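(* Let $p$ be a radial weight and let $r_0>0$ be such that $r\mapsto p(r)$ is positive and of class $C^2$ on $[r_0,\infty)$ and, with $q(t):=\ln p(e^t)$, (1) $q$ is convex on $[\ln r_0,\infty)$; (2) $q'(\ln r_0)>0$ and $r\mapsto \dfrac{r}{q'(\ln r)}$ is increasing (in the wide sense, i.e. nondecreasing) on $[r_0,\infty)$. Let $V=\{(z_j,m_j)\}_{j\in\mathbb{N}}$ be a multiplicity variety. Then $V$ is an interpolating variety for $A_p(\mathbb{C})$ if and only if there exist constants $A,B>0$ such that for all $j$ with $|z_j|\ge r_0$ $$N\left(z_j,\max\left(\frac{|z_j|}{q'(\ln|z_j|)},\,e\right)\right)\le A\,p(z_j)+B.$$
   Context: A weight is a subharmonic function $p:\mathbb{C}\to[0,\infty)$ such that (a) $\ln(1+|z|^2)=O(p(z))$ as $|z|\to\infty$; (b) there exist constants $C_1,C_2>0$ such that $|z-w|\le 1$ implies $p(w)\le C_1p(z)+C_2$. The weight is radial if $p(z)=p(|z|)$ for all $z$; then $p(r)$, $r\ge0$, denotes the common value of $p$ on $|z|=r$. $A_p(\mathbb{C})$ is the space of entire functions $f$ for which there exist $A,B>0$ with $|f(z)|\le Ae^{Bp(z)}$ for all $z\in\mathbb{C}$. A multiplicity variety $V=\{(z_j,m_j)\}_{j\in\mathbb{N}}$ consists of a sequence of (pairwise distinct) points $z_j\in\mathbb{C}$ with $|z_j|\to\infty$ and a sequence of positive integers $m_j$. $V$ is an interpolating variety for $A_p(\mathbb{C})$ if for every family $\{w_{j,l}\}_{j\in\mathbb{N},\,0\le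 l<m_j}$ of complex numbers for which there exist $A,B>0$ with $\sum_{l=0}^{m_j-1}|w_{j,l}|\le Ae^{Bp(z_j)}$ for all $j$, there is $f\in A_p(\mathbb{C})$ with $f^{(l)}(z_j)/l!=w_{j,l}$ for all $j\in\mathbb{N}$ and $0\le l<m_j$. For $z\in\mathbb{C}$ and $r>0$, $n(z,r)=\sum_{|z-z_j|\le r}m_j$ (and $n(z,0)$ is $m_j$ if $z=z_j$ for some $j$, and $0$ otherwise), and $$N(z,r)=\int_0^r\frac{n(z,t)-n(z,0)}{t}\,dt+n(z,0)\ln r=\sum_{0<|z-z_j|\le r}m_j\ln\frac{r}{|z-z_j|}+n(z,0)\ln r.$$ Here $e$ is the base of natural logarithms. At the endpoint $\ln r_0$, derivatives are one-sided. *)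

theory Defs
  imports "HOL-Complex_Analysis.Complex_Analysis" "HOL-Library.Landau_Symbols"
begin

(* Real-valued subharmonic functions on the plane: upper semicontinuity plus the sub-mean-value
   inequality on all circles.  A subharmonic function that is finite somewhere is integrable over
   every circle, so the integrability clause is no extra restriction; it only prevents the
   convention that the integral of a non-integrable function is 0 from playing a role. *)
definition subharmonic :: "(complex \<Rightarrow> real) \<Rightarrow> bool" where
  "subharmonic u \<longleftrightarrow>
     (\<forall>a. open {z. u z < a}) \<and>
     (\<forall>z. \<forall>r>0. (\<lambda>\<theta>. u (z + of_real r * cis \<theta>)) absolutely_integrable_on {0..2*pi} \<and>
        u z \<le> 1 / (2*pi) * integral {0..2*pi} (\<lambda>\<theta>. u (z + of_real r * cis \<theta>)))"

definition weight :: "(complex \<Rightarrow> real) \<Rightarrow> bool" where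
  "weight p \<longleftrightarrow>
     (\<forall>z. p z \<ge> 0) \<and> subharmonic p \<and>
     (\<lambda>z. ln (1 + (norm z)\<^sup>2)) \<in> O[at_infinity](p) \<and>
     (\<exists>C1>0. \<exists>C2>0. \<forall>z w. norm (z - w) \<le> 1 \<longrightarrow> p w \<le> C1 * p z + C2)"

definition radial :: "(complex \<Rightarrow> real) \<Rightarrow> bool" where
  "radial p \<longleftrightarrow> (\<forall>z. p z = p (of_real (norm z)))"

definition A_space :: "(complex \<Rightarrow> real) \<Rightarrow> (complex \<Rightarrow> complex) set" where
  "A_space p = {f. f holomorphic_on UNIV \<and>
                   (\<exists>A>0. \<exists>B>0. \<forall>z. norm (f z) \<le> A * exp (B * p z))}"

definition multiplicity_variety :: "(nat \<Rightarrow> complex) \<Rightarrow> (nat \<Rightarrow> nat) \<Rightarrow> bool" where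
  "multiplicity_variety z m \<longleftrightarrow>
     inj z \<and> filterlim (\<lambda>j. norm (z j)) at_top sequentially \<and> (\<forall>j. m j > 0)"

definition interpolating_variety ::
  "(complex \<Rightarrow> real) \<Rightarrow> (nat \<Rightarrow> complex) \<Rightarrow> (nat \<Rightarrow> nat) \<Rightarrow> bool" where
  "interpolating_variety p z m \<longleftrightarrow>
     (\<forall>w :: nat \<Rightarrow> nat \<Rightarrow> complex.
        (\<exists>A>0. \<exists>B>0. \<forall>j. (\<Sum>l<m j. norm (w j l)) \<le> A * exp (B * p (z j))) \<longrightarrow>
        (\<exists>f\<in>A_space p. \<forall>j. \<forall>l<m j. (deriv ^^ l) f (z j) / fact l = w j l))"

(* For pairwise distinct z j the value at r = 0 is the multiplicity of a (0 if a is not a z j). *)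
definition n_count :: "(nat \<Rightarrow> complex) \<Rightarrow> (nat \<Rightarrow> nat) \<Rightarrow> complex \<Rightarrow> real \<Rightarrow> nat" where
  "n_count z m a r = (\<Sum>j | norm (a - z j) \<le> r. m j)"

definition N_count :: "(nat \<Rightarrow> complex) \<Rightarrow> (nat \<Rightarrow> nat) \<Rightarrow> complex \<Rightarrow> real \<Rightarrow> real" where
  "N_count z m a r =
     integral {0..r} (\<lambda>t. (real (n_count z m a t) - real (n_count z m a 0)) / t)
       + real (n_count z m a 0) * ln r"

(* q(t) = ln p(e^t) *)
definition log_profile :: "(complex \<Rightarrow> real) \<Rightarrow> real \<Rightarrow> real" where
  "log_profile p t = ln (p (of_real (exp t)))"

(* Derivatives relative to S, hence one-sided at an endpoint of an interval S. *)
definition C2_on :: "(real \<Rightarrow> real) \<Rightarrow> real set \<Rightarrow> bool" where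
  "C2_on f S \<longleftrightarrow>
     (\<exists>f' f''. (\<forall>x\<in>S. (f has_real_derivative f' x) (at x within S)) \<and>
               (\<forall>x\<in>S. (f' has_real_derivative f'' x) (at x within S)) \<and>
               continuous_on S f'')"

lemma finite_multiplicity_variety_disc:
  assumes "multiplicity_variety z m"
  shows "finite {j. norm (a - z j) \<le> r}"
proof -
  have "eventually (\<lambda>j. norm (z j) > norm a + r) sequentially"
    using assms by (auto simp: multiplicity_variety_def filterlim_at_top_dense)
  then obtain M where M: "\<And>j. j \<ge> M \<Longrightarrow> norm (z j) > norm a + r"
    by (auto simp: eventually_sequentially)
  have "{j. norm (a - z j) \<le> r} \<subseteq> {..<M}"
  proof
    fix j assume "j \<in> {j. norm (a - z j) \<le> r}"
    then have "norm (z j) \<le> norm a + r"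
      using norm_triangle_ineq2[of "z j" a] by (simp add: norm_minus_commute)
    then show "j \<in> {..<M}" using M[of j] by (cases "j < M") auto
  qed
  then show ?thesis by (rule finite_subset) simp
qed

lemma N_count_eq_sum:
  assumes V: "multiplicity_variety z m" and r: "r > 0"
  shows "N_count z m a r =
    (\<Sum>j | 0 < norm (a - z j) \<and> norm (a - z j) \<le> r. real (m j) * ln (r / norm (a - z j)))
      + real (n_count z m a 0) * ln r"
proof -
  define d where "d j = norm (a - z j)" for j
  define G where "G = {j. 0 < d j \<and> d j \<le> r}"
  have fin: "finite {j. d j \<le> s}" for s
    using finite_multiplicity_variety_disc[OF V] by (simp add: d_def)
  have finG: "finite G" unfolding G_def by (rule finite_subset[OF _ fin[of r]]) auto
  have eq: "(real (n_count z m a t) - real (n_count z m a 0)) / t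
      = (\<Sum>j\<in>G. if t \<in> {d j..r} then real (m j) / t else 0)" if t: "t \<in> {0..r}" for t
  proof -
    have u: "{j. d j \<le> t} = {j. d j \<le> 0} \<union> {j\<in>G. d j \<le> t}"
      using t by (auto simp: G_def d_def)
    have "n_count z m a t = n_count z m a 0 + (\<Sum>j\<in>{j\<in>G. d j \<le> t}. m j)"
      unfolding n_count_def d_def[symmetric] u
      by (rule sum.union_disjoint) (use fin finG in \<open>auto simp: G_def\<close>)
    moreover have "(\<Sum>j\<in>G. if t \<in> {d j..r} then real (m j) / t else 0)
        = (\<Sum>j\<in>{j\<in>G. d j \<le> t}. real (m j) / t)"
      using t finG by (simp add: sum.inter_filter)
    ultimately show ?thesis by (simp add: sum_divide_distrib)
  qed
  have int: "((\<lambda>t. if t \<in> {d j..r} then real (m j) / t else 0)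
      has_integral real (m j) * ln (r / d j)) {0..r}" if j: "j \<in> G" for j
  proof -
    have d: "0 < d j" "d j \<le> r" using j by (auto simp: G_def)
    have "((\<lambda>t. real (m j) / t) has_integral real (m j) * ln r - real (m j) * ln (d j)) {d j..r}"
      by (rule fundamental_theorem_of_calculus)
         (use d in \<open>auto intro!: derivative_eq_intros
            simp: has_real_derivative_iff_has_vector_derivative[symmetric]\<close>)
    moreover have "real (m j) * ln r - real (m j) * ln (d j) = real (m j) * ln (r / d j)"
      using d r by (simp add: ln_div algebra_simps)
    ultimately show ?thesis
      using d by (subst has_integral_restrict) auto
  qed
  have "((\<lambda>t. (real (n_count z m a t) - real (n_count z m a 0)) / t)
      has_integral (\<Sum>j\<in>G. real (m j) * ln (r / d j))) {0..r}"
    using has_integral_sum[OF finG int] by (subst has_integral_cong[OF eq])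
  then show ?thesis
    unfolding N_count_def by (simp add: integral_unique G_def d_def)
qed

end

theory Submission
  imports Defs
begin

text \<open>
The number \<open>R(\<zeta>) = |\<zeta>| / q'(ln |\<zeta>|)\<close> is a distance over which \<open>p\<close> grows by at most a factor \<open>e\<close>
from its value at \<open>\<zeta>\<close>. The condition on \<open>N\<close> says that the disc of radius comparable to \<open>R(z\<^sub>j)\<close> around \<open>z\<^sub>j\<close> contains
\<open>O(p(z\<^sub>j))\<close> points of the variety, counted with multiplicity, and that they are not too close to \<open>z\<^sub>j\<close>.

Necessity: a Baire argument on the data with values \<open>0\<close> and \<open>1\<close> gives one pair of constants for all
functions that have, on the whole variety, the jets \<open>0\<close> except for the coefficient \<open>1\<close> of order
\<open>m\<^sub>j - 1\<close> at \<open>z\<^sub>j\<close> (\<open>uniform_fundamental_functions\<close>). Jensen's inequality for such a function on the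
circle of radius \<open>max(R(z\<^sub>j), e)\<close> bounds \<open>N\<close>, because \<open>p = O(p(z\<^sub>j))\<close> on that circle.

Sufficiency: convexity of \<open>q\<close> gives \<open>p(z) \<ge> p(\<zeta>) |z/\<zeta>|\<^sup>\<kappa>\<close> with \<open>\<kappa> = q'(ln |\<zeta>|)\<close>, so near \<open>\<zeta>\<close> the
weight is at least as curved as a power. It follows that for every large \<open>b\<close> there is a polynomial
\<open>K\<close> in \<open>z/\<zeta>\<close> with \<open>K = 1\<close> at \<open>\<zeta>\<close> and
\<open>|K(z)| \<le> exp(b p(z) - b p(\<zeta>) - c b p(\<zeta>))\<close> as soon as \<open>|z - \<zeta>|\<close> exceeds a small multiple of \<open>R(\<zeta>)\<close>
(\<open>peak_function\<close>); here \<open>c > 0\<close> does not depend on \<open>b\<close>. To prescribe a jet at \<open>\<zeta> = z\<^sub>j\<close> and kill the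
points of the variety near \<open>z\<^sub>j\<close>, one multiplies \<open>K\<close> by a product of linear factors and a Taylor
polynomial, which by the hypothesis costs only \<open>exp(C p(z\<^sub>j))\<close> with \<open>C\<close> independent of \<open>b\<close>
(\<open>local_interpolant\<close>). For large \<open>b\<close> the gain \<open>c b\<close> beats \<open>C\<close>: at every point of the variety, the jet
of the sum of the local interpolants of the other points is small compared with \<open>exp(B p)\<close>, the size of
the data, where \<open>B\<close> is slightly larger than \<open>b\<close>. So this sum solves the interpolation problem with relative
error \<open>1/2\<close> (\<open>approximate_interpolation\<close>), and iterating on the error gives an exact solution. The
variety is thus sparse for the weight \<open>B p\<close>, \<open>B \<rightarrow> \<infinity>\<close>, and interpolation in \<open>A\<^sub>p\<close> allows such a \<open>B\<close>.
The argument uses points with \<open>|z\<^sub>j| \<ge> 2 r\<^sub>0\<close>; the finitely many others are adjoined one by one with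
the help of functions in the algebra \<open>A\<^sub>p\<close> that vanish on the rest (\<open>interpolates_on_insert\<close>).
\<close>

unbundle no vec_syntax

section \<open>Taylor coefficients of entire functions\<close>

lemma fps_expansion_eqI:
  assumes "(\<lambda>x. f (a + x)) has_fps_expansion F"
  shows "fps_expansion f a = F"
  using fps_nth_fps_expansion[OF assms]
  by (intro fps_ext) (simp add: fps_expansion_def higher_deriv_shift_0' o_def)

lemma entire_has_fps_expansion:
  assumes "f holomorphic_on UNIV"
  shows "(\<lambda>x. f (a + x)) has_fps_expansion fps_expansion f a"
  using assms by (intro analytic_at_imp_has_fps_expansion) (auto simp: analytic_at)

lemma fps_expansion_entire_mult:
  assumes "f holomorphic_on UNIV" "g holomorphic_on UNIV"
  shows "fps_expansion (\<lambda>z. f z * g z) a = fps_expansion f a * fps_expansion g a"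
  by (intro fps_expansion_eqI has_fps_expansion_mult entire_has_fps_expansion assms)

lemma fps_expansion_entire_add:
  assumes "f holomorphic_on UNIV" "g holomorphic_on UNIV"
  shows "fps_expansion (\<lambda>z. f z + g z) a = fps_expansion f a + fps_expansion g a"
  by (intro fps_expansion_eqI has_fps_expansion_add entire_has_fps_expansion assms)

lemma fps_expansion_entire_diff:
  assumes "f holomorphic_on UNIV" "g holomorphic_on UNIV"
  shows "fps_expansion (\<lambda>z. f z - g z) a = fps_expansion f a - fps_expansion g a"
  by (intro fps_expansion_eqI has_fps_expansion_diff entire_has_fps_expansion assms)

lemma fps_expansion_entire_sum:
  assumes "\<And>i. i \<in> I \<Longrightarrow> f i holomorphic_on UNIV"
  shows "fps_expansion (\<lambda>z. \<Sum>i\<in>I. f i z) a = (\<Sum>i\<in>I. fps_expansion (f i) a)"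
  by (intro fps_expansion_eqI has_fps_expansion_sum entire_has_fps_expansion assms)

lemma fps_expansion_linear_power:
  "fps_expansion (\<lambda>z. (z - b) ^ n) a = (fps_X + fps_const (a - b)) ^ n"
proof (rule fps_expansion_eqI)
  have "(\<lambda>x. (x + (a - b)) ^ n) has_fps_expansion (fps_X + fps_const (a - b)) ^ n"
    by (intro fps_expansion_intros)
  then show "(\<lambda>x. (a + x - b) ^ n) has_fps_expansion (fps_X + fps_const (a - b)) ^ n"
    by (simp add: algebra_simps)
qed

lemma fps_expansion_Taylor_polynomial:
  "fps_expansion (\<lambda>z. \<Sum>l<m. c l * (z - a) ^ l) a $ l = (if l < m then c l else 0)"
proof -
  have "(\<lambda>x. \<Sum>l<m. c l * x ^ l) has_fps_expansion (\<Sum>l<m. fps_const (c l) * fps_X ^ l)"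
    by (intro has_fps_expansion_sum has_fps_expansion_cmult_left has_fps_expansion_fps_X_power)
  then have "fps_expansion (\<lambda>z. \<Sum>l<m. c l * (z - a) ^ l) a = (\<Sum>l<m. fps_const (c l) * fps_X ^ l)"
    by (intro fps_expansion_eqI) simp
  moreover have "(\<Sum>l<m. fps_const (c l) * fps_X ^ l) $ l = (\<Sum>i<m. if i = l then c l else 0)"
    unfolding fps_sum_nth by (intro sum.cong) auto
  ultimately show ?thesis by simp
qed

lemma fps_expansion_Cauchy_bound:
  assumes "f holomorphic_on ball a r" "continuous_on (cball a r) f" "r > 0"
    and "\<And>z. norm (z - a) = r \<Longrightarrow> norm (f z) \<le> B"
  shows "norm (fps_expansion f a $ l) \<le> B / r ^ l"
proof -
  have "norm ((deriv ^^ l) f a) \<le> fact l * B / r ^ l"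
    using assms by (intro Cauchy_inequality) (auto simp: norm_minus_commute)
  then show ?thesis
    by (simp add: fps_expansion_def norm_divide field_simps)
qed

lemma fps_expansion_Cauchy_bound_entire:
  assumes "f holomorphic_on UNIV" "r > 0"
    and "\<And>z. norm (z - a) = r \<Longrightarrow> norm (f z) \<le> B"
  shows "norm (fps_expansion f a $ l) \<le> B / r ^ l"
  using assms by (intro fps_expansion_Cauchy_bound)
    (auto intro: holomorphic_on_subset holomorphic_on_imp_continuous_on)

lemma fps_mult_nth_eq_0:
  fixes F G :: "'a::comm_ring_1 fps"
  assumes "\<forall>l<m. F $ l = 0" "l < m"
  shows "(F * G) $ l = 0"
  using assms by (auto simp: fps_mult_nth intro!: sum.neutral)

lemma fps_mult_nth_cong:
  fixes F G :: "'a::comm_ring_1 fps"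
  assumes "\<forall>l<m. G $ l = H $ l" "l < m"
  shows "(F * G) $ l = (F * H) $ l"
  using assms by (auto simp: fps_mult_nth intro!: sum.cong)

lemma entire_divide_root:
  assumes f: "f holomorphic_on UNIV" and "f a = 0"
  shows "\<exists>h. h holomorphic_on UNIV \<and> (\<forall>z. f z = (z - a) * h z)"
proof -
  define h where "h z = (if z = a then deriv f a else f z / (z - a))" for z
  have "h holomorphic_on UNIV"
    by (rule pole_theorem_open_0[OF f]) (auto simp: h_def assms)
  moreover have "f z = (z - a) * h z" for z
    using assms by (auto simp: h_def)
  ultimately show ?thesis by blast
qed

lemma entire_divide_zero:
  assumes "f holomorphic_on UNIV" and "\<forall>l<m. fps_expansion f a $ l = 0"
  shows "\<exists>h. h holomorphic_on UNIV \<and> (\<forall>z. f z = (z - a) ^ m * h z)"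
  using assms
proof (induction m arbitrary: f)
  case 0
  then show ?case by auto
next
  case (Suc m)
  have "f a = 0" using Suc.prems(2) by (auto simp: fps_expansion_def dest: spec[of _ 0])
  then obtain h where h: "h holomorphic_on UNIV" "\<And>z. f z = (z - a) * h z"
    using entire_divide_root[OF Suc.prems(1)] by blast
  have "fps_expansion f a = fps_expansion (\<lambda>z. (z - a) ^ 1 * h z) a"
    by (intro arg_cong[where f="\<lambda>f. fps_expansion f a"]) (auto simp: h)
  also have "\<dots> = fps_X * fps_expansion h a"
    by (subst fps_expansion_entire_mult; (unfold fps_expansion_linear_power)?)
       (auto intro!: holomorphic_intros h)
  finally have eq: "fps_expansion f a = fps_X * fps_expansion h a" .
  have "\<forall>l<m. fps_expansion h a $ l = 0"
  proof (intro allI impI)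
    fix l assume "l < m"
    then have "fps_expansion f a $ Suc l = 0" using Suc.prems(2) by simp
    then show "fps_expansion h a $ l = 0" by (simp add: eq)
  qed
  from Suc.IH[OF h(1) this] obtain g where
    "g holomorphic_on UNIV" "\<forall>z. h z = (z - a) ^ m * g z" by blast
  then show ?case using h by (intro exI[of _ g]) auto
qed

lemma fps_expansion_vanish_mult:
  assumes "f holomorphic_on UNIV" "g holomorphic_on UNIV"
    and "\<forall>l<m. fps_expansion f a $ l = 0" and "l < m"
  shows "fps_expansion (\<lambda>z. f z * g z) a $ l = 0"
  using assms by (simp add: fps_expansion_entire_mult fps_mult_nth_eq_0)

lemma fps_expansion_vanish_power:
  assumes "h holomorphic_on UNIV" "l < m"
  shows "fps_expansion (\<lambda>z. (z - a) ^ m * h z) a $ l = 0"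
  using assms
  by (subst fps_expansion_entire_mult)
     (auto intro!: holomorphic_intros simp: fps_expansion_linear_power fps_X_power_mult_nth)

text \<open>The Taylor series of \<open>g\<close> at \<open>a\<close> is a unit in the ring of power series.\<close>

lemma fps_expansion_vanish_cancel:
  assumes "g holomorphic_on UNIV" "h holomorphic_on UNIV" "g a \<noteq> 0"
    and "\<forall>l<m. fps_expansion (\<lambda>z. g z * h z) a $ l = 0" and "l < m"
  shows "fps_expansion h a $ l = 0"
proof -
  define G where "G = fps_expansion g a"
  have "G $ 0 \<noteq> 0" using assms(3) by (simp add: G_def fps_expansion_def)
  then have "inverse G * G = 1" by (rule inverse_mult_eq_1)
  moreover have "(G * fps_expansion h a) * inverse G = fps_expansion h a * (inverse G * G)"
    by (simp only: mult_ac)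
  ultimately have "fps_expansion h a = (G * fps_expansion h a) * inverse G"
    by (simp only: mult_1_right)
  moreover have "((G * fps_expansion h a) * inverse G) $ l = 0"
    using assms(4,5) by (intro fps_mult_nth_eq_0[of m])
       (auto simp: G_def fps_expansion_entire_mult[OF assms(1,2), symmetric])
  ultimately show ?thesis by (simp only:)
qed

text \<open>Prescribing the jet of a product \<open>F \<cdot> Q\<close> at a point where \<open>F\<close> does not vanish amounts to
  taking for \<open>Q\<close> a Taylor polynomial of the quotient; Cauchy's estimates bound its coefficients.\<close>

lemma jet_quotient:
  fixes v :: "nat \<Rightarrow> complex"
  assumes F: "F holomorphic_on UNIV" and r: "r > 0" and c: "c > 0"
    and Fc: "\<And>z. norm (z - a) \<le> r \<Longrightarrow> norm (F z) \<ge> c"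
    and M: "\<And>z. norm (z - a) = r \<Longrightarrow> norm (\<Sum>l<m. v l * (z - a) ^ l) \<le> M"
  shows "\<exists>\<psi>. (\<forall>l<m. fps_expansion (\<lambda>z. F z * (\<Sum>l<m. \<psi> l * (z - a) ^ l)) a $ l = v l) \<and>
             (\<forall>l. norm (\<psi> l) \<le> (M / c) / r ^ l)"
proof -
  define W where "W z = (\<Sum>l<m. v l * (z - a) ^ l)" for z
  define G where "G z = W z / F z" for z
  have W: "W holomorphic_on UNIV" unfolding W_def by (intro holomorphic_intros)
  have nz: "F z \<noteq> 0" if "z \<in> cball a r" for z
    using Fc[of z] that c by (auto simp: dist_norm norm_minus_commute)
  have Gh: "G holomorphic_on ball a r" unfolding G_def
    using nz by (intro holomorphic_on_divide holomorphic_on_subset[OF W] holomorphic_on_subset[OF F]) auto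
  have Gc: "continuous_on (cball a r) G" unfolding G_def
    using nz holomorphic_on_imp_continuous_on[OF W] holomorphic_on_imp_continuous_on[OF F]
    by (intro continuous_on_divide) (auto intro: continuous_on_subset)
  define \<psi> where "\<psi> l = fps_expansion G a $ l" for l
  have bd: "norm (\<psi> l) \<le> (M / c) / r ^ l" for l
    unfolding \<psi>_def
  proof (rule fps_expansion_Cauchy_bound[OF Gh Gc r])
    fix z assume z: "norm (z - a) = r"
    have "norm (W z) / norm (F z) \<le> M / c"
      using M[OF z] Fc[of z] z c by (intro frac_le) (auto simp: W_def intro: order_trans[OF norm_ge_zero])
    then show "norm (G z) \<le> M / c" by (simp add: G_def norm_divide)
  qed
  have "(\<lambda>x. G (a + x)) has_fps_expansion fps_expansion G a"
  proof (intro analytic_at_imp_has_fps_expansion)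
    show "G analytic_on {a}"
      unfolding analytic_at using Gh r by (intro exI[of _ "ball a r"]) simp
  qed
  then have "(\<lambda>x. F (a + x) * G (a + x)) has_fps_expansion fps_expansion F a * fps_expansion G a"
    by (rule has_fps_expansion_mult[OF entire_has_fps_expansion[OF F]])
  moreover have ev: "eventually (\<lambda>x. F (a + x) * G (a + x) = W (a + x)) (nhds 0)"
  proof -
    have "eventually (\<lambda>x::complex. x \<in> ball 0 r) (nhds 0)"
      using r by (intro eventually_nhds_in_open) auto
    then show ?thesis
    proof eventually_elim
      case (elim x)
      then have "F (a + x) \<noteq> 0" by (intro nz) (auto simp: dist_norm)
      then show ?case by (simp add: G_def)
    qed
  qed
  ultimately have "(\<lambda>x. W (a + x)) has_fps_expansion fps_expansion F a * fps_expansion G a"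
    using has_fps_expansion_cong[OF ev refl] by blast
  then have FG: "fps_expansion F a * fps_expansion G a = fps_expansion W a"
    using fps_expansion_eqI by metis
  have "fps_expansion (\<lambda>z. F z * (\<Sum>l<m. \<psi> l * (z - a) ^ l)) a $ l = v l" if l: "l < m" for l
  proof -
    have "fps_expansion (\<lambda>z. F z * (\<Sum>l<m. \<psi> l * (z - a) ^ l)) a
        = fps_expansion F a * fps_expansion (\<lambda>z. \<Sum>l<m. \<psi> l * (z - a) ^ l) a"
      by (intro fps_expansion_entire_mult F holomorphic_intros)
    also have "\<dots> $ l = (fps_expansion F a * fps_expansion G a) $ l"
      using l by (intro fps_mult_nth_cong) (auto simp: fps_expansion_Taylor_polynomial \<psi>_def)
    also have "\<dots> = v l"
      unfolding FG W_def using l by (simp add: fps_expansion_Taylor_polynomial)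
    finally show ?thesis .
  qed
  with bd show ?thesis by blast
qed

lemma fps_expansion_uniform_limit:
  assumes f: "\<And>n. f n holomorphic_on UNIV" and g: "g holomorphic_on UNIV"
    and lim: "uniform_limit (cball a 1) f g sequentially"
  shows "(\<lambda>n. fps_expansion (f n) a $ l) \<longlonglongrightarrow> fps_expansion g a $ l"
proof (rule tendstoI)
  fix e :: real assume e: "e > 0"
  have "eventually (\<lambda>n. \<forall>z\<in>cball a 1. dist (f n z) (g z) < e / 2) sequentially"
    using uniform_limitD[OF lim, of "e/2"] e by simp
  then show "eventually (\<lambda>n. dist (fps_expansion (f n) a $ l) (fps_expansion g a $ l) < e) sequentially"
  proof eventually_elim
    case (elim n)
    have "norm (fps_expansion (\<lambda>z. f n z - g z) a $ l) \<le> (e / 2) / 1 ^ l"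
    proof (rule fps_expansion_Cauchy_bound_entire)
      show "norm (f n z - g z) \<le> e / 2" if "norm (z - a) = 1" for z
        using elim[rule_format, of z] that by (auto simp: dist_norm norm_minus_commute)
    qed (auto intro!: holomorphic_intros f g)
    then show ?case
      using e by (simp add: fps_expansion_entire_diff[OF f g] dist_norm)
  qed
qed

text \<open>Functions built from infinitely many points, or from infinitely many correction steps, are sums
of such series; the majorant \<open>c j * M z\<close> separates the index from the point, so that one
bound gives the growth of the sum and the convergence of its Taylor coefficients.\<close>

lemma entire_series:
  fixes f :: "nat \<Rightarrow> complex \<Rightarrow> complex"
  assumes f: "\<And>j. f j holomorphic_on UNIV" and c: "summable c"
    and bd: "\<And>j z. norm (f j z) \<le> c j * M z"
    and M: "\<And>r. \<exists>B. \<forall>z. norm z \<le> r \<longrightarrow> M z \<le> B"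
    and c0: "\<And>j. c j \<ge> 0"
  shows "(\<lambda>z. \<Sum>j. f j z) holomorphic_on UNIV"
    and "norm (\<Sum>j. f j z) \<le> (\<Sum>j. c j) * M z"
    and "(\<lambda>j. fps_expansion (f j) a $ l) sums (fps_expansion (\<lambda>z. \<Sum>j. f j z) a $ l)"
proof -
  have ul: "uniform_limit (cball x 1) (\<lambda>n z. \<Sum>j<n. f j z) (\<lambda>z. \<Sum>j. f j z) sequentially" for x
  proof -
    obtain B where B: "\<And>z. norm z \<le> norm x + 1 \<Longrightarrow> M z \<le> B" using M[of "norm x + 1"] by blast
    show ?thesis
    proof (rule Weierstrass_m_test)
      show "summable (\<lambda>j. c j * B)" using c by (rule summable_mult2)
      fix j z assume "z \<in> cball x 1"
      then have "norm z \<le> norm x + 1"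
        using norm_triangle_sub[of z x] by (auto simp: dist_norm norm_minus_commute)
      then show "norm (f j z) \<le> c j * B"
        using bd[of j z] B[of z] c0[of j] by (meson mult_left_mono order_trans)
    qed
  qed
  show hol: "(\<lambda>z. \<Sum>j. f j z) holomorphic_on UNIV"
  proof (rule holomorphic_uniform_sequence[where f="\<lambda>n z. \<Sum>j<n. f j z"])
    show "\<exists>d>0. cball x d \<subseteq> UNIV \<and>
        uniform_limit (cball x d) (\<lambda>n z. \<Sum>j<n. f j z) (\<lambda>z. \<Sum>j. f j z) sequentially" for x
      using ul[of x] by (intro exI[of _ 1]) simp
    show "(\<lambda>z. \<Sum>j<n. f j z) holomorphic_on UNIV" for n
      by (intro holomorphic_intros f)
  qed simp
  have sm: "summable (\<lambda>j. c j * M z)" using c by (rule summable_mult2)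
  then have sf: "summable (\<lambda>j. norm (f j z))"
    using bd by (intro summable_comparison_test[OF _ sm]) auto
  have "norm (\<Sum>j. f j z) \<le> (\<Sum>j. norm (f j z))" using sf by (rule summable_norm)
  also have "\<dots> \<le> (\<Sum>j. c j * M z)" using bd sf sm by (intro suminf_le) auto
  also have "\<dots> = (\<Sum>j. c j) * M z" using c by (rule suminf_mult2[symmetric])
  finally show "norm (\<Sum>j. f j z) \<le> (\<Sum>j. c j) * M z" .
  have "(\<lambda>n. fps_expansion (\<lambda>z. \<Sum>j<n. f j z) a $ l) \<longlonglongrightarrow> fps_expansion (\<lambda>z. \<Sum>j. f j z) a $ l"
    by (intro fps_expansion_uniform_limit hol ul) (auto intro!: holomorphic_intros f)
  then show "(\<lambda>j. fps_expansion (f j) a $ l) sums (fps_expansion (\<lambda>z. \<Sum>j. f j z) a $ l)"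
    unfolding sums_def by (simp add: fps_expansion_entire_sum f fps_sum_nth)
qed

section \<open>Peak functions\<close>

text \<open>The average of \<open>1, x, \<dots>, x ^ (S - 1)\<close> is a Dirichlet kernel: it is \<open>1\<close> at \<open>x = 1\<close> and decays like
\<open>1 / (S |x - 1|)\<close> on the unit circle. A power of it localises in the angle at distance \<open>1 / S\<close>.\<close>

lemma geometric_average_le:
  fixes x :: complex
  assumes "S > 0"
  shows "norm ((\<Sum>i<S. x ^ i) / of_nat S) \<le> max 1 (norm x) ^ S / max 1 (real S * norm (x - 1) / 2)"
proof -
  define X where "X = max 1 (norm x)"
  have X: "X \<ge> 1" "norm x \<le> X" by (auto simp: X_def)
  define g where "g = norm (\<Sum>i<S. x ^ i)"
  have "g \<le> (\<Sum>i<S. norm (x ^ i))" unfolding g_def by (rule norm_sum)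
  also have "\<dots> \<le> (\<Sum>i<S. X ^ S)"
  proof (intro sum_mono)
    fix i assume "i \<in> {..<S}"
    then have "norm x ^ i \<le> X ^ i" "X ^ i \<le> X ^ S"
      using X by (auto intro!: power_mono power_increasing)
    then show "norm (x ^ i) \<le> X ^ S" by (simp add: norm_power)
  qed
  finally have g1: "g / real S \<le> X ^ S" using assms by (simp add: field_simps)
  have "norm (x - 1) * g = norm (x ^ S - 1)"
    unfolding g_def using power_diff_1_eq[of x S] assms by (simp add: norm_mult)
  also have "\<dots> \<le> norm x ^ S + 1"
    using norm_triangle_ineq4[of "x ^ S" 1] by (simp add: norm_power)
  also have "\<dots> \<le> 2 * X ^ S"
    using power_mono[OF X(2), of S] one_le_power[OF X(1), of S] by simp
  finally have "g / real S * (real S * norm (x - 1) / 2) \<le> X ^ S"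
    using assms by (simp add: field_simps)
  with g1 have "g / real S * max 1 (real S * norm (x - 1) / 2) \<le> X ^ S"
    by (cases "1 \<le> real S * norm (x - 1) / 2") (simp_all only: max_def if_True if_False mult_1_right)
  then show ?thesis
    by (simp add: norm_divide g_def X_def pos_le_divide_eq)
qed

lemma exp_neg_double_le: "0 \<le> y \<Longrightarrow> y \<le> 1/2 \<Longrightarrow> exp (- (2 * y)) \<le> 1 - (y::real)"
proof -
  assume y: "0 \<le> y" "y \<le> 1/2"
  have "- y - 2 * y\<^sup>2 \<le> ln (1 - y)" using y by (rule ln_one_minus_pos_lower_bound)
  moreover have "y\<^sup>2 \<le> y / 2" using y mult_left_mono[of y "1/2" y] by (simp add: power2_eq_square)
  ultimately have "- (2 * y) \<le> ln (1 - y)" by linarith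
  then show ?thesis using y by (subst ln_ge_iff[symmetric]) auto
qed


lemma geometric_average_ge:
  fixes x :: complex
  assumes S: "S > 0" and s: "real S * norm (x - 1) \<le> s" "s \<le> 1/4"
  shows "exp (- (4 * s)) \<le> norm ((\<Sum>i<S. x ^ i) / of_nat S)"
proof -
  define h where "h = norm (x - 1)"
  have h: "h \<ge> 0" by (simp add: h_def)
  have s0: "s \<ge> 0" using s h by (auto simp: h_def intro: order_trans[rotated])
  have pw: "norm (x ^ i - 1) \<le> (1 + h) ^ i - 1" for i
  proof (induction i)
    case (Suc i)
    have "norm x \<le> 1 + h" using norm_triangle_sub[of x 1] by (simp add: h_def)
    have "x ^ Suc i - 1 = x * (x ^ i - 1) + (x - 1)" by (simp add: algebra_simps)
    then have "norm (x ^ Suc i - 1) \<le> norm x * norm (x ^ i - 1) + h"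
      by (metis h_def norm_mult norm_triangle_ineq)
    also have "\<dots> \<le> (1 + h) * ((1 + h) ^ i - 1) + h"
      using \<open>norm x \<le> 1 + h\<close> Suc h by (intro add_right_mono mult_mono) auto
    finally show ?case by (simp add: algebra_simps)
  qed auto
  have pw2: "norm (x ^ i - 1) \<le> 2 * s" if "i < S" for i
  proof -
    have "(1 + h) ^ i \<le> exp h ^ i" using h exp_ge_add_one_self[of h] by (intro power_mono) auto
    also have "\<dots> = exp (real i * h)" by (simp add: exp_of_nat_mult)
    also have "\<dots> \<le> exp s"
    proof -
      have "real i * h \<le> real S * h" using that h by (intro mult_right_mono) auto
      then show ?thesis using s by (simp add: h_def)
    qed
    also have "\<dots> \<le> 1 + s + s\<^sup>2" using s0 s by (intro exp_bound) auto
    also have "s\<^sup>2 \<le> s" using s0 s mult_left_mono[of s 1 s] by (simp add: power2_eq_square)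
    finally show ?thesis using pw[of i] by simp
  qed
  have "(\<Sum>i<S. x ^ i) / of_nat S - 1 = (\<Sum>i<S. x ^ i - 1) / of_nat S"
    using S by (simp add: sum_subtractf field_simps)
  also have "norm \<dots> \<le> (\<Sum>i<S. 2 * s) / real S"
    unfolding norm_divide norm_of_nat
    using pw2 by (intro divide_right_mono order_trans[OF norm_sum] sum_mono) auto
  also have "\<dots> = 2 * s" using S by simp
  finally have "norm ((\<Sum>i<S. x ^ i) / of_nat S - 1) \<le> 2 * s" .
  then have "1 - 2 * s \<le> norm ((\<Sum>i<S. x ^ i) / of_nat S)"
    using norm_triangle_ineq2[of 1 "(\<Sum>i<S. x ^ i) / of_nat S"] by (simp add: norm_minus_commute)
  moreover have "exp (- (4 * s)) \<le> 1 - 2 * s"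
    using exp_neg_double_le[of "2 * s"] s0 s by simp
  ultimately show ?thesis by linarith
qed

text \<open>The maximum of \<open>ln (Y * max 1 Y powr \<eta>) - (Y - 1)\<close> is of second order in \<open>\<eta>\<close>. With
\<open>Y = |x| powr \<kappa>\<close>, this is why the localising factor, whose degree makes up the proportion \<open>\<eta>\<close> of the
whole degree, loses less than it gains.\<close>

lemma mult_max_powr_le_exp:
  fixes Y \<eta> :: real
  assumes "Y \<ge> 0" "\<eta> \<ge> 0"
  shows "Y * max 1 Y powr \<eta> \<le> exp (Y - 1 + \<eta>\<^sup>2)"
proof (cases "Y \<le> 1")
  case True
  have "Y \<le> exp (Y - 1)" using exp_ge_add_one_self[of "Y - 1"] by simp
  also have "\<dots> \<le> exp (Y - 1 + \<eta>\<^sup>2)" by simp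
  finally show ?thesis using True by (simp add: max_def)
next
  case False
  then have Y: "Y > 1" by simp
  have "ln Y = ln (Y / (1 + \<eta>)) + ln (1 + \<eta>)" using Y assms by (simp add: ln_div)
  also have "\<dots> \<le> (Y / (1 + \<eta>) - 1) + \<eta>"
    using Y assms by (intro add_mono ln_le_minus_one ln_add_one_self_le_self) auto
  finally have "(1 + \<eta>) * ln Y \<le> (1 + \<eta>) * (Y / (1 + \<eta>) - 1 + \<eta>)"
    using assms by (intro mult_left_mono) auto
  also have "\<dots> = Y - 1 + \<eta>\<^sup>2" using assms by (simp add: field_simps power2_eq_square)
  finally have "exp ((1 + \<eta>) * ln Y) \<le> exp (Y - 1 + \<eta>\<^sup>2)" by simp
  moreover have "Y * max 1 Y powr \<eta> = exp ((1 + \<eta>) * ln Y)"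
    using Y by (simp add: max_def powr_def exp_add[symmetric] ring_distribs)
       (simp add: exp_add)
  ultimately show ?thesis by simp
qed

text \<open>The function is \<open>x ^ n\<close>, with \<open>n\<close> close to the slope \<open>T * \<kappa>\<close> of \<open>T * |x| powr \<kappa>\<close> at \<open>|x| = 1\<close>
in the variable \<open>ln |x|\<close>, times the \<open>N\<close>-th power of the average of \<open>S\<close> powers of \<open>x\<close>. The choices
\<open>N \<approx> eps * T\<close> and \<open>S \<approx> lam * \<kappa>\<close> balance two effects: the kernel gains \<open>N\<close> logarithms of the scaled
distance \<open>lam / 2 * (\<kappa> * |x - 1|)\<close>, while its degree is at most the proportion \<open>\<eta> = 4 * eps * (lam + 1 / a)\<close> of
\<open>T * \<kappa>\<close> and so it costs at most \<open>\<eta>\<^sup>2 * T = eps / 4 * T\<close>. The last property is needed to divide by the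
peak function near its centre: its logarithm there is at least \<open>- 12 * s * T\<close>, with \<open>s\<close> as small
as we please.\<close>

lemma peak_function:
  fixes \<kappa> a T lam eps :: real
  assumes a: "a > 0" "a \<le> \<kappa>" and lam: "lam \<ge> 1"
    and eps: "eps = 1 / (64 * (lam + 1 / a)\<^sup>2)" and T: "eps * T \<ge> 1"
  obtains K :: "complex \<Rightarrow> complex" and N :: nat
  where "K holomorphic_on UNIV" "K 1 = 1" "eps * T \<le> real N"
    and "\<And>x. norm (K x) \<le> exp (T * norm x powr \<kappa> - T + eps / 4 * T)
                              / max 1 (lam / 2 * (\<kappa> * norm (x - 1))) ^ N"
    and "\<And>x s. \<kappa> * norm (x - 1) \<le> s \<Longrightarrow> s \<le> a / 2 \<Longrightarrow> (lam + 1 / a) * s \<le> 1/4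
            \<Longrightarrow> exp (- (12 * s * T)) \<le> norm (K x)"
proof -
  define lam' where "lam' = lam + 1 / a"
  have lam': "lam' \<ge> 1" "lam \<le> lam'" "lam' * a \<ge> 1"
    using lam a by (auto simp: lam'_def distrib_right intro: add_increasing2)
  have k0: "\<kappa> > 0" using a by simp
  have eps': "eps = 1 / (64 * lam'\<^sup>2)" by (simp add: eps lam'_def)
  have eps0: "eps > 0" using lam' by (simp add: eps')
  have el: "eps * lam' \<le> 1 / 64" "64 * eps * lam'\<^sup>2 = 1"
    using lam' by (simp_all add: eps' field_simps power2_eq_square)
  have T0: "T > 0" using T eps0 by (metis less_le_trans zero_less_mult_pos zero_less_one)
  have lk: "lam' * \<kappa> \<ge> 1" using lam' a by (meson mult_left_mono order_trans zero_le_one)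
  have e1: "eps \<le> 1"
  proof -
    have "64 * lam'\<^sup>2 \<ge> 1" using one_le_power[OF lam'(1), of 2] by linarith
    then show ?thesis unfolding eps' by (subst divide_le_eq_1_pos) linarith+
  qed
  have Tk: "T * \<kappa> \<ge> 1"
  proof -
    have "1 * 1 \<le> (eps * T) * (lam' * \<kappa>)" using T lk by (intro mult_mono) auto
    also have "\<dots> = (eps * lam') * (T * \<kappa>)" by simp
    also have "\<dots> \<le> 1 * (T * \<kappa>)" using el T0 k0 by (intro mult_right_mono) auto
    finally show ?thesis by simp
  qed
  define S where "S = nat \<lceil>lam * \<kappa>\<rceil>"
  define N where "N = nat \<lceil>eps * T\<rceil>"
  define n where "n = nat \<lceil>T * \<kappa>\<rceil>"
  have S: "lam * \<kappa> \<le> real S" "real S \<le> lam' * \<kappa>" "S > 0"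
  proof -
    show "lam * \<kappa> \<le> real S" unfolding S_def by linarith
    have "0 < lam * \<kappa>" using lam k0 by simp
    then show "S > 0" unfolding S_def by linarith
    have "real S \<le> lam * \<kappa> + 1" unfolding S_def using \<open>0 < lam * \<kappa>\<close> by linarith
    also have "1 \<le> 1 / a * \<kappa>" using a by (simp add: field_simps)
    finally show "real S \<le> lam' * \<kappa>" by (simp add: lam'_def ring_distribs)
  qed
  have N: "eps * T \<le> real N" "real N \<le> 2 * (eps * T)" unfolding N_def using T by linarith+
  have n: "T * \<kappa> \<le> real n" "real n \<le> T * \<kappa> + 1" unfolding n_def using Tk by linarith+
  define K where "K x = x ^ n * ((\<Sum>i<S. x ^ i) / of_nat S) ^ N" for x :: complex
  define \<eta> where "\<eta> = 4 * eps * lam'"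
  have "\<eta>\<^sup>2 = eps / 4 * (64 * eps * lam'\<^sup>2)" by (simp add: \<eta>_def power2_eq_square)
  then have eta: "\<eta> \<ge> 0" "\<eta>\<^sup>2 = eps / 4"
    using eps0 lam' by (simp_all add: el(2)) (simp add: \<eta>_def)
  have NS: "real N * real S + 1 \<le> \<eta> * (T * \<kappa>)"
  proof -
    have "real N * real S \<le> 2 * (eps * T) * (lam' * \<kappa>)" using N S by (intro mult_mono) auto
    moreover have "1 * 1 \<le> (eps * T) * (lam' * \<kappa>)" using T lk by (intro mult_mono) auto
    ultimately show ?thesis by (simp add: \<eta>_def algebra_simps)
  qed
  show thesis
  proof (rule that[of K N])
    show "K holomorphic_on UNIV" unfolding K_def using S by (intro holomorphic_intros) auto
    show "K 1 = 1" using S by (simp add: K_def)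
    show "eps * T \<le> real N" by fact
  next
    fix x :: complex
    define X where "X = max 1 (norm x)"
    define Y where "Y = norm x powr \<kappa>"
    have X: "X \<ge> 1" by (simp add: X_def)
    have XY: "X powr \<kappa> = max 1 Y"
    proof (cases "norm x \<le> 1")
      case True
      then have "Y \<le> 1" using k0 by (simp add: Y_def powr_le1)
      then show ?thesis using True by (simp add: X_def max_absorb1)
    next
      case False
      then have "1 \<le> Y" using k0 by (simp add: Y_def ge_one_powr_ge_zero)
      then show ?thesis using False by (simp add: X_def Y_def max_absorb2)
    qed
    define \<Theta> where "\<Theta> = max 1 (lam / 2 * (\<kappa> * norm (x - 1)))"
    have \<Theta>: "\<Theta> \<ge> 1" by (simp add: \<Theta>_def)
    have "norm ((\<Sum>i<S. x ^ i) / of_nat S) \<le> X ^ S / max 1 (real S * norm (x - 1) / 2)"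
      unfolding X_def using S by (intro geometric_average_le) auto
    also have "\<dots> \<le> X ^ S / \<Theta>"
    proof (intro divide_left_mono)
      have "lam * \<kappa> * norm (x - 1) \<le> real S * norm (x - 1)" using S by (intro mult_right_mono) auto
      then show "\<Theta> \<le> max 1 (real S * norm (x - 1) / 2)" by (auto simp: \<Theta>_def)
    qed (use X \<Theta> in auto)
    finally have "norm ((\<Sum>i<S. x ^ i) / of_nat S) ^ N \<le> (X ^ S / \<Theta>) ^ N"
      by (intro power_mono) auto
    also have "\<dots> = X powr (real N * real S) / \<Theta> ^ N"
      using X powr_realpow[of X "N * S"] by (simp add: power_divide power_mult[symmetric] mult.commute)
    finally have D: "norm ((\<Sum>i<S. x ^ i) / of_nat S) ^ N \<le> X powr (real N * real S) / \<Theta> ^ N" .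
    have xn: "norm x ^ n \<le> norm x powr (T * \<kappa>) * X"
    proof (cases "x = 0")
      case True
      then show ?thesis using n Tk by (simp add: power_0_left)
    next
      case False
      then have "norm x ^ n = norm x powr real n" by (simp add: powr_realpow)
      also have "\<dots> = norm x powr (T * \<kappa>) * norm x powr (real n - T * \<kappa>)"
        by (simp add: powr_add[symmetric])
      also have "\<dots> \<le> norm x powr (T * \<kappa>) * X"
      proof (intro mult_left_mono)
        have "norm x powr (real n - T * \<kappa>) \<le> X powr (real n - T * \<kappa>)"
          using n by (intro powr_mono2) (auto simp: X_def)
        also have "\<dots> \<le> X powr 1" using n X by (intro powr_mono) auto
        finally show "norm x powr (real n - T * \<kappa>) \<le> X" using X by simp
      qed auto
      finally show ?thesis .
    qed
    have "norm (K x) = norm x ^ n * norm ((\<Sum>i<S. x ^ i) / of_nat S) ^ N"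
      by (simp add: K_def norm_mult norm_power)
    also have "\<dots> \<le> (norm x powr (T * \<kappa>) * X) * (X powr (real N * real S) / \<Theta> ^ N)"
      using X by (intro mult_mono xn D) auto
    also have "\<dots> = norm x powr (T * \<kappa>) * X powr (real N * real S + 1) / \<Theta> ^ N"
      using X by (simp add: powr_add)
    also have "\<dots> \<le> norm x powr (T * \<kappa>) * X powr (\<eta> * (T * \<kappa>)) / \<Theta> ^ N"
      using NS X \<Theta> by (intro divide_right_mono mult_left_mono powr_mono) auto
    also have "norm x powr (T * \<kappa>) * X powr (\<eta> * (T * \<kappa>)) = Y powr T * ((X powr \<kappa>) powr \<eta>) powr T"
      by (simp add: Y_def powr_powr mult_ac)
    also have "\<dots> = (Y * max 1 Y powr \<eta>) powr T"
      unfolding XY by (simp add: powr_mult Y_def)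
    also have "\<dots> \<le> exp (Y - 1 + \<eta>\<^sup>2) powr T"
      using T0 eta by (intro powr_mono2 mult_max_powr_le_exp) (auto simp: Y_def)
    also have "\<dots> = exp (T * Y - T + eps / 4 * T)"
      by (simp add: powr_def eta algebra_simps)
    finally show "norm (K x) \<le> exp (T * norm x powr \<kappa> - T + eps / 4 * T) / \<Theta> ^ N"
      using \<Theta> by (simp add: Y_def divide_right_mono)
  next
    fix x :: complex and s :: real
    assume s: "\<kappa> * norm (x - 1) \<le> s" "s \<le> a / 2" "(lam + 1 / a) * s \<le> 1/4"
    have s0: "s \<ge> 0" using s(1) k0 by (meson mult_nonneg_nonneg norm_ge_zero order_trans less_imp_le)
    have sk: "norm (x - 1) \<le> s / \<kappa>" using s k0 by (simp add: field_simps)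
    have sk2: "s / \<kappa> \<le> 1/2" using s a k0 by (simp add: field_simps)
    have "exp (- (2 * (s / \<kappa>))) \<le> 1 - s / \<kappa>" using s0 k0 sk2 by (intro exp_neg_double_le) auto
    also have "\<dots> \<le> norm x" using sk norm_triangle_ineq2[of 1 "x"] by (simp add: norm_minus_commute)
    finally have "exp (- (2 * (s / \<kappa>))) ^ n \<le> norm x ^ n" by (intro power_mono) auto
    moreover have "exp (- (4 * s * T)) \<le> exp (- (2 * (s / \<kappa>))) ^ n"
    proof -
      have "real n * (2 * (s / \<kappa>)) \<le> (2 * (T * \<kappa>)) * (2 * (s / \<kappa>))"
        using n Tk s0 k0 by (intro mult_right_mono) auto
      also have "\<dots> = 4 * s * T" using k0 by simp
      finally show ?thesis by (simp add: exp_of_nat_mult[symmetric])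
    qed
    ultimately have 1: "exp (- (4 * s * T)) \<le> norm x ^ n" by linarith
    have "real S * norm (x - 1) \<le> (lam' * \<kappa>) * (s / \<kappa>)"
      using S sk s0 k0 lam' by (intro mult_mono) auto
    then have "real S * norm (x - 1) \<le> lam' * s" using k0 by simp
    then have "exp (- (4 * (lam' * s))) \<le> norm ((\<Sum>i<S. x ^ i) / of_nat S)"
      using s S by (intro geometric_average_ge) (auto simp: lam'_def)
    then have "exp (- (4 * (lam' * s))) ^ N \<le> norm ((\<Sum>i<S. x ^ i) / of_nat S) ^ N"
      by (intro power_mono) auto
    moreover have "exp (- (8 * s * T)) \<le> exp (- (4 * (lam' * s))) ^ N"
    proof -
      have "real N * (4 * (lam' * s)) \<le> (2 * (eps * T)) * (4 * (lam' * s))"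
        using N s0 lam' by (intro mult_right_mono) auto
      also have "\<dots> = (eps * lam') * (8 * s * T)" by simp
      also have "\<dots> \<le> 1 * (8 * s * T)" using el s0 T0 by (intro mult_right_mono) auto
      finally show ?thesis by (simp add: exp_of_nat_mult[symmetric])
    qed
    ultimately have 2: "exp (- (8 * s * T)) \<le> norm ((\<Sum>i<S. x ^ i) / of_nat S) ^ N" by linarith
    have "exp (- (12 * s * T)) = exp (- (4 * s * T)) * exp (- (8 * s * T))"
      by (simp add: exp_add[symmetric])
    also have "\<dots> \<le> norm x ^ n * norm ((\<Sum>i<S. x ^ i) / of_nat S) ^ N"
      using 1 2 by (intro mult_mono) auto
    also have "\<dots> = norm (K x)" by (simp add: K_def norm_mult norm_power)
    finally show "exp (- (12 * s * T)) \<le> norm (K x)" .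
  qed
qed

section \<open>Weights of regular growth and sparse varieties\<close>

text \<open>What sufficiency uses of the weight. In the application \<open>P\<close> agrees with \<open>p\<close> outside the disc of radius
\<open>r0\<close> and is constant inside, and \<open>\<kappa>\<close> is \<open>q' \<circ> ln \<circ> norm\<close>. The lower bound for \<open>P\<close> is the
convexity of \<open>q\<close>, the upper bound is the monotonicity of \<open>r / q' (ln r)\<close>.\<close>

locale regular_growth =
  fixes P \<kappa> :: "complex \<Rightarrow> real" and r0 a \<rho>0 p0 M :: real
  assumes pos: "r0 > 0" "a > 0" "\<rho>0 > 0" "p0 > 0" "M > 0"
    and P_ge: "p0 \<le> P z"
    and \<kappa>_ge: "r0 \<le> norm \<zeta> \<Longrightarrow> a \<le> \<kappa> \<zeta>"
    and radius_ge: "r0 \<le> norm \<zeta> \<Longrightarrow> \<rho>0 * \<kappa> \<zeta> \<le> norm \<zeta>"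
    and P_lower: "r0 \<le> norm \<zeta> \<Longrightarrow> P \<zeta> * norm (z / \<zeta>) powr \<kappa> \<zeta> \<le> P z"
    and P_upper: "r0 \<le> norm \<zeta> \<Longrightarrow> P z \<le> P \<zeta> * exp (\<kappa> \<zeta> * norm (z - \<zeta>) / norm \<zeta>)"
    and P_log: "1 + (norm z)\<^sup>2 \<le> M * exp (M * P z)"

text \<open>In the application \<open>\<rho> j = max (norm (z j) / \<kappa> (z j)) (exp 1)\<close>. The first lower bound makes the disc reach
the natural scale of the weight; the second makes \<open>ln (\<rho> j) \<ge> 1\<close>, so that \<open>N\<close> controls the multiplicities. The additive constant of the theorem is absorbed into \<open>A\<close>, as \<open>P\<close> is bounded below.\<close>

locale sparse_variety = regular_growth +
  fixes z :: "nat \<Rightarrow> complex" and m :: "nat \<Rightarrow> nat" and \<rho> :: "nat \<Rightarrow> real" and A :: real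
  assumes V: "multiplicity_variety z m" and A: "A > 0"
    and \<rho>: "r0 \<le> norm (z j) \<Longrightarrow> norm (z j) / \<kappa> (z j) \<le> \<rho> j" "r0 \<le> norm (z j) \<Longrightarrow> exp 1 \<le> \<rho> j"
    and N: "r0 \<le> norm (z j) \<Longrightarrow> N_count z m (z j) (\<rho> j) \<le> A * P (z j)"
begin

lemma P_pos: "P w > 0" using P_ge[of w] pos by linarith

lemma m_pos: "m j > 0" using V by (simp add: multiplicity_variety_def)

lemma z_inj: "z j = z k \<longleftrightarrow> j = k" using V by (auto simp: multiplicity_variety_def inj_def)

lemma n_count_0: "n_count z m (z j) 0 = m j"
proof -
  have "{k. norm (z j - z k) \<le> 0} = {j}" by (auto simp: z_inj)
  then show ?thesis by (simp add: n_count_def)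
qed

lemma neighbour_sum_le:
  assumes j: "r0 \<le> norm (z j)" and F: "F \<subseteq> {k. k \<noteq> j \<and> norm (z j - z k) \<le> \<rho> j}"
  shows "(\<Sum>k\<in>F. real (m k) * ln (\<rho> j / norm (z j - z k))) + real (m j) * ln (\<rho> j) \<le> A * P (z j)"
proof -
  have r: "\<rho> j > 0" using \<rho>(2)[OF j] by (meson exp_gt_zero less_le_trans)
  define G where "G = {k. 0 < norm (z j - z k) \<and> norm (z j - z k) \<le> \<rho> j}"
  have fin: "finite G"
    by (rule finite_subset[OF _ finite_multiplicity_variety_disc[OF V, of "z j" "\<rho> j"]]) (auto simp: G_def)
  have "F \<subseteq> G" using F by (auto simp: G_def z_inj)
  then have "(\<Sum>k\<in>F. real (m k) * ln (\<rho> j / norm (z j - z k)))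
      \<le> (\<Sum>k\<in>G. real (m k) * ln (\<rho> j / norm (z j - z k)))"
    using r by (intro sum_mono2 fin) (auto simp: G_def z_inj)
  then show ?thesis
    using N[OF j] unfolding N_count_eq_sum[OF V r] n_count_0 by (simp add: G_def)
qed

lemma rho_ln: "r0 \<le> norm (z j) \<Longrightarrow> 1 \<le> ln (\<rho> j)"
  using \<rho>(2)[of j] by (metis exp_gt_zero less_le_trans ln_exp ln_le_cancel_iff)

lemma m_le: assumes "r0 \<le> norm (z j)" shows "real (m j) \<le> A * P (z j)" "real (m j) * ln (\<rho> j) \<le> A * P (z j)"
proof -
  show "real (m j) * ln (\<rho> j) \<le> A * P (z j)"
    using neighbour_sum_le[OF assms, of "{}"] by simp
  then show "real (m j) \<le> A * P (z j)"
    using mult_left_mono[OF rho_ln[OF assms], of "real (m j)"] by simp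
qed

text \<open>The point \<open>z j\<close> contributes \<open>m j * ln (\<rho> k / |z j - z k|)\<close> to the counting function of its neighbour
\<open>z k\<close>. In this form the multiplicity \<open>m j\<close> tempers the exponent, so that the \<open>m j\<close>-th power of the
inverse distance, which arises from a jet of length \<open>m j\<close>, is still \<open>exp (O(P (z k)))\<close>.\<close>

lemma separation:
  assumes k: "r0 \<le> norm (z k)" and "j \<noteq> k"
  shows "exp (- (A * P (z k) / real (m j))) \<le> norm (z j - z k)"
proof -
  have d: "norm (z j - z k) > 0" using assms by (simp add: z_inj)
  show ?thesis
  proof (cases "norm (z j - z k) \<le> \<rho> k")
    case True
    have "real (m j) * ln (\<rho> k / norm (z j - z k)) \<le> A * P (z k)"
    proof -
      have "(\<Sum>i\<in>{j}. real (m i) * ln (\<rho> k / norm (z k - z i))) + real (m k) * ln (\<rho> k) \<le> A * P (z k)"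
        using True assms by (intro neighbour_sum_le) (auto simp: norm_minus_commute)
      moreover have "0 \<le> real (m k) * ln (\<rho> k)" using rho_ln[OF k] by simp
      ultimately show ?thesis by (simp add: norm_minus_commute)
    qed
    moreover have "ln (\<rho> k / norm (z j - z k)) \<ge> - ln (norm (z j - z k))"
    proof -
      have "\<rho> k > 0" using \<rho>(2)[OF k] by (meson exp_gt_zero less_le_trans)
      then have "ln (\<rho> k / norm (z j - z k)) = ln (\<rho> k) - ln (norm (z j - z k))"
        using d by (simp add: ln_div)
      then show ?thesis using rho_ln[OF k] by linarith
    qed
    ultimately have "real (m j) * (- ln (norm (z j - z k))) \<le> A * P (z k)"
      by (meson mult_left_mono of_nat_0_le_iff order_trans)
    then have "- (A * P (z k) / real (m j)) \<le> ln (norm (z j - z k))"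
      using m_pos[of j] by (simp add: field_simps)
    then show ?thesis using d by (simp add: ln_ge_iff)
  next
    case False
    have "exp (- (A * P (z k) / real (m j))) \<le> 1" using A P_pos[of "z k"] by simp
    also have "1 \<le> exp (1::real)" by simp
    also have "\<dots> \<le> norm (z j - z k)" using False \<rho>(2)[OF k] by linarith
    finally show ?thesis .
  qed
qed

lemma card_unit_disc_le:
  assumes j: "r0 \<le> norm (z j)" and F: "F \<subseteq> {k. norm (z j - z k) \<le> 1}"
  shows "real (card F) \<le> A * P (z j)"
proof -
  define G where "G = {k. norm (z j - z k) \<le> 1}"
  have fG: "finite G" unfolding G_def by (rule finite_multiplicity_variety_disc[OF V])
  have r: "\<rho> j \<ge> exp 1" by (rule \<rho>(2)[OF j])
  have jG: "j \<in> G" by (simp add: G_def)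
  have "real (card F) \<le> real (card G)" using F fG by (intro of_nat_mono card_mono) (auto simp: G_def)
  also have "\<dots> = (\<Sum>k\<in>G. 1)" by simp
  also have "\<dots> = (\<Sum>k\<in>G - {j}. 1) + 1" by (simp only: sum.remove[OF fG jG] add.commute)
  also have "\<dots> \<le> (\<Sum>k\<in>G - {j}. real (m k) * ln (\<rho> j / norm (z j - z k))) + real (m j) * ln (\<rho> j)"
  proof (intro add_mono sum_mono)
    have "1 * 1 \<le> real (m j) * ln (\<rho> j)" using m_pos[of j] rho_ln[OF j] by (intro mult_mono) auto
    then show "1 \<le> real (m j) * ln (\<rho> j)" by simp
    fix k assume k: "k \<in> G - {j}"
    then have d: "0 < norm (z j - z k)" "norm (z j - z k) \<le> 1" by (auto simp: G_def z_inj)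
    have "\<rho> j > 0" using r by (meson exp_gt_zero less_le_trans)
    moreover from this have "exp 1 * norm (z j - z k) \<le> \<rho> j * 1" using r d by (intro mult_mono) auto
    ultimately have "1 \<le> ln (\<rho> j / norm (z j - z k))"
      using d by (subst ln_ge_iff) (auto simp: field_simps)
    then have "1 * 1 \<le> real (m k) * ln (\<rho> j / norm (z j - z k))" using m_pos[of k] by (intro mult_mono) auto
    then show "1 \<le> real (m k) * ln (\<rho> j / norm (z j - z k))" by simp
  qed
  also have "\<dots> \<le> A * P (z j)"
  proof (rule neighbour_sum_le[OF j])
    have "(1::real) \<le> exp 1" by simp
    then have "1 \<le> \<rho> j" using r by linarith
    then show "G - {j} \<subseteq> {k. k \<noteq> j \<and> norm (z j - z k) \<le> \<rho> j}" by (auto simp: G_def)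
  qed
  finally show ?thesis .
qed

end

lemma sum_inverse_squares_int_le:
  obtains S :: real where "\<And>I :: int set. finite I \<Longrightarrow> (\<Sum>a\<in>I. 1 / (1 + (real_of_int a)\<^sup>2)) \<le> S"
proof -
  define g where "g n = 1 / (1 + (real n)\<^sup>2)" for n :: nat
  have "summable (\<lambda>n. 2 * inverse ((real (Suc n))\<^sup>2))"
    using inverse_power_summable[of 2, where 'a=real] summable_Suc_iff[of "\<lambda>n. inverse ((real n)\<^sup>2)"]
    by (intro summable_mult) auto
  then have sg: "summable g"
  proof (rule summable_comparison_test[rotated], intro exI allI impI)
    fix n :: nat
    have "(real (Suc n))\<^sup>2 \<le> 2 * (1 + (real n)\<^sup>2)"
      using sum_squares_bound[of "real n" 1] by (simp add: power2_eq_square algebra_simps)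
    then show "norm (g n) \<le> 2 * inverse ((real (Suc n))\<^sup>2)"
      by (simp add: g_def field_simps add_pos_nonneg)
  qed
  have fin: "(\<Sum>a\<in>I. g (nat \<bar>a\<bar>)) \<le> suminf g" if "finite I" "inj_on (\<lambda>a. nat \<bar>a\<bar>) I" for I :: "int set"
  proof -
    have "(\<Sum>a\<in>I. g (nat \<bar>a\<bar>)) = (\<Sum>n\<in>(\<lambda>a. nat \<bar>a\<bar>) ` I. g n)"
      using that(2) by (subst sum.reindex) auto
    also have "\<dots> \<le> suminf g" using that(1) by (intro sum_le_suminf sg) (auto simp: g_def)
    finally show ?thesis .
  qed
  have "(\<Sum>a\<in>I. 1 / (1 + (real_of_int a)\<^sup>2)) \<le> suminf g + suminf g" if I: "finite I" for I :: "int set"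
  proof -
    have "(\<Sum>a\<in>I. 1 / (1 + (real_of_int a)\<^sup>2)) = (\<Sum>a\<in>I. g (nat \<bar>a\<bar>))"
      by (intro sum.cong) (auto simp: g_def)
    also have "\<dots> = (\<Sum>a\<in>(I \<inter> {0..}) \<union> (I \<inter> {..<0}). g (nat \<bar>a\<bar>))"
      by (intro sum.cong) auto
    also have "(\<Sum>a\<in>(I \<inter> {0..}) \<union> (I \<inter> {..<0}). g (nat \<bar>a\<bar>))
        = (\<Sum>a\<in>I \<inter> {0..}. g (nat \<bar>a\<bar>)) + (\<Sum>a\<in>I \<inter> {..<0}. g (nat \<bar>a\<bar>))"
      using I by (intro sum.union_disjoint) auto
    also have "\<dots> \<le> suminf g + suminf g"
      using I by (intro add_mono fin) (auto simp: inj_on_def)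
    finally show ?thesis .
  qed
  then show thesis by (rule that)
qed

context sparse_variety
begin

text \<open>Points are grouped by squares of side \<open>1/2\<close>. A square with a point \<open>z j\<close> contains at most
\<open>A * P (z j) \<le> A * exp (P (z j))\<close> points, and \<open>exp (- (2 * M * P))\<close> is summable over the squares
because \<open>P\<close> dominates \<open>ln (1 + |z|\<^sup>2)\<close>.\<close>

lemma exponential_sum_bounded:
  obtains c S :: real where "c > 0"
    "\<And>F. finite F \<Longrightarrow> F \<subseteq> {j. r0 \<le> norm (z j)} \<Longrightarrow> (\<Sum>j\<in>F. exp (- (c * P (z j)))) \<le> S"
proof -
  obtain S1 where S1: "\<And>I :: int set. finite I \<Longrightarrow> (\<Sum>a\<in>I. 1 / (1 + (real_of_int a)\<^sup>2)) \<le> S1"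
    using sum_inverse_squares_int_le by blast
  have S10: "S1 \<ge> 0" using S1[of "{}"] by simp
  define cell where "cell w = (\<lfloor>2 * Re w\<rfloor>, \<lfloor>2 * Im w\<rfloor>)" for w :: complex
  define h where "h = (\<lambda>(a :: int, b :: int). (1 / (1 + (real_of_int a)\<^sup>2)) * (1 / (1 + (real_of_int b)\<^sup>2)))"
  define D where "D = (8 * M)\<^sup>2"
  have floor_sq: "1 + (real_of_int \<lfloor>2 * t\<rfloor>)\<^sup>2 \<le> 8 * (1 + s)" if "t\<^sup>2 \<le> s" for t s :: real
  proof -
    have "\<bar>real_of_int \<lfloor>2 * t\<rfloor>\<bar> \<le> 2 * \<bar>t\<bar> + 1" by linarith
    then have "(real_of_int \<lfloor>2 * t\<rfloor>)\<^sup>2 \<le> (2 * \<bar>t\<bar> + 1)\<^sup>2" by (simp add: abs_le_square_iff[symmetric])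
    also have "\<dots> \<le> 8 * t\<^sup>2 + 2"
      using sum_squares_bound[of "2 * \<bar>t\<bar>" 1] by (simp add: power2_eq_square algebra_simps abs_mult_self_eq)
    finally show ?thesis using that by simp
  qed
  have decay: "exp (- (2 * M * P w)) \<le> D * h (cell w)" for w
  proof -
    have 1: "1 + (real_of_int \<lfloor>2 * Re w\<rfloor>)\<^sup>2 \<le> 8 * (M * exp (M * P w))"
      by (rule order_trans[OF floor_sq[of "Re w" "(norm w)\<^sup>2"]]) (use P_log[of w] in \<open>auto simp: cmod_power2\<close>)
    have 2: "1 + (real_of_int \<lfloor>2 * Im w\<rfloor>)\<^sup>2 \<le> 8 * (M * exp (M * P w))"
      by (rule order_trans[OF floor_sq[of "Im w" "(norm w)\<^sup>2"]]) (use P_log[of w] in \<open>auto simp: cmod_power2\<close>)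
    have "(1 + (real_of_int \<lfloor>2 * Re w\<rfloor>)\<^sup>2) * (1 + (real_of_int \<lfloor>2 * Im w\<rfloor>)\<^sup>2)
        \<le> (8 * (M * exp (M * P w))) * (8 * (M * exp (M * P w)))"
      using pos by (intro mult_mono 1 2) auto
    also have "\<dots> = D * exp (2 * M * P w)"
      by (simp add: D_def power2_eq_square exp_add[symmetric])
    finally have le: "(1 + (real_of_int \<lfloor>2 * Re w\<rfloor>)\<^sup>2) * (1 + (real_of_int \<lfloor>2 * Im w\<rfloor>)\<^sup>2) \<le> D * exp (2 * M * P w)" .
    have p: "0 < (1 + (real_of_int \<lfloor>2 * Re w\<rfloor>)\<^sup>2) * (1 + (real_of_int \<lfloor>2 * Im w\<rfloor>)\<^sup>2)"
      by (intro mult_pos_pos) (auto simp: add_pos_nonneg)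
    have "1 / exp (2 * M * P w) \<le> D / ((1 + (real_of_int \<lfloor>2 * Re w\<rfloor>)\<^sup>2) * (1 + (real_of_int \<lfloor>2 * Im w\<rfloor>)\<^sup>2))"
      using le p by (simp add: divide_le_eq pos_le_divide_eq mult.commute)
    then show ?thesis by (simp add: h_def cell_def exp_minus inverse_eq_divide)
  qed
  have cell_close: "norm (w - w') \<le> 1" if "cell w = cell w'" for w w'
  proof -
    have "\<lfloor>2 * Re w\<rfloor> = \<lfloor>2 * Re w'\<rfloor>" "\<lfloor>2 * Im w\<rfloor> = \<lfloor>2 * Im w'\<rfloor>" using that by (auto simp: cell_def)
    then have "\<bar>Re w - Re w'\<bar> \<le> 1/2" "\<bar>Im w - Im w'\<bar> \<le> 1/2" by linarith+
    then have "\<bar>Re (w - w')\<bar> \<le> 1/2" "\<bar>Im (w - w')\<bar> \<le> 1/2" by simp_all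
    then show ?thesis using cmod_le[of "w - w'"] by linarith
  qed
  have "(\<Sum>j\<in>F. exp (- ((1 + 2 * M) * P (z j)))) \<le> A * D * S1\<^sup>2"
    if F: "finite F" "F \<subseteq> {j. r0 \<le> norm (z j)}" for F
  proof -
    define C where "C = (\<lambda>j. cell (z j)) ` F"
    have fC: "finite C" using F by (simp add: C_def)
    have "(\<Sum>j\<in>F. exp (- ((1 + 2 * M) * P (z j)))) = (\<Sum>Q\<in>C. \<Sum>j | j \<in> F \<and> cell (z j) = Q. exp (- ((1 + 2 * M) * P (z j))))"
      unfolding C_def using F by (intro sum.image_gen)
    also have "\<dots> \<le> (\<Sum>Q\<in>C. A * D * h Q)"
    proof (intro sum_mono)
      fix Q assume "Q \<in> C"
      define E where "E = {j \<in> F. cell (z j) = Q}"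
      have hQ: "h Q \<ge> 0" by (auto simp: h_def split: prod.split)
      have fE: "finite E" using F by (simp add: E_def)
      have "(\<Sum>j\<in>E. exp (- ((1 + 2 * M) * P (z j)))) \<le> (\<Sum>j\<in>E. A / card E * (D * h Q))"
      proof (intro sum_mono)
        fix j assume j: "j \<in> E"
        have cE: "card E > 0" using j fE by (auto simp: card_gt_0_iff)
        have "real (card E) \<le> A * P (z j)"
          using j F by (intro card_unit_disc_le) (auto simp: E_def intro!: cell_close)
        also have "\<dots> \<le> A * exp (P (z j))"
          using A exp_ge_add_one_self[of "P (z j)"] by (intro mult_left_mono) linarith+
        finally have "exp (- P (z j)) \<le> A / card E"
          using cE by (simp add: exp_minus field_simps)
        moreover have "exp (- (2 * M * P (z j))) \<le> D * h Q"
          using decay[of "z j"] j by (simp add: E_def)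
        ultimately have "exp (- P (z j)) * exp (- (2 * M * P (z j))) \<le> A / card E * (D * h Q)"
          using A by (intro mult_mono) auto
        then show "exp (- ((1 + 2 * M) * P (z j))) \<le> A / card E * (D * h Q)"
          by (simp add: exp_add[symmetric] algebra_simps)
      qed
      also have "\<dots> \<le> A * D * h Q"
        using A hQ by (cases "E = {}") (auto simp: D_def fE)
      finally show "(\<Sum>j | j \<in> F \<and> cell (z j) = Q. exp (- ((1 + 2 * M) * P (z j)))) \<le> A * D * h Q"
        by (simp add: E_def)
    qed
    also have "\<dots> = A * D * (\<Sum>Q\<in>C. h Q)" by (simp add: sum_distrib_left)
    also have "\<dots> \<le> A * D * S1\<^sup>2"
    proof (intro mult_left_mono)
      have "(\<Sum>Q\<in>C. h Q) \<le> (\<Sum>Q\<in>fst ` C \<times> snd ` C. h Q)"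
        using fC by (intro sum_mono2) (auto simp: h_def split: prod.split intro: rev_image_eqI)
      also have "\<dots> = (\<Sum>a\<in>fst ` C. 1 / (1 + (real_of_int a)\<^sup>2)) * (\<Sum>b\<in>snd ` C. 1 / (1 + (real_of_int b)\<^sup>2))"
        by (simp add: h_def sum_product sum.cartesian_product)
      also have "\<dots> \<le> S1 * S1"
        using fC S10 by (intro mult_mono S1 sum_nonneg) auto
      finally show "(\<Sum>Q\<in>C. h Q) \<le> S1\<^sup>2" by (simp add: power2_eq_square)
    qed (use A in \<open>auto simp: D_def\<close>)
    finally show ?thesis .
  qed
  moreover have "1 + 2 * M > 0" using pos by simp
  ultimately show thesis by (intro that[of "1 + 2 * M" "A * D * S1\<^sup>2"]) auto
qed

text \<open>Since \<open>P \<ge> p0 > 0\<close>, increasing the exponent from \<open>c\<close> to \<open>b\<close> multiplies the sum by at most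
\<open>exp (- ((b - c) * p0))\<close>.\<close>

lemma exponential_series_small:
  assumes \<eta>: "\<eta> > 0"
  obtains c where "\<And>J b. J \<subseteq> {j. r0 \<le> norm (z j)} \<Longrightarrow> b \<ge> c \<Longrightarrow> summable (\<lambda>j. if j \<in> J then exp (- (b * P (z j))) else 0)"
    "\<And>J b. J \<subseteq> {j. r0 \<le> norm (z j)} \<Longrightarrow> b \<ge> c \<Longrightarrow> (\<Sum>j. if j \<in> J then exp (- (b * P (z j))) else 0) \<le> \<eta>"
proof -
  obtain c S where c: "c > 0" and S: "\<And>F. finite F \<Longrightarrow> F \<subseteq> {j. r0 \<le> norm (z j)} \<Longrightarrow> (\<Sum>j\<in>F. exp (- (c * P (z j)))) \<le> S"
    using exponential_sum_bounded by blast
  define c' where "c' = c + ln ((\<bar>S\<bar> + 1) / \<eta> + 1) / p0"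
  have *: "(\<Sum>j<n. if j \<in> J then exp (- (b * P (z j))) else 0) \<le> \<eta>"
    if J: "J \<subseteq> {j. r0 \<le> norm (z j)}" and b: "b \<ge> c'" for J b n
  proof -
    have "(\<Sum>j<n. if j \<in> J then exp (- (b * P (z j))) else 0) = (\<Sum>j\<in>{..<n} \<inter> J. exp (- (b * P (z j))))"
      by (simp add: sum.inter_restrict[symmetric])
    also have "\<dots> \<le> (\<Sum>j\<in>{..<n} \<inter> J. \<eta> / (\<bar>S\<bar> + 1) * exp (- (c * P (z j))))"
    proof (intro sum_mono)
      fix j
      have q: "(\<bar>S\<bar> + 1) / \<eta> > 0" using \<eta> by (intro divide_pos_pos) auto
      have "ln ((\<bar>S\<bar> + 1) / \<eta> + 1) / p0 \<ge> 0" using q pos by (intro divide_nonneg_pos ln_ge_zero) auto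
      then have bc: "b - c \<ge> 0" using b by (simp add: c'_def)
      have "ln ((\<bar>S\<bar> + 1) / \<eta>) \<le> ln ((\<bar>S\<bar> + 1) / \<eta> + 1)" using q by simp
      also have "\<dots> \<le> (b - c) * p0" using b pos by (simp add: c'_def field_simps)
      also have "\<dots> \<le> (b - c) * P (z j)" using bc P_ge by (intro mult_left_mono) auto
      finally have "(\<bar>S\<bar> + 1) / \<eta> \<le> exp ((b - c) * P (z j))" using q by (metis exp_le_cancel_iff exp_ln)
      then have "exp (- ((b - c) * P (z j))) \<le> \<eta> / (\<bar>S\<bar> + 1)"
        using \<eta> unfolding exp_minus inverse_eq_divide by (simp add: pos_divide_le_eq pos_le_divide_eq mult.commute)
      then have "exp (- ((b - c) * P (z j))) * exp (- (c * P (z j))) \<le> \<eta> / (\<bar>S\<bar> + 1) * exp (- (c * P (z j)))"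
        by (intro mult_right_mono) auto
      then show "exp (- (b * P (z j))) \<le> \<eta> / (\<bar>S\<bar> + 1) * exp (- (c * P (z j)))"
        by (simp add: exp_add[symmetric] algebra_simps)
    qed
    also have "\<dots> = \<eta> / (\<bar>S\<bar> + 1) * (\<Sum>j\<in>{..<n} \<inter> J. exp (- (c * P (z j))))"
      by (simp add: sum_distrib_left)
    also have "\<dots> \<le> \<eta> / (\<bar>S\<bar> + 1) * S" using J \<eta> by (intro mult_left_mono S) auto
    also have "\<dots> \<le> \<eta> / (\<bar>S\<bar> + 1) * (\<bar>S\<bar> + 1)" using \<eta> by (intro mult_left_mono) auto
    also have "\<dots> = \<eta>" by simp
    finally show ?thesis .
  qed
  show thesis
  proof (rule that[of c'])
    fix J b assume Jb: "J \<subseteq> {j. r0 \<le> norm (z j)}" "b \<ge> c'"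
    show "summable (\<lambda>j. if j \<in> J then exp (- (b * P (z j))) else 0)"
      by (rule bounded_imp_summable[of _ \<eta>]) (use *[OF Jb, of "Suc _"] in \<open>auto simp: lessThan_Suc_atMost\<close>)
    then show "(\<Sum>j. if j \<in> J then exp (- (b * P (z j))) else 0) \<le> \<eta>"
      using *[OF Jb] by (intro suminf_le_const) auto
  qed
qed

end

section \<open>Local interpolating functions\<close>

context sparse_variety
begin

text \<open>The natural scale at \<open>z j\<close>, and the fraction of it that counts as the neighbourhood of \<open>z j\<close>. The
bound \<open>\<delta> \<le> a / 4\<close> keeps the neighbourhood away from the origin when \<open>\<kappa> (z j) < 1\<close>.\<close>

definition rad :: "nat \<Rightarrow> real" where "rad j = norm (z j) / \<kappa> (z j)"

definition \<delta> :: real where "\<delta> = min (1/4) (a/4)"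

lemma \<delta>: "\<delta> > 0" "\<delta> \<le> 1/4" "\<delta> \<le> a/4" using pos by (auto simp: \<delta>_def)

lemma rad:
  assumes "r0 \<le> norm (z j)"
  shows "rad j \<ge> \<rho>0" "rad j \<le> \<rho> j" "\<delta> * rad j \<le> norm (z j) / 4" "rad j > 0" "\<kappa> (z j) > 0"
proof -
  show k: "\<kappa> (z j) > 0" using \<kappa>_ge[OF assms] pos by linarith
  show "rad j \<ge> \<rho>0" using radius_ge[OF assms] k by (simp add: rad_def pos_le_divide_eq)
  then show "rad j > 0" using pos by linarith
  show "rad j \<le> \<rho> j" using \<rho>(1)[OF assms] by (simp add: rad_def)
  have "4 * \<delta> * norm (z j) \<le> \<kappa> (z j) * norm (z j)"
    using \<delta>(3) \<kappa>_ge[OF assms] by (intro mult_right_mono) auto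
  then show "\<delta> * rad j \<le> norm (z j) / 4" using k by (simp add: rad_def field_simps)
qed

lemma neighbour:
  assumes j: "2 * r0 \<le> norm (z j)" and k: "norm (z j - z k) \<le> \<delta> * rad j"
  shows "r0 \<le> norm (z k)" "P (z k) \<le> 3 * P (z j)"
proof -
  have j': "r0 \<le> norm (z j)" using j pos by linarith
  have "norm (z j) - norm (z k) \<le> norm (z j - z k)" by (rule norm_triangle_ineq2)
  then show "r0 \<le> norm (z k)" using k rad(3)[OF j'] j pos by linarith
  have "\<kappa> (z j) * norm (z k - z j) / norm (z j) = norm (z j - z k) / rad j"
    by (simp add: rad_def norm_minus_commute)
  also have "\<dots> \<le> 1"
  proof -
    have "\<delta> * rad j \<le> 1 * rad j" using \<delta>(2) rad(4)[OF j'] by (intro mult_right_mono) linarith+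
    then have "norm (z j - z k) \<le> rad j" using k by linarith
    then show ?thesis using rad(4)[OF j'] by simp
  qed
  finally have "exp (\<kappa> (z j) * norm (z k - z j) / norm (z j)) \<le> exp 1" by simp
  also have "\<dots> \<le> 3" by (rule exp_le)
  finally have "P (z j) * exp (\<kappa> (z j) * norm (z k - z j) / norm (z j)) \<le> P (z j) * 3"
    using P_pos[of "z j"] by (intro mult_left_mono) auto
  then show "P (z k) \<le> 3 * P (z j)" using P_upper[OF j', of "z k"] by linarith
qed

text \<open>The normalised product of linear factors that vanishes at the neighbours of \<open>z j\<close>. Both its size and
its degree \<open>n\<close> are controlled by the counting function at \<open>z j\<close>; the parameter \<open>\<Theta>\<close> measures the
distance from \<open>z j\<close> on the scale \<open>\<rho> j\<close>, and is matched later with the decay of the peak function.\<close>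

lemma neighbour_product:
  assumes j: "r0 \<le> norm (z j)"
  obtains L :: "complex \<Rightarrow> complex" and n :: nat
  where "L holomorphic_on UNIV" "real n \<le> A * P (z j)"
    and "\<And>k l. k \<noteq> j \<Longrightarrow> norm (z j - z k) \<le> \<delta> * rad j \<Longrightarrow> l < m k \<Longrightarrow> fps_expansion L (z k) $ l = 0"
    and "\<And>w \<Theta>. \<Theta> \<ge> 1 \<Longrightarrow> norm (w - z j) + \<delta> * rad j \<le> 2 * \<Theta> * \<rho> j \<Longrightarrow> norm (L w) \<le> exp (2 * A * P (z j)) * \<Theta> ^ n"
    and "\<And>w. (\<And>k. k \<noteq> j \<Longrightarrow> norm (z j - z k) \<le> \<delta> * rad j \<Longrightarrow> 2 * norm (w - z j) \<le> norm (z j - z k))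
            \<Longrightarrow> exp (- (A * P (z j))) \<le> norm (L w)"
proof -
  define G where "G = {k. k \<noteq> j \<and> norm (z j - z k) \<le> \<delta> * rad j}"
  define L where "L w = (\<Prod>k\<in>G. ((w - z k) / (z j - z k)) ^ m k)" for w
  define n where "n = (\<Sum>k\<in>G. m k)"
  have fG: "finite G"
    by (rule finite_subset[OF _ finite_multiplicity_variety_disc[OF V, of "z j" "\<delta> * rad j"]]) (auto simp: G_def)
  have d: "norm (z j - z k) > 0" if "k \<in> G" for k using that by (auto simp: G_def z_inj)
  have r0: "\<rho> j > 0" using \<rho>(2)[OF j] by (meson exp_gt_zero less_le_trans)
  have dr: "norm (z j - z k) \<le> \<rho> j / 4" if "k \<in> G" for k
  proof -
    have "\<delta> * rad j \<le> 1/4 * \<rho> j" using \<delta> rad[OF j] r0 by (intro mult_mono) auto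
    then show ?thesis using that by (auto simp: G_def)
  qed
  have sum_le: "(\<Sum>k\<in>G. real (m k) * ln (\<rho> j / norm (z j - z k))) \<le> A * P (z j)"
  proof -
    have "(\<Sum>k\<in>G. real (m k) * ln (\<rho> j / norm (z j - z k))) + real (m j) * ln (\<rho> j) \<le> A * P (z j)"
    proof (rule neighbour_sum_le[OF j], safe)
      fix k assume "k \<in> G"
      then show "norm (z j - z k) \<le> \<rho> j" using dr[of k] r0 by simp
    qed (auto simp: G_def)
    moreover have "real (m j) * ln (\<rho> j) \<ge> 0" using rho_ln[OF j] by simp
    ultimately show ?thesis by linarith
  qed
  have "real n = (\<Sum>k\<in>G. real (m k) * 1)" by (simp add: n_def)
  also have "\<dots> \<le> (\<Sum>k\<in>G. real (m k) * ln (\<rho> j / norm (z j - z k)))"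
  proof (intro sum_mono mult_left_mono)
    fix k assume k: "k \<in> G"
    have "exp 1 * norm (z j - z k) \<le> 4 * norm (z j - z k)"
      using exp_le by (intro mult_right_mono) auto
    also have "\<dots> \<le> \<rho> j" using dr[OF k] by simp
    finally show "1 \<le> ln (\<rho> j / norm (z j - z k))"
      using d[OF k] r0 by (subst ln_ge_iff) (auto simp: field_simps)
  qed auto
  also note sum_le
  finally have n: "real n \<le> A * P (z j)" .
  have en: "2 ^ n \<le> exp (A * P (z j))"
  proof -
    have "(2::real) ^ n \<le> exp 1 ^ n" using exp_ge_add_one_self[of 1] by (intro power_mono) auto
    also have "\<dots> = exp (real n)" by (simp add: exp_of_nat_mult[symmetric])
    finally show ?thesis using n by (meson exp_le_cancel_iff order_trans)
  qed
  show thesis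
  proof (rule that[of L n])
    show L: "L holomorphic_on UNIV" unfolding L_def by (intro holomorphic_intros) (use z_inj in \<open>auto simp: G_def\<close>)
    show "real n \<le> A * P (z j)" by fact
    show "fps_expansion L (z k) $ l = 0" if "k \<noteq> j" "norm (z j - z k) \<le> \<delta> * rad j" "l < m k" for k l
    proof -
      have k: "k \<in> G" using that by (simp add: G_def)
      define h where "h w = (1 / (z j - z k)) ^ m k * (\<Prod>i\<in>G - {k}. ((w - z i) / (z j - z i)) ^ m i)" for w
      have "L = (\<lambda>w. (w - z k) ^ m k * h w)"
        unfolding L_def h_def using fG k by (auto simp: prod.remove power_divide)
      moreover have "h holomorphic_on UNIV"
        unfolding h_def by (intro holomorphic_intros) (use z_inj in \<open>auto simp: G_def\<close>)
      ultimately show ?thesis using fps_expansion_vanish_power that(3) by simp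
    qed
    show "norm (L w) \<le> exp (2 * A * P (z j)) * \<Theta> ^ n"
      if \<Theta>: "\<Theta> \<ge> 1" and w: "norm (w - z j) + \<delta> * rad j \<le> 2 * \<Theta> * \<rho> j" for w \<Theta>
    proof -
      have "norm (L w) = (\<Prod>k\<in>G. (norm (w - z k) / norm (z j - z k)) ^ m k)"
        by (simp add: L_def prod_norm[symmetric] norm_power norm_divide)
      also have "\<dots> \<le> (\<Prod>k\<in>G. (2 * \<Theta>) ^ m k * (\<rho> j / norm (z j - z k)) ^ m k)"
      proof (intro prod_mono conjI)
        fix k assume k: "k \<in> G"
        have "norm (w - z k) \<le> norm (w - z j) + norm (z j - z k)"
          using norm_triangle_ineq[of "w - z j" "z j - z k"] by simp
        also have "\<dots> \<le> 2 * \<Theta> * \<rho> j" using w k by (auto simp: G_def)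
        finally have "norm (w - z k) / norm (z j - z k) \<le> 2 * \<Theta> * (\<rho> j / norm (z j - z k))"
          using d[OF k] by (simp add: divide_right_mono)
        then have "(norm (w - z k) / norm (z j - z k)) ^ m k \<le> (2 * \<Theta> * (\<rho> j / norm (z j - z k))) ^ m k"
          by (intro power_mono) auto
        then show "(norm (w - z k) / norm (z j - z k)) ^ m k \<le> (2 * \<Theta>) ^ m k * (\<rho> j / norm (z j - z k)) ^ m k"
          unfolding power_mult_distrib[of "2 * \<Theta>"] .
      qed auto
      also have "\<dots> = (2 * \<Theta>) ^ n * (\<Prod>k\<in>G. (\<rho> j / norm (z j - z k)) ^ m k)"
        by (simp add: prod.distrib n_def power_sum)
      also have "(\<Prod>k\<in>G. (\<rho> j / norm (z j - z k)) ^ m k) = exp (\<Sum>k\<in>G. real (m k) * ln (\<rho> j / norm (z j - z k)))"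
        unfolding exp_sum[OF fG] using d r0 by (intro prod.cong) (auto simp: exp_of_nat_mult)
      also have "(2 * \<Theta>) ^ n * \<dots> \<le> (exp (A * P (z j)) * \<Theta> ^ n) * exp (A * P (z j))"
        unfolding power_mult_distrib using en \<Theta> sum_le by (intro mult_mono) auto
      finally show ?thesis by (simp add: mult_exp_exp mult_ac)
    qed
    show "exp (- (A * P (z j))) \<le> norm (L w)"
      if w: "\<And>k. k \<noteq> j \<Longrightarrow> norm (z j - z k) \<le> \<delta> * rad j \<Longrightarrow> 2 * norm (w - z j) \<le> norm (z j - z k)" for w
    proof -
      have "exp (- (A * P (z j))) = inverse (exp (A * P (z j)))" by (rule exp_minus)
      also have "\<dots> \<le> inverse (2 ^ n)" using en by (intro le_imp_inverse_le) auto
      also have "\<dots> = (1/2) ^ n" by (simp add: power_one_over inverse_eq_divide)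
      also have "\<dots> = (\<Prod>k\<in>G. (1/2) ^ m k)" by (simp add: n_def power_sum)
      also have "\<dots> \<le> (\<Prod>k\<in>G. (norm (w - z k) / norm (z j - z k)) ^ m k)"
      proof (intro prod_mono conjI power_mono)
        fix k assume k: "k \<in> G"
        have "norm (z j - z k) \<le> norm (w - z k) + norm (w - z j)"
          using norm_triangle_ineq4[of "w - z k" "w - z j"] by simp
        moreover have "2 * norm (w - z j) \<le> norm (z j - z k)" using w k by (auto simp: G_def)
        ultimately show "1/2 \<le> norm (w - z k) / norm (z j - z k)" using d[OF k] by (simp add: field_simps)
      qed auto
      also have "\<dots> = norm (L w)"
        by (simp add: L_def prod_norm[symmetric] norm_power norm_divide)
      finally show ?thesis .
    qed
  qed
qed

end

context sparse_variety
begin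

text \<open>All constants below are independent of the exponent \<open>b\<close> of the peak functions; the whole argument
depends on this. Jets are measured on circles of radius \<open>\<sigma>\<close>, on which \<open>P\<close> exceeds its value at
the centre at most by the factor \<open>1 + eps / 16\<close>. The number \<open>core_ratio\<close> is the proportion of the scale
on which the peak function loses at most the factor \<open>exp (- (eps / 16 * b * P (z j)))\<close>, and Cauchy's estimates for the local
correction are made on circles of radius at most \<open>\<tau>\<close>.\<close>

definition "far = {j. 2 * r0 \<le> norm (z j)}"
definition "lam = 12 / \<delta>"
definition "eps = 1 / (64 * (lam + 1 / a)\<^sup>2)"
definition "\<sigma> = min (min 1 (\<delta> * \<rho>0 / 2)) (\<rho>0 * ln (1 + eps / 16))"
definition "core_ratio = min (eps / 192) (min (a / 2) (1 / (4 * (lam + 1 / a))))"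
definition "\<tau> = min (\<sigma> / 2) (core_ratio * \<rho>0)"

lemma constants:
  "lam \<ge> 1" "eps > 0" "\<sigma> > 0" "\<sigma> \<le> 1" "\<sigma> \<le> \<delta> * \<rho>0 / 2" "exp (\<sigma> / \<rho>0) \<le> 1 + eps / 16"
  "core_ratio > 0" "12 * core_ratio \<le> eps / 16" "core_ratio \<le> a / 2" "(lam + 1 / a) * core_ratio \<le> 1/4"
  "\<tau> > 0" "\<tau> \<le> 1/2" "\<tau> \<le> \<sigma> / 2" "\<tau> \<le> core_ratio * \<rho>0"
proof -
  show lam: "lam \<ge> 1" using \<delta> by (simp add: lam_def)
  have l: "lam + 1 / a > 0" using lam pos by (simp add: add_pos_pos)
  show e: "eps > 0" using l by (simp add: eps_def)
  show s: "\<sigma> > 0" using \<delta> pos e by (simp add: \<sigma>_def)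
  show sg: "\<sigma> \<le> 1" "\<sigma> \<le> \<delta> * \<rho>0 / 2" by (auto simp: \<sigma>_def)
  have "\<sigma> / \<rho>0 \<le> ln (1 + eps / 16)" using pos by (simp add: \<sigma>_def pos_divide_le_eq min.coboundedI2 mult.commute)
  then have "exp (\<sigma> / \<rho>0) \<le> exp (ln (1 + eps / 16))" by (subst exp_le_cancel_iff)
  then show "exp (\<sigma> / \<rho>0) \<le> 1 + eps / 16" using e by simp
  show t: "core_ratio > 0" using e l pos by (simp add: core_ratio_def)
  show "12 * core_ratio \<le> eps / 16" "core_ratio \<le> a / 2" by (auto simp: core_ratio_def)
  have "core_ratio \<le> 1 / (4 * (lam + 1 / a))" by (auto simp: core_ratio_def)
  then show "(lam + 1 / a) * core_ratio \<le> 1/4" using l by (simp add: field_simps)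
  show "\<tau> > 0" using s t pos by (simp add: \<tau>_def)
  show t2: "\<tau> \<le> \<sigma> / 2" "\<tau> \<le> core_ratio * \<rho>0" by (auto simp: \<tau>_def)
  show "\<tau> \<le> 1/2" using t2 sg by linarith
qed

definition "Cloc = 9 * A + A * ln (1 / \<tau>) + 1 / p0"

text \<open>The function is \<open>K * L * Q\<close>: a peak function with parameter \<open>T = b * P (z j)\<close>, the product over the
neighbours, and the polynomial \<open>Q\<close> that adjusts the jet at \<open>z j\<close>. The exponents add up as follows, in
units of \<open>b * P (z j)\<close>. The data contribute \<open>1 + eps / 16\<close>, the peak function \<open>- 1 + eps / 4\<close>, and dividing by
the peak function near its centre \<open>eps / 16\<close>: together \<open>3/8 * eps\<close>. At distance at least
\<open>\<delta> / 2 * rad j\<close> the decay of the kernel, after paying for the degrees of \<open>L\<close> and \<open>Q\<close>, contributes a further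
\<open>- eps / 2\<close>. Everything else is \<open>exp (Cloc * P (z j))\<close>.\<close>

lemma local_interpolant:
  fixes v :: "nat \<Rightarrow> complex"
  assumes j: "j \<in> far" and b: "eps * b * p0 \<ge> 1" "eps * b \<ge> 4 * A" and \<mu>: "\<mu> \<ge> 0"
    and v: "\<And>l. l < m j \<Longrightarrow> norm (v l) \<le> \<mu> * exp ((1 + eps / 16) * b * P (z j)) / \<sigma> ^ l"
  obtains f where "f holomorphic_on UNIV"
    and "\<And>l. l < m j \<Longrightarrow> fps_expansion f (z j) $ l = v l"
    and "\<And>k l. k \<noteq> j \<Longrightarrow> norm (z j - z k) \<le> \<delta> * rad j \<Longrightarrow> l < m k \<Longrightarrow> fps_expansion f (z k) $ l = 0"
    and "\<And>w. norm (f w) \<le> \<mu> * exp (b * P w + 3/8 * eps * b * P (z j) + Cloc * P (z j))"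
    and "\<And>w. norm (w - z j) \<ge> \<delta> / 2 * rad j \<Longrightarrow>
              norm (f w) \<le> \<mu> * exp (b * P w - eps / 8 * b * P (z j) + Cloc * P (z j))"
proof -
  note c = constants
  define Pj where "Pj = P (z j)"
  define T where "T = b * Pj"
  define \<kappa>j where "\<kappa>j = \<kappa> (z j)"
  have j1: "2 * r0 \<le> norm (z j)" using j by (simp add: far_def)
  then have j0: "r0 \<le> norm (z j)" using pos by linarith
  have zj: "z j \<noteq> 0" using j0 pos by auto
  note radj = rad[OF j0]
  have Pj: "Pj \<ge> p0" "Pj > 0" using P_ge[of "z j"] pos by (auto simp: Pj_def)
  have b0: "b > 0"
  proof -
    have "0 < eps * b" using b A by linarith
    then show ?thesis using c(2) by (simp add: zero_less_mult_iff)
  qed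
  have T0: "T > 0" using b0 Pj by (simp add: T_def)
  have T1: "eps * T \<ge> 1"
  proof -
    have "eps * b * p0 \<le> eps * b * Pj" using c(2) b0 Pj by (intro mult_left_mono) auto
    then show ?thesis using b by (simp add: T_def mult.assoc)
  qed
  have ka: "a \<le> \<kappa>j" "\<kappa>j > 0" using \<kappa>_ge[OF j0] radj by (auto simp: \<kappa>j_def)
  have rk: "\<rho>0 * \<kappa>j \<le> norm (z j)" using radius_ge[OF j0] by (simp add: \<kappa>j_def)
  have rho: "\<rho> j \<ge> 1" using \<rho>(2)[OF j0] by (meson exp_ge_add_one_self le_add_same_cancel1 order_trans zero_le_one)
  obtain K :: "complex \<Rightarrow> complex" and N :: nat where K: "K holomorphic_on UNIV" and N: "eps * T \<le> real N"
    and Kup: "\<And>x. norm (K x) \<le> exp (T * norm x powr \<kappa>j - T + eps / 4 * T) / max 1 (lam / 2 * (\<kappa>j * norm (x - 1))) ^ N"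
    and Klow: "\<And>x s. \<kappa>j * norm (x - 1) \<le> s \<Longrightarrow> s \<le> a / 2 \<Longrightarrow> (lam + 1 / a) * s \<le> 1/4
            \<Longrightarrow> exp (- (12 * s * T)) \<le> norm (K x)"
    using peak_function[OF pos(2) ka(1) c(1) eps_def T1] by metis
  obtain L n where L: "L holomorphic_on UNIV" and n: "real n \<le> A * Pj"
    and Lz: "\<And>k l. k \<noteq> j \<Longrightarrow> norm (z j - z k) \<le> \<delta> * rad j \<Longrightarrow> l < m k \<Longrightarrow> fps_expansion L (z k) $ l = 0"
    and Lup: "\<And>w \<Theta>. \<Theta> \<ge> 1 \<Longrightarrow> norm (w - z j) + \<delta> * rad j \<le> 2 * \<Theta> * \<rho> j \<Longrightarrow> norm (L w) \<le> exp (2 * A * Pj) * \<Theta> ^ n"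
    and Llow: "\<And>w. (\<And>k. k \<noteq> j \<Longrightarrow> norm (z j - z k) \<le> \<delta> * rad j \<Longrightarrow> 2 * norm (w - z j) \<le> norm (z j - z k))
            \<Longrightarrow> exp (- (A * Pj)) \<le> norm (L w)"
    using neighbour_product[OF j0] unfolding Pj_def by metis
  \<comment> \<open>This radius is at most half the distance from \<open>z j\<close> to each neighbour \<open>z k\<close>, where \<open>P (z k) \<le> 3 * P (z j)\<close>,
and its \<open>m j\<close>-th power is only \<open>exp (O(P (z j)))\<close> small.\<close>
  define t where "t = \<tau> * exp (- (3 * A * Pj / real (m j)))"
  have t0: "t > 0" using c by (simp add: t_def)
  have tt: "t \<le> \<tau>" using c A Pj m_pos[of j] by (simp add: t_def mult_le_cancel_left1)
  have tk: "2 * t \<le> norm (z j - z k)" if "k \<noteq> j" "norm (z j - z k) \<le> \<delta> * rad j" for k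
  proof -
    have "P (z k) \<le> 3 * Pj" "r0 \<le> norm (z k)" using neighbour[OF j1 that(2)] by (auto simp: Pj_def)
    then have "A * P (z k) / real (m j) \<le> 3 * A * Pj / real (m j)"
      using A by (intro divide_right_mono) auto
    then have "exp (- (3 * A * Pj / real (m j))) \<le> exp (- (A * P (z k) / real (m j)))" by simp
    also have "\<dots> \<le> norm (z j - z k)" using that \<open>r0 \<le> norm (z k)\<close> by (intro separation) auto
    finally have "exp (- (3 * A * Pj / real (m j))) \<le> norm (z j - z k)" .
    moreover have "2 * t \<le> 1 * exp (- (3 * A * Pj / real (m j)))"
      unfolding t_def using c by (simp add: mult_le_cancel_right1)
    ultimately show ?thesis by simp
  qed
  define F where "F w = K (w / z j) * L w" for w
  have F: "F holomorphic_on UNIV"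
    unfolding F_def
    by (intro holomorphic_intros L holomorphic_on_compose_gen[OF _ K, unfolded o_def]) (use zj in auto)
  define c0 where "c0 = exp (- (12 * core_ratio * T)) * exp (- (A * Pj))"
  have c00: "c0 > 0" by (simp add: c0_def)
  have xw: "\<kappa>j * norm (w / z j - 1) = norm (w - z j) / rad j" for w
  proof -
    have "w / z j - 1 = (w - z j) / z j" using zj by (simp add: field_simps)
    then show ?thesis by (simp add: rad_def norm_divide \<kappa>j_def)
  qed
  have Flow: "norm (F w) \<ge> c0" if w: "norm (w - z j) \<le> t" for w
    unfolding F_def c0_def norm_mult
  proof (intro mult_mono)
    show "exp (- (12 * core_ratio * T)) \<le> norm (K (w / z j))"
    proof (rule Klow)
      have "norm (w - z j) \<le> core_ratio * \<rho>0" using w tt c by linarith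
      also have "\<dots> \<le> core_ratio * rad j" using c radj by (intro mult_left_mono) auto
      finally show "\<kappa>j * norm (w / z j - 1) \<le> core_ratio" unfolding xw using radj by (simp add: pos_divide_le_eq)
    qed (use c in auto)
    show "exp (- (A * Pj)) \<le> norm (L w)"
    proof (rule Llow)
      fix k assume "k \<noteq> j" "norm (z j - z k) \<le> \<delta> * rad j"
      from tk[OF this] w show "2 * norm (w - z j) \<le> norm (z j - z k)" by linarith
    qed
  qed auto
  define E where "E = \<mu> * exp ((1 + eps / 16) * b * P (z j))"
  have E0: "E \<ge> 0" using \<mu> by (simp add: E_def)
  have W: "norm (\<Sum>l<m j. v l * (w - z j) ^ l) \<le> 2 * E" if w: "norm (w - z j) = t" for w
  proof -
    have "norm (\<Sum>l<m j. v l * (w - z j) ^ l) \<le> (\<Sum>l<m j. norm (v l * (w - z j) ^ l))" by (rule norm_sum)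
    also have "\<dots> \<le> (\<Sum>l<m j. E * (1/2) ^ l)"
    proof (intro sum_mono)
      fix l assume l: "l \<in> {..<m j}"
      have "norm (v l * (w - z j) ^ l) \<le> E / \<sigma> ^ l * t ^ l"
        unfolding norm_mult norm_power w using v[of l] l t0 by (intro mult_right_mono) (auto simp: E_def)
      also have "\<dots> = E * (t / \<sigma>) ^ l" by (simp add: power_divide)
      also have "\<dots> \<le> E * (1/2) ^ l"
        using E0 t0 tt c by (intro mult_left_mono power_mono) (auto simp: field_simps)
      finally show "norm (v l * (w - z j) ^ l) \<le> E * (1/2) ^ l" .
    qed
    also have "\<dots> = E * (\<Sum>l<m j. (1/2) ^ l)" by (simp add: sum_distrib_left)
    also have "\<dots> \<le> E * 2"
      using E0 by (intro mult_left_mono) (simp_all add: geometric_sum)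
    finally show ?thesis by (simp add: mult.commute)
  qed
  obtain \<psi> where \<psi>1: "\<And>l. l < m j \<Longrightarrow> fps_expansion (\<lambda>w. F w * (\<Sum>l<m j. \<psi> l * (w - z j) ^ l)) (z j) $ l = v l"
    and \<psi>2: "\<And>l. norm (\<psi> l) \<le> (2 * E / c0) / t ^ l"
    using jet_quotient[where m="m j", OF F t0 c00 Flow W] by blast
  define Q where "Q w = (\<Sum>l<m j. \<psi> l * (w - z j) ^ l)" for w
  have Qh: "Q holomorphic_on UNIV" unfolding Q_def by (intro holomorphic_intros)
  define f where "f w = F w * Q w" for w
  define \<Theta> where "\<Theta> w = max 1 (lam / 2 * (norm (w - z j) / rad j))" for w
  have Th1: "\<Theta> w \<ge> 1" for w by (simp add: \<Theta>_def)
  have Th2: "1 + norm (w - z j) / rad j \<le> 2 * \<Theta> w" for w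
  proof -
    have "1 * (norm (w - z j) / rad j) \<le> lam / 2 * (norm (w - z j) / rad j)"
      using radj \<delta> by (intro mult_right_mono) (auto simp: lam_def field_simps)
    then show ?thesis by (simp add: \<Theta>_def max_def)
  qed
  have Th3: "norm (w - z j) + rad j \<le> 2 * \<Theta> w * \<rho> j" for w
  proof -
    have "norm (w - z j) + rad j = (1 + norm (w - z j) / rad j) * rad j" using radj by (simp add: field_simps)
    also have "\<dots> \<le> 2 * \<Theta> w * \<rho> j" using Th2[of w] Th1[of w] radj by (intro mult_mono) auto
    finally show ?thesis .
  qed
  have m1: "real (m j) \<le> A * Pj" "real (m j) * ln (\<rho> j) \<le> A * Pj" using m_le[OF j0] by (auto simp: Pj_def)
  have ebd: "(1 / t) ^ m j = exp (real (m j) * ln (1 / \<tau>) + 3 * A * Pj)"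
  proof -
    have "1 / t = exp (ln (1 / \<tau>) + 3 * A * Pj / real (m j))"
      using c by (simp add: t_def exp_add exp_minus exp_diff ln_div field_simps)
    then show ?thesis using m_pos[of j] by (simp add: exp_of_nat_mult[symmetric] distrib_left)
  qed
  have Qup: "norm (Q w) \<le> 2 * E / c0 * exp ((6 * A + A * ln (1 / \<tau>)) * Pj) * \<Theta> w ^ m j" for w
  proof -
    define y where "y = 2 * \<Theta> w * (\<rho> j / t)"
    have rt: "\<rho> j / t \<ge> 1" using rho t0 tt c by (simp add: pos_le_divide_eq)
    have y1: "y \<ge> 1" unfolding y_def using mult_mono[of 1 "2 * \<Theta> w" 1 "\<rho> j / t"] rt Th1[of w] by simp
    have yw: "norm (w - z j) / t \<le> y"
    proof -
      have "norm (w - z j) \<le> 2 * \<Theta> w * \<rho> j" using Th3[of w] radj by linarith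
      then have "norm (w - z j) / t \<le> 2 * \<Theta> w * \<rho> j / t" using t0 by (intro divide_right_mono) auto
      then show ?thesis by (simp add: y_def)
    qed
    have "norm (Q w) \<le> (\<Sum>l<m j. norm (\<psi> l * (w - z j) ^ l))" unfolding Q_def by (rule norm_sum)
    also have "\<dots> \<le> (\<Sum>l<m j. 2 * E / c0 * y ^ m j)"
    proof (intro sum_mono)
      fix l assume l: "l \<in> {..<m j}"
      have "norm (\<psi> l * (w - z j) ^ l) \<le> (2 * E / c0) / t ^ l * norm (w - z j) ^ l"
        unfolding norm_mult norm_power using \<psi>2 by (intro mult_right_mono) auto
      also have "\<dots> = 2 * E / c0 * (norm (w - z j) / t) ^ l" by (simp add: power_divide)
      also have "\<dots> \<le> 2 * E / c0 * y ^ m j"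
      proof (intro mult_left_mono)
        have "(norm (w - z j) / t) ^ l \<le> y ^ l" using yw t0 by (intro power_mono) auto
        also have "\<dots> \<le> y ^ m j" using y1 l by (intro power_increasing) auto
        finally show "(norm (w - z j) / t) ^ l \<le> y ^ m j" .
      qed (use E0 c00 in auto)
      finally show "norm (\<psi> l * (w - z j) ^ l) \<le> 2 * E / c0 * y ^ m j" .
    qed
    also have "\<dots> = 2 * E / c0 * (real (m j) * y ^ m j)" by simp
    also have "\<dots> \<le> 2 * E / c0 * (exp ((6 * A + A * ln (1 / \<tau>)) * Pj) * \<Theta> w ^ m j)"
    proof (intro mult_left_mono)
      have l0: "ln (1 / \<tau>) \<ge> 0" using c by simp
      have ye: "y ^ m j = 2 ^ m j * \<Theta> w ^ m j * (\<rho> j ^ m j * (1 / t) ^ m j)"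
        by (simp add: y_def power_mult_distrib power_divide)
      have b1: "(2::real) ^ m j \<le> exp (A * Pj)"
      proof -
        have "(2::real) ^ m j \<le> exp 1 ^ m j" using exp_ge_add_one_self[of 1] by (intro power_mono) auto
        also have "\<dots> = exp (real (m j))" by (simp add: exp_of_nat_mult[symmetric])
        finally show ?thesis using m1 by (meson exp_le_cancel_iff order_trans)
      qed
      have b2: "\<rho> j ^ m j \<le> exp (A * Pj)"
      proof -
        have "\<rho> j ^ m j = exp (real (m j) * ln (\<rho> j))" using rho by (simp add: exp_of_nat_mult)
        also have "\<dots> \<le> exp (A * Pj)" using m1 by simp
        finally show ?thesis .
      qed
      have b3: "(1 / t) ^ m j \<le> exp (A * Pj * ln (1 / \<tau>) + 3 * A * Pj)"
        unfolding ebd exp_le_cancel_iff using mult_right_mono[OF m1(1) l0] by linarith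
      have y: "y ^ m j \<le> exp (A * Pj) * \<Theta> w ^ m j * (exp (A * Pj) * exp (A * Pj * ln (1 / \<tau>) + 3 * A * Pj))"
        unfolding ye using Th1[of w] t0 rho by (intro mult_mono b1 b2 b3 order_refl mult_nonneg_nonneg) auto
      have "real (m j) \<le> exp (A * Pj)" using m1 exp_ge_add_one_self[of "A * Pj"] by linarith
      then have "real (m j) * y ^ m j \<le> exp (A * Pj) * (exp (A * Pj) * \<Theta> w ^ m j * (exp (A * Pj) * exp (A * Pj * ln (1 / \<tau>) + 3 * A * Pj)))"
        using y y1 by (intro mult_mono) auto
      also have "\<dots> = exp ((6 * A + A * ln (1 / \<tau>)) * Pj) * \<Theta> w ^ m j"
        by (simp add: exp_add[symmetric] algebra_simps flip: mult.assoc)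
      finally show "real (m j) * y ^ m j \<le> exp ((6 * A + A * ln (1 / \<tau>)) * Pj) * \<Theta> w ^ m j" .
    qed (use E0 c00 in auto)
    finally show ?thesis by (simp add: mult_ac)
  qed
  have Kup': "norm (K (w / z j)) \<le> exp (b * P w - T + eps / 4 * T) / \<Theta> w ^ N" for w
  proof -
    have "T * norm (w / z j) powr \<kappa>j = b * (Pj * norm (w / z j) powr \<kappa>j)" by (simp add: T_def)
    also have "\<dots> \<le> b * P w"
      unfolding Pj_def \<kappa>j_def using P_lower[OF j0, of w] b0 by (intro mult_left_mono) auto
    finally have "exp (T * norm (w / z j) powr \<kappa>j - T + eps / 4 * T) \<le> exp (b * P w - T + eps / 4 * T)"
      by simp
    then have "exp (T * norm (w / z j) powr \<kappa>j - T + eps / 4 * T) / \<Theta> w ^ N \<le> exp (b * P w - T + eps / 4 * T) / \<Theta> w ^ N"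
      using Th1[of w] by (intro divide_right_mono) auto
    then show ?thesis using Kup[of "w / z j"] unfolding xw \<Theta>_def by linarith
  qed
  have Lup': "norm (L w) \<le> exp (2 * A * Pj) * \<Theta> w ^ n" for w
  proof (rule Lup[OF Th1])
    have "\<delta> * rad j \<le> 1 * rad j" using \<delta> radj by (intro mult_right_mono) auto
    then show "norm (w - z j) + \<delta> * rad j \<le> 2 * \<Theta> w * \<rho> j" using Th3[of w] by linarith
  qed
  have fup: "norm (f w) \<le> \<mu> * exp (b * P w + 3/8 * eps * T + Cloc * Pj) * (\<Theta> w ^ (n + m j) / \<Theta> w ^ N)" for w
  proof -
    have "norm (f w) = norm (K (w / z j)) * norm (L w) * norm (Q w)"
      by (simp add: f_def F_def norm_mult)
    also have "\<dots> \<le> (exp (b * P w - T + eps / 4 * T) / \<Theta> w ^ N) * (exp (2 * A * Pj) * \<Theta> w ^ n)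
        * (2 * E / c0 * exp ((6 * A + A * ln (1 / \<tau>)) * Pj) * \<Theta> w ^ m j)"
      using Th1[of w] by (intro mult_mono Kup' Lup' Qup mult_nonneg_nonneg) auto
    also have "\<dots> = (2 * E / c0) * exp (b * P w - T + eps / 4 * T + (8 * A + A * ln (1 / \<tau>)) * Pj) * (\<Theta> w ^ (n + m j) / \<Theta> w ^ N)"
      by (simp add: power_add exp_add exp_diff algebra_simps) (simp add: exp_add[symmetric] algebra_simps flip: mult.assoc)
    also have "\<dots> \<le> \<mu> * exp (1 / p0 * Pj + T + eps / 8 * T + A * Pj) * exp (b * P w - T + eps / 4 * T + (8 * A + A * ln (1 / \<tau>)) * Pj) * (\<Theta> w ^ (n + m j) / \<Theta> w ^ N)"
    proof (intro mult_right_mono)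
      have "(2::real) \<le> exp 1" using exp_ge_add_one_self[of 1] by simp
      also have "\<dots> \<le> exp (1 / p0 * Pj)" using Pj pos by (simp add: field_simps)
      finally have two: "2 \<le> exp (1 / p0 * Pj)" .
      have "2 * E / c0 = \<mu> * (2 * exp ((1 + eps / 16) * T) * exp (12 * core_ratio * T + A * Pj))"
        by (simp add: E_def c0_def T_def Pj_def exp_minus exp_add mult.assoc field_simps)
      also have "\<dots> \<le> \<mu> * (exp (1 / p0 * Pj) * exp ((1 + eps / 16) * T) * exp (eps / 16 * T + A * Pj))"
        using \<mu> two c(8) T0 by (intro mult_left_mono mult_mono) (auto intro!: mult_right_mono)
      also have "\<dots> = \<mu> * exp (1 / p0 * Pj + T + eps / 8 * T + A * Pj)"
        by (simp add: exp_add[symmetric] algebra_simps)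
      finally show "2 * E / c0 \<le> \<mu> * exp (1 / p0 * Pj + T + eps / 8 * T + A * Pj)" .
    qed (use Th1[of w] in auto)
    also have "\<dots> = \<mu> * exp (b * P w + 3/8 * eps * T + Cloc * Pj) * (\<Theta> w ^ (n + m j) / \<Theta> w ^ N)"
      by (simp add: exp_add[symmetric] Cloc_def algebra_simps)
    finally show ?thesis .
  qed
  \<comment> \<open>By the assumption \<open>eps * b \<ge> 4 * A\<close>, half of the kernel's exponent pays for the degrees of the two polynomials.\<close>
  have Nn: "real n + real (m j) \<le> real N - eps * T / 2"
  proof -
    have "4 * A * Pj \<le> eps * b * Pj" using b Pj by (intro mult_right_mono) auto
    then have "2 * (A * Pj) \<le> eps * T / 2" by (simp add: T_def mult.assoc)
    then show ?thesis using n m1 N by linarith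
  qed
  have nN: "n + m j \<le> N" using Nn T1 by linarith
  show thesis
  proof (rule that[of f])
    show fh: "f holomorphic_on UNIV" unfolding f_def by (intro holomorphic_intros F Qh)
    show "fps_expansion f (z j) $ l = v l" if "l < m j" for l
      using \<psi>1[OF that] unfolding f_def Q_def .
    show "fps_expansion f (z k) $ l = 0" if "k \<noteq> j" "norm (z j - z k) \<le> \<delta> * rad j" "l < m k" for k l
    proof -
      have "f = (\<lambda>w. L w * (K (w / z j) * Q w))" by (rule ext) (simp add: f_def F_def mult_ac)
      moreover have "(\<lambda>w. K (w / z j) * Q w) holomorphic_on UNIV"
        by (intro holomorphic_intros Qh holomorphic_on_compose_gen[OF _ K, unfolded o_def]) (use zj in auto)
      ultimately show ?thesis
        using fps_expansion_vanish_mult[OF L, of _ "m k" "z k" l] Lz[OF that(1,2)] that(3) by simp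
    qed
    show "norm (f w) \<le> \<mu> * exp (b * P w + 3/8 * eps * b * P (z j) + Cloc * P (z j))" for w
    proof -
      have "\<Theta> w ^ (n + m j) / \<Theta> w ^ N \<le> 1"
        using power_increasing[OF nN Th1[of w]] Th1[of w] by (simp add: divide_le_eq)
      then have "\<mu> * exp (b * P w + 3/8 * eps * T + Cloc * Pj) * (\<Theta> w ^ (n + m j) / \<Theta> w ^ N)
          \<le> \<mu> * exp (b * P w + 3/8 * eps * T + Cloc * Pj) * 1"
        using \<mu> by (intro mult_left_mono) auto
      then show ?thesis using fup[of w] by (simp add: T_def Pj_def mult.assoc)
    qed
    show "norm (f w) \<le> \<mu> * exp (b * P w - eps / 8 * b * P (z j) + Cloc * P (z j))"
      if w: "norm (w - z j) \<ge> \<delta> / 2 * rad j" for w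
    proof -
      have "3 = lam / 2 * (\<delta> / 2)" using \<delta> by (simp add: lam_def)
      also have "\<dots> \<le> lam / 2 * (norm (w - z j) / rad j)"
        using w radj c(1) by (intro mult_left_mono) (auto simp: pos_le_divide_eq)
      also have "\<dots> \<le> \<Theta> w" by (simp add: \<Theta>_def)
      finally have e: "exp 1 \<le> \<Theta> w" using exp_le by linarith
      have "\<Theta> w ^ (n + m j) / \<Theta> w ^ N = 1 / \<Theta> w ^ (N - (n + m j))"
        using nN Th1[of w] by (simp add: power_diff)
      also have "\<dots> \<le> 1 / exp 1 ^ (N - (n + m j))"
        using e Th1[of w] by (intro divide_left_mono power_mono mult_pos_pos zero_less_power) auto
      also have "\<dots> = exp (- (real N - (real n + real (m j))))"
        using nN unfolding exp_minus inverse_eq_divide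
        by (simp add: exp_of_nat_mult[symmetric] of_nat_diff)
      also have "\<dots> \<le> exp (- (eps * T / 2))" using Nn by simp
      finally have q: "\<Theta> w ^ (n + m j) / \<Theta> w ^ N \<le> exp (- (eps * T / 2))" .
      have "norm (f w) \<le> \<mu> * exp (b * P w + 3/8 * eps * T + Cloc * Pj) * exp (- (eps * T / 2))"
        by (rule order_trans[OF fup mult_left_mono[OF q]]) (use \<mu> in auto)
      also have "\<dots> = \<mu> * exp (b * P w - eps / 8 * b * P (z j) + Cloc * P (z j))"
        by (simp add: exp_add[symmetric] T_def Pj_def algebra_simps)
      finally show ?thesis .
    qed
  qed
qed

end

section \<open>Interpolation far from the origin\<close>

context sparse_variety
begin

lemma P_locally_bounded: "\<exists>B. \<forall>w. norm w \<le> r \<longrightarrow> P w \<le> B"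
proof -
  define \<zeta> where "\<zeta> = complex_of_real r0"
  have z: "norm \<zeta> = r0" using pos by (simp add: \<zeta>_def)
  have k: "\<kappa> \<zeta> > 0" using \<kappa>_ge[of \<zeta>] z pos by simp
  have "P w \<le> P \<zeta> * exp (\<kappa> \<zeta> * (r + r0) / r0)" if w: "norm w \<le> r" for w
  proof -
    have "norm (w - \<zeta>) \<le> r + r0" using norm_triangle_ineq4[of w \<zeta>] w z by linarith
    then have "\<kappa> \<zeta> * norm (w - \<zeta>) / r0 \<le> \<kappa> \<zeta> * (r + r0) / r0"
      using k pos by (intro divide_right_mono mult_left_mono) auto
    then have "P \<zeta> * exp (\<kappa> \<zeta> * norm (w - \<zeta>) / r0) \<le> P \<zeta> * exp (\<kappa> \<zeta> * (r + r0) / r0)"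
      using P_pos[of \<zeta>] by (intro mult_left_mono) auto
    then show ?thesis using P_upper[of \<zeta> w] z by simp
  qed
  then show ?thesis by blast
qed

lemma exp_P_locally_bounded: assumes "c \<ge> 0" shows "\<exists>B. \<forall>w. norm w \<le> r \<longrightarrow> exp (c * P w) \<le> B"
proof -
  obtain B where "\<And>w. norm w \<le> r \<Longrightarrow> P w \<le> B" using P_locally_bounded by blast
  then have "exp (c * P w) \<le> exp (c * B)" if "norm w \<le> r" for w
    using that assms by (simp add: mult_left_mono)
  then show ?thesis by blast
qed

text \<open>Inside the neighbourhood of \<open>z j\<close> there is no gain; there the loss \<open>exp (O(b * P (z j)))\<close> is
charged to \<open>exp (3 * b * P w)\<close>.\<close>

lemma P_near: assumes j: "r0 \<le> norm (z j)" and w: "norm (w - z j) \<le> \<delta> / 2 * rad j" shows "P (z j) \<le> 2 * P w"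
proof -
  note radj = rad[OF j]
  have k: "\<kappa> (z j) \<ge> a" by (rule \<kappa>_ge[OF j])
  have zj: "norm (z j) > 0" using j pos by linarith
  define y where "y = \<delta> / 2 / \<kappa> (z j)"
  have y: "y \<ge> 0" "y \<le> 1/2" using \<delta> k pos radj by (auto simp: y_def field_simps)
  have "exp (- (2 * y)) \<le> 1 - y" using y by (rule exp_neg_double_le)
  also have "1 - y \<le> norm (w / z j)"
  proof -
    have "norm (w - z j) \<le> y * norm (z j)" using w by (simp add: y_def rad_def)
    then have "(1 - y) * norm (z j) \<le> norm w" using norm_triangle_ineq2[of "z j" w] by (simp add: norm_minus_commute algebra_simps)
    then show ?thesis using zj by (simp add: norm_divide pos_le_divide_eq)
  qed
  finally have "exp (- (2 * y)) powr \<kappa> (z j) \<le> norm (w / z j) powr \<kappa> (z j)"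
    using radj by (intro powr_mono2) auto
  moreover have "exp (- (2 * y)) powr \<kappa> (z j) = exp (- \<delta>)" using radj by (simp add: powr_def y_def)
  moreover have "1/2 \<le> exp (- \<delta>)" using exp_ge_add_one_self[of "- \<delta>"] \<delta> by linarith
  ultimately have "P (z j) * (1/2) \<le> P (z j) * norm (w / z j) powr \<kappa> (z j)"
    using P_pos[of "z j"] by (intro mult_left_mono) auto
  then show ?thesis using P_lower[OF j, of w] by linarith
qed

text \<open>The norm in which the interpolation error contracts. The weight \<open>\<sigma> ^ l\<close> makes it comparable to the
supremum on the circle of radius \<open>\<sigma>\<close>.\<close>

definition "small_data b \<mu> v \<longleftrightarrow>
  (\<forall>j\<in>far. \<forall>l<m j. norm (v j l) \<le> \<mu> * exp ((1 + eps / 16) * b * P (z j)) / \<sigma> ^ l)"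

text \<open>Summing the local interpolants, the error at \<open>z k\<close> comes only from the points \<open>z j\<close> that do not have
\<open>z k\<close> as a neighbour, hence from a region where the local interpolant of \<open>z j\<close> carries the factor
\<open>exp (- (\<beta> * P (z j)))\<close>. As \<open>\<beta>\<close> grows with \<open>b\<close>, the sum of these factors is at most \<open>1/2\<close> for large \<open>b\<close>.\<close>

lemma approximate_interpolation:
  obtains b0 where "b0 > 0" and "\<And>b \<mu> v. b \<ge> b0 \<Longrightarrow> \<mu> \<ge> 0 \<Longrightarrow> small_data b \<mu> v \<Longrightarrow>
    \<exists>f. f holomorphic_on UNIV \<and> (\<forall>w. norm (f w) \<le> \<mu> * exp (3 * b * P w)) \<and>
        small_data b (\<mu> / 2) (\<lambda>j l. v j l - fps_expansion f (z j) $ l)"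
proof -
  note c = constants
  obtain c1 where sm: "\<And>far' b. far' \<subseteq> {j. r0 \<le> norm (z j)} \<Longrightarrow> b \<ge> c1 \<Longrightarrow> summable (\<lambda>j. if j \<in> far' then exp (- (b * P (z j))) else 0)"
    and sl: "\<And>far' b. far' \<subseteq> {j. r0 \<le> norm (z j)} \<Longrightarrow> b \<ge> c1 \<Longrightarrow> (\<Sum>j. if j \<in> far' then exp (- (b * P (z j))) else 0) \<le> 1/2"
    using exponential_series_small[of "1/2"] by auto
  \<comment> \<open>The second and third terms are required by the local interpolants, the last one makes the net decay \<open>\<beta>\<close> at least \<open>c1\<close>.\<close>
  define b0 where "b0 = max 1 (max (max (1 / (eps * p0)) (4 * A / eps)) (8 / eps * (c1 + Cloc)))"
  have far_sub: "far \<subseteq> {j. r0 \<le> norm (z j)}" using pos by (auto simp: far_def)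
  have eps1: "eps \<le> 1"
  proof -
    have "1 \<le> (lam + 1 / a)\<^sup>2" using c(1) pos by (intro one_le_power) (simp add: add_increasing2)
    then show ?thesis unfolding eps_def by (subst divide_le_eq_1_pos) linarith+
  qed
  show thesis
  proof (rule that[of b0])
    show "b0 > 0" by (simp add: b0_def)
    fix b \<mu> :: real and v :: "nat \<Rightarrow> nat \<Rightarrow> complex"
    assume b: "b \<ge> b0" and \<mu>: "\<mu> \<ge> 0" and v: "small_data b \<mu> v"
    have b_pos: "b \<ge> 1" using b by (simp add: b0_def)
    have "b \<ge> 1 / (eps * p0)" using b by (simp add: b0_def)
    then have b1: "eps * b * p0 \<ge> 1" using c(2) pos by (simp add: field_simps)
    have "b \<ge> 4 * A / eps" using b by (simp add: b0_def)
    then have b2: "eps * b \<ge> 4 * A" using c(2) by (simp add: field_simps)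
    have "b \<ge> 8 / eps * (c1 + Cloc)" using b by (simp add: b0_def)
    then have b3: "eps / 8 * b - Cloc \<ge> c1" using c(2) by (simp add: field_simps)
    define \<beta> where "\<beta> = eps / 8 * b - Cloc"
    define cc where "cc j = \<mu> * (if j \<in> far then exp (- (\<beta> * P (z j))) else 0)" for j
    have cc0: "cc j \<ge> 0" for j using \<mu> by (simp add: cc_def)
    have scc: "summable cc" unfolding cc_def by (intro summable_mult sm far_sub) (use b3 in \<open>simp add: \<beta>_def\<close>)
    have cc2: "suminf cc \<le> \<mu> / 2"
    proof -
      have "suminf cc = \<mu> * (\<Sum>j. if j \<in> far then exp (- (\<beta> * P (z j))) else 0)"
        unfolding cc_def by (intro suminf_mult sm far_sub) (use b3 in \<open>simp add: \<beta>_def\<close>)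
      also have "\<dots> \<le> \<mu> * (1/2)" using \<mu> b3 by (intro mult_left_mono sl far_sub) (auto simp: \<beta>_def)
      finally show ?thesis by simp
    qed
    have "\<exists>f. f holomorphic_on UNIV \<and> (\<forall>w. norm (f w) \<le> cc j * exp (3 * b * P w)) \<and>
        (j \<in> far \<longrightarrow> (\<forall>l<m j. fps_expansion f (z j) $ l = v j l)) \<and>
        (\<forall>k\<in>far. k \<noteq> j \<longrightarrow> (\<forall>l<m k. norm (fps_expansion f (z k) $ l) \<le> cc j * exp ((1 + eps / 16) * b * P (z k)) / \<sigma> ^ l))"
      for j
    proof (cases "j \<in> far")
      case False
      then show ?thesis by (intro exI[of _ "\<lambda>_. 0"]) (auto simp: cc_def fps_expansion_def)
    next
      case True
      then have j0: "r0 \<le> norm (z j)" using far_sub by auto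
      have vj: "\<And>l. l < m j \<Longrightarrow> norm (v j l) \<le> \<mu> * exp ((1 + eps / 16) * b * P (z j)) / \<sigma> ^ l"
        using v True by (auto simp: small_data_def)
      obtain f where f: "f holomorphic_on UNIV"
        and f1: "\<And>l. l < m j \<Longrightarrow> fps_expansion f (z j) $ l = v j l"
        and f2: "\<And>k l. k \<noteq> j \<Longrightarrow> norm (z j - z k) \<le> \<delta> * rad j \<Longrightarrow> l < m k \<Longrightarrow> fps_expansion f (z k) $ l = 0"
        and f3: "\<And>w. norm (f w) \<le> \<mu> * exp (b * P w + 3/8 * eps * b * P (z j) + Cloc * P (z j))"
        and f4: "\<And>w. norm (w - z j) \<ge> \<delta> / 2 * rad j \<Longrightarrow>
              norm (f w) \<le> \<mu> * exp (b * P w - eps / 8 * b * P (z j) + Cloc * P (z j))"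
        by (rule local_interpolant[OF True b1 b2 \<mu> vj]) blast+
      have f4': "norm (f w) \<le> cc j * exp (b * P w)" if "norm (w - z j) \<ge> \<delta> / 2 * rad j" for w
      proof -
        have "b * P w - eps / 8 * b * P (z j) + Cloc * P (z j) = - (\<beta> * P (z j)) + b * P w"
          by (simp add: \<beta>_def algebra_simps)
        then have "exp (b * P w - eps / 8 * b * P (z j) + Cloc * P (z j)) = exp (- (\<beta> * P (z j))) * exp (b * P w)"
          by (simp only: exp_add)
        then show ?thesis using f4[OF that] True by (simp add: cc_def mult.assoc)
      qed
      have "norm (f w) \<le> cc j * exp (3 * b * P w)" for w
      proof (cases "norm (w - z j) \<ge> \<delta> / 2 * rad j")
        case True
        have "exp (b * P w) \<le> exp (3 * b * P w)" using b_pos P_pos[of w] by simp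
        then show ?thesis using f4'[OF True] cc0[of j] by (meson mult_left_mono order_trans)
      next
        case False
        have "P (z j) \<le> 2 * P w" using False j0 by (intro P_near) auto
        then have "b * eps / 2 * P (z j) \<le> b * eps / 2 * (2 * P w)" using b_pos c(2) by (intro mult_left_mono) auto
        also have "\<dots> = eps * (b * P w)" by simp
        also have "\<dots> \<le> 2 * (b * P w)" using eps1 b_pos P_pos[of w] by (intro mult_right_mono) auto
        finally have "b * P w + 3/8 * eps * b * P (z j) + Cloc * P (z j) \<le> - (\<beta> * P (z j)) + 3 * b * P w"
          by (simp add: \<beta>_def algebra_simps)
        then have "exp (b * P w + 3/8 * eps * b * P (z j) + Cloc * P (z j)) \<le> exp (- (\<beta> * P (z j))) * exp (3 * b * P w)"
          by (simp add: exp_add[symmetric])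
        then have "\<mu> * exp (b * P w + 3/8 * eps * b * P (z j) + Cloc * P (z j)) \<le> \<mu> * (exp (- (\<beta> * P (z j))) * exp (3 * b * P w))"
          using \<mu> by (rule mult_left_mono)
        then show ?thesis using f3[of w] \<open>j \<in> far\<close> by (simp add: cc_def mult.assoc)
      qed
      moreover have "norm (fps_expansion f (z k) $ l) \<le> cc j * exp ((1 + eps / 16) * b * P (z k)) / \<sigma> ^ l"
        if k: "k \<in> far" "k \<noteq> j" "l < m k" for k l
      proof (cases "norm (z j - z k) \<le> \<delta> * rad j")
        case True
        then show ?thesis using f2[OF k(2) True k(3)] cc0[of j] c(3) by simp
      next
        case distant: False
        have k0: "r0 \<le> norm (z k)" using k(1) far_sub by auto
        show ?thesis
        proof (rule fps_expansion_Cauchy_bound_entire[OF f c(3)])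
          fix w assume w: "norm (w - z k) = \<sigma>"
          have "norm (z j - z k) \<le> norm (w - z k) + norm (w - z j)"
            using norm_triangle_ineq4[of "w - z k" "w - z j"] by simp
          moreover have "\<sigma> \<le> \<delta> / 2 * rad j"
          proof -
            have "\<delta> / 2 * \<rho>0 \<le> \<delta> / 2 * rad j" using rad[OF j0] \<delta> by (intro mult_left_mono) auto
            then show ?thesis using c(5) by simp
          qed
          ultimately have "norm (w - z j) \<ge> \<delta> / 2 * rad j" using distant w by (simp add: not_le)
          then have "norm (f w) \<le> cc j * exp (b * P w)" by (rule f4')
          also have "\<dots> \<le> cc j * exp ((1 + eps / 16) * b * P (z k))"
          proof (intro mult_left_mono cc0)
            have "\<kappa> (z k) * norm (w - z k) / norm (z k) = \<sigma> / rad k" by (simp add: rad_def w)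
            also have "\<dots> \<le> \<sigma> / \<rho>0" using rad[OF k0] c(3) pos by (intro divide_left_mono) auto
            finally have "exp (\<kappa> (z k) * norm (w - z k) / norm (z k)) \<le> 1 + eps / 16"
              using c(6) by (meson exp_le_cancel_iff order_trans)
            then have "P (z k) * exp (\<kappa> (z k) * norm (w - z k) / norm (z k)) \<le> P (z k) * (1 + eps / 16)"
              using P_pos[of "z k"] by (intro mult_left_mono) auto
            then have "P w \<le> P (z k) * (1 + eps / 16)" using P_upper[OF k0, of w] by linarith
            then have "b * P w \<le> b * (P (z k) * (1 + eps / 16))" using b_pos by (intro mult_left_mono) auto
            then show "exp (b * P w) \<le> exp ((1 + eps / 16) * b * P (z k))" by (simp add: mult_ac)
          qed
          finally show "norm (f w) \<le> cc j * exp ((1 + eps / 16) * b * P (z k))" .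
        qed
      qed
      ultimately show ?thesis using f f1 by (intro exI[of _ f]) auto
    qed
    then obtain f where f: "\<And>j. f j holomorphic_on UNIV"
      and f1: "\<And>j w. norm (f j w) \<le> cc j * exp (3 * b * P w)"
      and f2: "\<And>j l. j \<in> far \<Longrightarrow> l < m j \<Longrightarrow> fps_expansion (f j) (z j) $ l = v j l"
      and f3: "\<And>j k l. k \<in> far \<Longrightarrow> k \<noteq> j \<Longrightarrow> l < m k \<Longrightarrow> norm (fps_expansion (f j) (z k) $ l) \<le> cc j * exp ((1 + eps / 16) * b * P (z k)) / \<sigma> ^ l"
      by metis
    have lb: "\<exists>B. \<forall>w. norm w \<le> r \<longrightarrow> exp (3 * b * P w) \<le> B" for r
      using b_pos by (intro exp_P_locally_bounded) auto
    note ser = entire_series[OF f scc f1 lb cc0]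
    define g where "g w = (\<Sum>j. f j w)" for w
    have "norm (g w) \<le> \<mu> * exp (3 * b * P w)" for w
    proof -
      have "norm (g w) \<le> suminf cc * exp (3 * b * P w)" unfolding g_def by (rule ser(2))
      also have "\<dots> \<le> \<mu> * exp (3 * b * P w)" using cc2 \<mu> by (intro mult_right_mono) auto
      finally show ?thesis .
    qed
    moreover have "small_data b (\<mu> / 2) (\<lambda>j l. v j l - fps_expansion g (z j) $ l)"
      unfolding small_data_def
    proof (intro ballI allI impI)
      fix k l assume k: "k \<in> far" "l < m k"
      define D where "D = exp ((1 + eps / 16) * b * P (z k)) / \<sigma> ^ l"
      have D: "D \<ge> 0" using c(3) by (simp add: D_def)
      have "(\<lambda>j. fps_expansion (f j) (z k) $ l) sums (fps_expansion g (z k) $ l)"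
        unfolding g_def by (rule ser(3))
      from sums_diff[OF sums_single[of k "\<lambda>_. v k l"] this]
      have s: "(\<lambda>j. (if j = k then v k l else 0) - fps_expansion (f j) (z k) $ l) sums (v k l - fps_expansion g (z k) $ l)" .
      have t: "norm ((if j = k then v k l else 0) - fps_expansion (f j) (z k) $ l) \<le> cc j * D" for j
      proof (cases "j = k")
        case True
        then show ?thesis using f2[OF k] cc0[of k] D by simp
      next
        case False
        then show ?thesis using f3[OF k(1) _ k(2), of j] by (simp add: D_def)
      qed
      have sD: "summable (\<lambda>j. cc j * D)" using scc by (rule summable_mult2)
      have sn: "summable (\<lambda>j. norm ((if j = k then v k l else 0) - fps_expansion (f j) (z k) $ l))"
        using t by (intro summable_comparison_test[OF _ sD]) auto
      have "norm (v k l - fps_expansion g (z k) $ l) \<le> (\<Sum>j. norm ((if j = k then v k l else 0) - fps_expansion (f j) (z k) $ l))"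
        using summable_norm[OF sn] sums_unique[OF s] by simp
      also have "\<dots> \<le> (\<Sum>j. cc j * D)" using t sn sD by (rule suminf_le)
      also have "\<dots> = suminf cc * D" using scc by (rule suminf_mult2[symmetric])
      also have "\<dots> \<le> \<mu> / 2 * D" using cc2 D by (rule mult_right_mono)
      finally show "norm (v k l - fps_expansion g (z k) $ l) \<le> \<mu> / 2 * exp ((1 + eps / 16) * b * P (z k)) / \<sigma> ^ l"
        by (simp add: D_def)
    qed
    ultimately show "\<exists>f. f holomorphic_on UNIV \<and> (\<forall>w. norm (f w) \<le> \<mu> * exp (3 * b * P w)) \<and>
        small_data b (\<mu> / 2) (\<lambda>j l. v j l - fps_expansion f (z j) $ l)"
      using ser(1) unfolding g_def by blast
  qed
qed

text \<open>The errors of the successive approximations decrease geometrically, and the jets of the corrections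
telescope to the original data.\<close>

lemma exact_interpolation:
  obtains b0 where "b0 > 0" and "\<And>b \<mu> v. b \<ge> b0 \<Longrightarrow> \<mu> \<ge> 0 \<Longrightarrow> small_data b \<mu> v \<Longrightarrow>
    \<exists>f. f holomorphic_on UNIV \<and> (\<forall>w. norm (f w) \<le> 2 * \<mu> * exp (3 * b * P w)) \<and>
        (\<forall>j\<in>far. \<forall>l<m j. fps_expansion f (z j) $ l = v j l)"
proof -
  obtain b0 where b0: "b0 > 0" and ap: "\<And>b \<mu> v. b \<ge> b0 \<Longrightarrow> \<mu> \<ge> 0 \<Longrightarrow> small_data b \<mu> v \<Longrightarrow>
    \<exists>f. f holomorphic_on UNIV \<and> (\<forall>w. norm (f w) \<le> \<mu> * exp (3 * b * P w)) \<and>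
        small_data b (\<mu> / 2) (\<lambda>j l. v j l - fps_expansion f (z j) $ l)"
    using approximate_interpolation by blast
  show thesis
  proof (rule that[OF b0])
    fix b \<mu> :: real and v :: "nat \<Rightarrow> nat \<Rightarrow> complex"
    assume b: "b \<ge> b0" and \<mu>: "\<mu> \<ge> 0" and v: "small_data b \<mu> v"
    define ok where "ok n v f \<longleftrightarrow> f holomorphic_on UNIV \<and> (\<forall>w. norm (f w) \<le> \<mu> * (1/2) ^ n * exp (3 * b * P w)) \<and>
        small_data b (\<mu> * (1/2) ^ Suc n) (\<lambda>j l. v j l - fps_expansion f (z j) $ l)" for n v f
    have step: "\<exists>f. ok n v f" if "small_data b (\<mu> * (1/2) ^ n) v" for n v
      using ap[OF b _ that] \<mu> by (auto simp: ok_def)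
    define pick where "pick n v = (SOME f. ok n v f)" for n v
    define vs where "vs = rec_nat v (\<lambda>n u. (\<lambda>j l. u j l - fps_expansion (pick n u) (z j) $ l))"
    define fs where "fs n = pick n (vs n)" for n
    have vs0: "vs 0 = v" and vsS: "vs (Suc n) = (\<lambda>j l. vs n j l - fps_expansion (fs n) (z j) $ l)" for n
      by (simp_all add: vs_def fs_def)
    have small: "small_data b (\<mu> * (1/2) ^ n) (vs n)" for n
    proof (induction n)
      case 0
      then show ?case using v by (simp add: vs0)
    next
      case (Suc n)
      have "ok n (vs n) (fs n)" unfolding fs_def pick_def using step[OF Suc.IH] by (rule someI_ex)
      then show ?case by (simp add: ok_def vsS)
    qed
    have ok: "ok n (vs n) (fs n)" for n unfolding fs_def pick_def using step[OF small] by (rule someI_ex)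
    have f: "fs n holomorphic_on UNIV" for n using ok by (simp add: ok_def)
    have fb: "norm (fs n w) \<le> \<mu> * (1/2) ^ n * exp (3 * b * P w)" for n w using ok by (simp add: ok_def)
    have sg: "(\<lambda>n. \<mu> * (1/2) ^ n) sums (\<mu> * 2)"
      using sums_mult[OF geometric_sums[of "1/2 :: real"]] by simp
    have lb: "\<exists>B. \<forall>w. norm w \<le> r \<longrightarrow> exp (3 * b * P w) \<le> B" for r
      using b b0 by (intro exp_P_locally_bounded) auto
    have c0: "\<mu> * (1/2) ^ n \<ge> 0" for n using \<mu> by simp
    note ser = entire_series[OF f sums_summable[OF sg] fb lb c0]
    define g where "g w = (\<Sum>n. fs n w)" for w
    have "norm (g w) \<le> 2 * \<mu> * exp (3 * b * P w)" for w
      using ser(2)[of w] sums_unique[OF sg] by (simp add: g_def mult.commute)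
    moreover have "fps_expansion g (z j) $ l = v j l" if jl: "j \<in> far" "l < m j" for j l
    proof -
      define D where "D = exp ((1 + eps / 16) * b * P (z j)) / \<sigma> ^ l"
      have "(\<lambda>n. vs n j l) \<longlonglongrightarrow> 0"
      proof (rule Lim_null_comparison)
        show "eventually (\<lambda>n. norm (vs n j l) \<le> \<mu> * (1/2) ^ n * D) sequentially"
          using small jl by (simp add: small_data_def D_def)
        have "(\<lambda>n. \<mu> * (1/2) ^ n * D) \<longlonglongrightarrow> \<mu> * 0 * D"
          by (intro tendsto_intros LIMSEQ_power_zero) auto
        then show "(\<lambda>n. \<mu> * (1/2) ^ n * D) \<longlonglongrightarrow> 0" by simp
      qed
      from telescope_sums'[OF this] have "(\<lambda>n. vs n j l - vs (Suc n) j l) sums (v j l)" by (simp add: vs0)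
      then have "(\<lambda>n. fps_expansion (fs n) (z j) $ l) sums (v j l)" by (simp add: vsS)
      then show ?thesis using ser(3) sums_unique2 unfolding g_def by blast
    qed
    ultimately show "\<exists>f. f holomorphic_on UNIV \<and> (\<forall>w. norm (f w) \<le> 2 * \<mu> * exp (3 * b * P w)) \<and>
        (\<forall>j\<in>far. \<forall>l<m j. fps_expansion f (z j) $ l = v j l)"
      using ser(1) unfolding g_def by blast
  qed
qed

text \<open>The given exponent \<open>B0\<close> of the data is no obstacle, since \<open>b\<close> may be taken as large as needed.\<close>

theorem interpolation_far_points:
  assumes "A0 \<ge> 0" and w: "\<And>j l. j \<in> far \<Longrightarrow> l < m j \<Longrightarrow> norm (w j l) \<le> A0 * exp (B0 * P (z j))"
  shows "\<exists>f A1 B1. f holomorphic_on UNIV \<and> A1 > 0 \<and> B1 > 0 \<and> (\<forall>w. norm (f w) \<le> A1 * exp (B1 * P w)) \<and>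
        (\<forall>j\<in>far. \<forall>l<m j. fps_expansion f (z j) $ l = w j l)"
proof -
  note c = constants
  obtain b0 where b0: "b0 > 0" and ex: "\<And>b \<mu> v. b \<ge> b0 \<Longrightarrow> \<mu> \<ge> 0 \<Longrightarrow> small_data b \<mu> v \<Longrightarrow>
    \<exists>f. f holomorphic_on UNIV \<and> (\<forall>w. norm (f w) \<le> 2 * \<mu> * exp (3 * b * P w)) \<and>
        (\<forall>j\<in>far. \<forall>l<m j. fps_expansion f (z j) $ l = v j l)"
    using exact_interpolation by blast
  define b where "b = max b0 B0"
  have "small_data b (A0 + 1) w"
    unfolding small_data_def
  proof (intro ballI allI impI)
    fix j l assume jl: "j \<in> far" "l < m j"
    have "b \<ge> 0" using b0 by (simp add: b_def)
    then have "b \<le> (1 + eps / 16) * b" using c(2) by (simp add: distrib_right)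
    then have "B0 \<le> (1 + eps / 16) * b" by (simp add: b_def)
    then have "exp (B0 * P (z j)) \<le> exp ((1 + eps / 16) * b * P (z j))"
      using P_pos[of "z j"] by simp
    then have "A0 * exp (B0 * P (z j)) \<le> (A0 + 1) * exp ((1 + eps / 16) * b * P (z j))"
      using assms(1) by (intro mult_mono) auto
    also have "\<dots> \<le> (A0 + 1) * exp ((1 + eps / 16) * b * P (z j)) / \<sigma> ^ l"
      using c(3,4) assms(1) by (subst pos_le_divide_eq) (auto simp: mult_left_le power_le_one)
    finally show "norm (w j l) \<le> (A0 + 1) * exp ((1 + eps / 16) * b * P (z j)) / \<sigma> ^ l"
      using w[OF jl] by linarith
  qed
  with ex[of b "A0 + 1" w] assms(1) obtain f where "f holomorphic_on UNIV" "\<And>w. norm (f w) \<le> 2 * (A0 + 1) * exp (3 * b * P w)"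
     "\<forall>j\<in>far. \<forall>l<m j. fps_expansion f (z j) $ l = w j l" by (auto simp: b_def)
  moreover have "2 * (A0 + 1) > 0" "3 * b > 0" using assms(1) b0 by (auto simp: b_def)
  ultimately show ?thesis by blast
qed

end

section \<open>The algebra of the weight and finitely many further points\<close>

lemma weight_nonneg: "weight p \<Longrightarrow> p w \<ge> 0"
  by (simp add: weight_def)

lemma weight_log:
  assumes "weight p"
  obtains M where "M > 0" "\<And>w. 1 + (norm w)\<^sup>2 \<le> M * exp (M * p w)"
proof -
  have "(\<lambda>z. ln (1 + (norm z)\<^sup>2)) \<in> O[at_infinity](p)" using assms by (simp add: weight_def)
  then obtain c where c: "c > 0" "eventually (\<lambda>w. norm (ln (1 + (norm w)\<^sup>2)) \<le> c * norm (p w)) at_infinity"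
    by (elim landau_o.bigE)
  from c(2) obtain r where r: "\<And>w. norm w \<ge> r \<Longrightarrow> norm (ln (1 + (norm w)\<^sup>2)) \<le> c * norm (p w)"
    by (auto simp: eventually_at_infinity)
  define M where "M = max c (1 + r\<^sup>2)"
  have M: "M \<ge> c" "M \<ge> 1 + r\<^sup>2" by (auto simp: M_def)
  moreover have "r\<^sup>2 \<ge> 0" by simp
  ultimately have M1: "M \<ge> 1" by linarith
  have "1 + (norm w)\<^sup>2 \<le> M * exp (M * p w)" for w
  proof (cases "norm w \<ge> r")
    case True
    have p: "1 + (norm w)\<^sup>2 > 0" by (simp add: add_pos_nonneg)
    have "ln (1 + (norm w)\<^sup>2) \<le> c * p w" using r[OF True] weight_nonneg[OF assms, of w] by simp
    also have "\<dots> \<le> M * p w" using M weight_nonneg[OF assms, of w] by (intro mult_right_mono) auto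
    finally have "1 + (norm w)\<^sup>2 \<le> exp (M * p w)" using p by (metis exp_le_cancel_iff exp_ln)
    also have "\<dots> \<le> M * exp (M * p w)" using M1 by simp
    finally show ?thesis .
  next
    case False
    then have "(norm w)\<^sup>2 \<le> r\<^sup>2" by (intro power_mono) auto
    then have "1 + (norm w)\<^sup>2 \<le> M * 1" using M by simp
    also have "\<dots> \<le> M * exp (M * p w)" using M1 weight_nonneg[OF assms, of w] by (intro mult_left_mono) auto
    finally show ?thesis .
  qed
  then show thesis using that[of M] M1 by auto
qed

lemma A_spaceI:
  assumes "weight p" "f holomorphic_on UNIV" "\<And>w. norm (f w) \<le> A * exp (B * p w)"
  shows "f \<in> A_space p"
proof -
  have "norm (f w) \<le> (\<bar>A\<bar> + 1) * exp ((\<bar>B\<bar> + 1) * p w)" for w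
  proof -
    have "B * p w \<le> (\<bar>B\<bar> + 1) * p w" using weight_nonneg[OF assms(1), of w] by (intro mult_right_mono) auto
    then have "A * exp (B * p w) \<le> (\<bar>A\<bar> + 1) * exp ((\<bar>B\<bar> + 1) * p w)" by (intro mult_mono) auto
    then show ?thesis using assms(3)[of w] by linarith
  qed
  moreover have "\<bar>A\<bar> + 1 > 0" "\<bar>B\<bar> + 1 > 0" by auto
  ultimately show ?thesis using assms(2) unfolding A_space_def by blast
qed

lemma A_space_holomorphic: "f \<in> A_space p \<Longrightarrow> f holomorphic_on UNIV"
  by (simp add: A_space_def)

lemma A_space_bound:
  assumes "f \<in> A_space p"
  obtains A B where "A > 0" "B > 0" "\<And>w. norm (f w) \<le> A * exp (B * p w)"
  using assms by (auto simp: A_space_def)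

lemma A_space_add:
  assumes "weight p" "f \<in> A_space p" "g \<in> A_space p"
  shows "(\<lambda>w. f w + g w) \<in> A_space p"
proof -
  obtain A B where f: "A > 0" "B > 0" "\<And>w. norm (f w) \<le> A * exp (B * p w)" using A_space_bound[OF assms(2)] by blast
  obtain A' B' where g: "A' > 0" "B' > 0" "\<And>w. norm (g w) \<le> A' * exp (B' * p w)" using A_space_bound[OF assms(3)] by blast
  have "norm (f w + g w) \<le> (A + A') * exp (max B B' * p w)" for w
  proof -
    have "A * exp (B * p w) \<le> A * exp (max B B' * p w)" "A' * exp (B' * p w) \<le> A' * exp (max B B' * p w)"
      using weight_nonneg[OF assms(1), of w] f g by (auto intro!: mult_right_mono)
    then show ?thesis using norm_triangle_ineq[of "f w" "g w"] f(3)[of w] g(3)[of w]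
      by (simp add: distrib_right)
  qed
  then show ?thesis by (intro A_spaceI[OF assms(1)] holomorphic_intros A_space_holomorphic[OF assms(2)]
      A_space_holomorphic[OF assms(3)]) auto
qed

lemma A_space_mult:
  assumes "weight p" "f \<in> A_space p" "g \<in> A_space p"
  shows "(\<lambda>w. f w * g w) \<in> A_space p"
proof -
  obtain A B where f: "A > 0" "B > 0" "\<And>w. norm (f w) \<le> A * exp (B * p w)" using A_space_bound[OF assms(2)] by blast
  obtain A' B' where g: "A' > 0" "B' > 0" "\<And>w. norm (g w) \<le> A' * exp (B' * p w)" using A_space_bound[OF assms(3)] by blast
  have "norm (f w * g w) \<le> (A * A') * exp ((B + B') * p w)" for w
  proof -
    have "norm (f w * g w) \<le> (A * exp (B * p w)) * (A' * exp (B' * p w))"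
      unfolding norm_mult using f g by (intro mult_mono) auto
    also have "\<dots> = (A * A') * exp ((B + B') * p w)" by (simp add: exp_add distrib_right)
    finally show ?thesis .
  qed
  then show ?thesis by (intro A_spaceI[OF assms(1)] holomorphic_intros A_space_holomorphic[OF assms(2)]
      A_space_holomorphic[OF assms(3)]) auto
qed

lemma A_space_const: "weight p \<Longrightarrow> (\<lambda>_. c) \<in> A_space p"
  by (rule A_spaceI[where A="norm c" and B=0]) auto

lemma A_space_linear:
  assumes "weight p"
  shows "(\<lambda>w. w - a) \<in> A_space p"
proof -
  obtain M where M: "M > 0" "\<And>w. 1 + (norm w)\<^sup>2 \<le> M * exp (M * p w)" using weight_log[OF assms] by blast
  have "norm (w - a) \<le> (M + norm a) * exp (M * p w)" for w
  proof -
    have "norm w \<le> 1 + (norm w)\<^sup>2" using sum_squares_bound[of "norm w" 1] norm_ge_zero[of w]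
      unfolding power2_eq_square by linarith
    moreover have "norm a * 1 \<le> norm a * exp (M * p w)"
      using M weight_nonneg[OF assms, of w] by (intro mult_left_mono) auto
    ultimately show ?thesis using norm_triangle_ineq4[of w a] M(2)[of w] by (simp add: distrib_right)
  qed
  then show ?thesis by (intro A_spaceI[OF assms]) (auto intro!: holomorphic_intros)
qed

lemma A_space_polynomial:
  assumes "weight p"
  shows "(\<lambda>w. \<Sum>l<m. c l * (w - a) ^ l) \<in> A_space p"
proof -
  have pw: "(\<lambda>w. (w - a) ^ l) \<in> A_space p" for l
    by (induction l) (auto intro!: A_space_const A_space_mult A_space_linear assms)
  show ?thesis
    by (induction m) (auto intro!: A_space_const A_space_mult A_space_add pw assms)
qed

text \<open>Away from \<open>a\<close> the quotient is smaller than \<open>f\<close>, and on the closed unit disc around \<open>a\<close> it is bounded.\<close>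

lemma A_space_divide:
  assumes p: "weight p" and f: "f \<in> A_space p" and h: "h holomorphic_on UNIV"
    and fh: "\<And>w. f w = (w - a) ^ k * h w"
  shows "h \<in> A_space p"
proof -
  obtain A B where AB: "A > 0" "B > 0" "\<And>w. norm (f w) \<le> A * exp (B * p w)" using A_space_bound[OF f] by blast
  have "compact (h ` cball a 1)"
    using h by (intro compact_continuous_image holomorphic_on_imp_continuous_on) (auto intro: holomorphic_on_subset)
  then obtain C where C: "\<And>w. w \<in> cball a 1 \<Longrightarrow> norm (h w) \<le> C"
    by (meson bounded_iff compact_imp_bounded imageI)
  have "norm (h w) \<le> max A C * exp (B * p w)" for w
  proof (cases "w \<in> cball a 1")
    case True
    have "norm (h w) \<le> max A C * 1" using C[OF True] by simp
    also have "\<dots> \<le> max A C * exp (B * p w)"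
      using AB weight_nonneg[OF p, of w] by (intro mult_left_mono) auto
    finally show ?thesis .
  next
    case False
    then have "norm (w - a) ^ k \<ge> 1" by (intro one_le_power) (auto simp: dist_norm norm_minus_commute)
    then have "1 * norm (h w) \<le> norm (w - a) ^ k * norm (h w)" by (intro mult_right_mono) auto
    also have "\<dots> = norm (f w)" by (simp add: fh norm_mult norm_power)
    also have "\<dots> \<le> A * exp (B * p w)" by (rule AB)
    also have "\<dots> \<le> max A C * exp (B * p w)" by (intro mult_right_mono) auto
    finally show ?thesis by simp
  qed
  then show ?thesis by (rule A_spaceI[OF p h])
qed

definition interpolates_on :: "(complex \<Rightarrow> real) \<Rightarrow> (nat \<Rightarrow> complex) \<Rightarrow> (nat \<Rightarrow> nat) \<Rightarrow> nat set \<Rightarrow> bool" where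
  "interpolates_on p z m J \<longleftrightarrow>
     (\<forall>w :: nat \<Rightarrow> nat \<Rightarrow> complex.
        (\<exists>A>0. \<exists>B>0. \<forall>j\<in>J. (\<Sum>l<m j. norm (w j l)) \<le> A * exp (B * p (z j))) \<longrightarrow>
        (\<exists>f\<in>A_space p. \<forall>j\<in>J. \<forall>l<m j. fps_expansion f (z j) $ l = w j l))"

lemma interpolating_variety_iff: "interpolating_variety p z m \<longleftrightarrow> interpolates_on p z m UNIV"
  unfolding interpolating_variety_def interpolates_on_def by (simp add: fps_expansion_def)

text \<open>Such a function is \<open>w - z j0\<close> times a solution with zero data except for the top coefficient at \<open>z j0\<close>.\<close>

lemma interpolates_on_nontrivial_zero:
  assumes p: "weight p" and J: "interpolates_on p z m J" "j0 \<in> J" and m: "\<And>j. m j > 0"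
  obtains F where "F \<in> A_space p" "\<exists>w. F w \<noteq> 0"
    "\<And>j l. j \<in> J \<Longrightarrow> l < m j \<Longrightarrow> fps_expansion F (z j) $ l = 0"
proof -
  define v :: "nat \<Rightarrow> nat \<Rightarrow> complex" where "v j l = (if j = j0 \<and> l = m j0 - 1 then 1 else 0)" for j l
  have "(\<Sum>l<m j. norm (v j l)) \<le> 1 * exp (1 * p (z j))" for j
  proof -
    have "(\<Sum>l<m j. norm (v j l)) = (\<Sum>l<m j. if l = m j0 - 1 then (if j = j0 then 1 else 0) else 0)"
      by (intro sum.cong) (auto simp: v_def)
    also have "\<dots> \<le> 1" by simp
    also have "1 \<le> exp (p (z j))" using weight_nonneg[OF p, of "z j"] by simp
    finally show ?thesis by simp
  qed
  then have "\<exists>A>0. \<exists>B>0. \<forall>j\<in>J. (\<Sum>l<m j. norm (v j l)) \<le> A * exp (B * p (z j))"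
    by (intro exI[of _ 1] conjI) auto
  then obtain f where f: "f \<in> A_space p" "\<And>j l. j \<in> J \<Longrightarrow> l < m j \<Longrightarrow> fps_expansion f (z j) $ l = v j l"
    using J(1) unfolding interpolates_on_def by blast
  define F where "F w = (w - z j0) ^ 1 * f w" for w
  note fh = A_space_holomorphic[OF f(1)]
  have FX: "fps_expansion F a = (fps_X + fps_const (a - z j0)) ^ 1 * fps_expansion f a" for a
    unfolding F_def by (subst fps_expansion_entire_mult; (unfold fps_expansion_linear_power)?)
       (auto intro!: holomorphic_intros fh)
  have top: "fps_expansion f (z j0) $ (m j0 - 1) = 1" using f(2)[of j0 "m j0 - 1"] J(2) m[of j0] by (simp add: v_def)
  show thesis
  proof (rule that[of F])
    show "F \<in> A_space p" unfolding F_def power_one_right by (intro A_space_mult A_space_linear f p)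
    have "fps_expansion F (z j0) $ m j0 = 1" using top m[of j0] by (simp add: FX)
    then show "\<exists>w. F w \<noteq> 0"
    proof (rule contrapos_pp)
      assume "\<nexists>w. F w \<noteq> 0"
      then have "F = (\<lambda>_. 0)" by auto
      then have "fps_expansion F (z j0) = 0" by (simp add: fps_expansion_def fps_eq_iff)
      then show "fps_expansion F (z j0) $ m j0 \<noteq> 1" by simp
    qed
    fix j l assume jl: "j \<in> J" "l < m j"
    show "fps_expansion F (z j) $ l = 0"
    proof (cases "j = j0")
      case True
      then show ?thesis using f(2)[of j0 "l - 1"] jl by (auto simp: FX v_def)
    next
      case False
      then have "\<forall>l<m j. fps_expansion f (z j) $ l = 0" using f(2) jl by (auto simp: v_def)
      then show ?thesis
        unfolding FX by (subst mult.commute) (rule fps_mult_nth_eq_0[OF _ jl(2)])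
    qed
  qed
qed

text \<open>Let \<open>g\<close> interpolate on \<open>J\<close>. A nonzero function of the algebra that vanishes on \<open>J\<close>, divided by its zero at
the new point \<open>z a\<close>, gives \<open>h\<close> with \<open>h (z a) \<noteq> 0\<close>; then \<open>g + h * Q\<close> has the right jet at \<open>z a\<close> for a
suitable polynomial \<open>Q\<close>.\<close>

lemma interpolates_on_insert:
  assumes p: "weight p" and J: "interpolates_on p z m J" "J \<noteq> {}" and m: "\<And>j. m j > 0" and z: "inj z"
    and a: "a \<notin> J"
  shows "interpolates_on p z m (insert a J)"
  unfolding interpolates_on_def
proof (intro allI impI)
  fix v :: "nat \<Rightarrow> nat \<Rightarrow> complex"
  assume "\<exists>A>0. \<exists>B>0. \<forall>j\<in>insert a J. (\<Sum>l<m j. norm (v j l)) \<le> A * exp (B * p (z j))"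
  then have "\<exists>A>0. \<exists>B>0. \<forall>j\<in>J. (\<Sum>l<m j. norm (v j l)) \<le> A * exp (B * p (z j))" by blast
  then obtain g where g: "g \<in> A_space p" "\<And>j l. j \<in> J \<Longrightarrow> l < m j \<Longrightarrow> fps_expansion g (z j) $ l = v j l"
    using J(1) unfolding interpolates_on_def by blast
  obtain j0 where j0: "j0 \<in> J" using J(2) by blast
  obtain F where F: "F \<in> A_space p" "\<exists>w. F w \<noteq> 0"
    "\<And>j l. j \<in> J \<Longrightarrow> l < m j \<Longrightarrow> fps_expansion F (z j) $ l = 0"
    using interpolates_on_nontrivial_zero[OF p J(1) j0 m] by blast
  note Fh = A_space_holomorphic[OF F(1)] and gh = A_space_holomorphic[OF g(1)]
  have "\<exists>k. fps_expansion F (z a) $ k \<noteq> 0"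
  proof (rule ccontr)
    assume *: "\<nexists>k. fps_expansion F (z a) $ k \<noteq> 0"
    have "F w = 0" for w
      by (rule holomorphic_fun_eq_0_on_connected[of F UNIV "z a"])
         (use Fh * in \<open>auto simp: fps_expansion_def\<close>)
    then show False using F(2) by blast
  qed
  then obtain k where k: "fps_expansion F (z a) $ k \<noteq> 0" "\<forall>l<k. fps_expansion F (z a) $ l = 0"
    using exists_least_iff[of "\<lambda>k. fps_expansion F (z a) $ k \<noteq> 0"] by auto
  obtain h where h: "h holomorphic_on UNIV" "\<And>w. F w = (w - z a) ^ k * h w"
    using entire_divide_zero[OF Fh k(2)] by blast
  have hA: "h \<in> A_space p" by (rule A_space_divide[OF p F(1) h])
  have Feq: "F = (\<lambda>w. (w - z a) ^ k * h w)" using h(2) by auto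
  have "fps_expansion F (z a) = fps_X ^ k * fps_expansion h (z a)"
    unfolding Feq by (subst fps_expansion_entire_mult) (auto intro!: holomorphic_intros h simp: fps_expansion_linear_power)
  then have ha: "h (z a) \<noteq> 0" using k(1) by (simp add: fps_X_power_mult_nth fps_expansion_def)
  have hz: "\<forall>l<m j. fps_expansion h (z j) $ l = 0" if j: "j \<in> J" for j
  proof (intro allI impI)
    fix l assume l: "l < m j"
    have "z j \<noteq> z a" using z a j by (auto dest: injD)
    then show "fps_expansion h (z j) $ l = 0"
      using F(3)[OF j] l unfolding Feq
      by (intro fps_expansion_vanish_cancel[of "\<lambda>w. (w - z a) ^ k" h "z j" "m j"]) (auto intro!: holomorphic_intros h)
  qed
  obtain r c where rc: "r > 0" "c > 0" "\<And>w. norm (w - z a) \<le> r \<Longrightarrow> c \<le> norm (h w)"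
  proof -
    have "isCont h (z a)" using holomorphic_on_imp_continuous_on[OF h(1)] continuous_on_eq_continuous_at[OF open_UNIV, of h] by blast
    then have "\<exists>d>0. \<forall>w. dist w (z a) < d \<longrightarrow> dist (h w) (h (z a)) < norm (h (z a)) / 2"
      unfolding continuous_at_eps_delta using ha by (meson half_gt_zero zero_less_norm_iff)
    then obtain d where d: "d > 0" "\<And>w. dist w (z a) < d \<Longrightarrow> dist (h w) (h (z a)) < norm (h (z a)) / 2" by blast
    show ?thesis
    proof (rule that[of "d/2" "norm (h (z a)) / 2"])
      fix w assume "norm (w - z a) \<le> d / 2"
      then have "dist (h w) (h (z a)) < norm (h (z a)) / 2" using d by (intro d(2)) (auto simp: dist_norm)
      then show "norm (h (z a)) / 2 \<le> norm (h w)"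
        using norm_triangle_ineq2[of "h (z a)" "h w"] by (simp add: dist_norm norm_minus_commute)
    qed (use d ha in auto)
  qed
  define u where "u l = v a l - fps_expansion g (z a) $ l" for l
  have M: "norm (\<Sum>l<m a. u l * (w - z a) ^ l) \<le> (\<Sum>l<m a. norm (u l) * r ^ l)" if "norm (w - z a) = r" for w
    using norm_sum[of "\<lambda>l. u l * (w - z a) ^ l" "{..<m a}"] that by (simp add: norm_mult norm_power)
  obtain \<psi> where \<psi>: "\<And>l. l < m a \<Longrightarrow> fps_expansion (\<lambda>w. h w * (\<Sum>l<m a. \<psi> l * (w - z a) ^ l)) (z a) $ l = u l"
    using jet_quotient[where m="m a", OF h(1) rc M] by blast
  define Q where "Q w = (\<Sum>l<m a. \<psi> l * (w - z a) ^ l)" for w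
  have Q: "Q \<in> A_space p" unfolding Q_def by (rule A_space_polynomial[OF p])
  note Qh = A_space_holomorphic[OF Q]
  define f where "f w = g w + h w * Q w" for w
  have "f \<in> A_space p" unfolding f_def by (intro A_space_add A_space_mult p g hA Q)
  moreover have "fps_expansion f (z j) $ l = v j l" if jl: "j \<in> insert a J" "l < m j" for j l
  proof -
    have e: "fps_expansion f (z j) $ l = fps_expansion g (z j) $ l + fps_expansion (\<lambda>w. h w * Q w) (z j) $ l"
      unfolding f_def by (subst fps_expansion_entire_add) (auto intro!: holomorphic_intros gh h Qh)
    show ?thesis
    proof (cases "j = a")
      case True
      then show ?thesis using e \<psi>[of l] jl by (simp add: Q_def[abs_def] u_def)
    next
      case False
      then have "j \<in> J" using jl by simp
      then show ?thesis
        using e g(2)[OF _ jl(2)] fps_expansion_vanish_mult[OF h(1) Qh hz jl(2)] by simp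
    qed
  qed
  ultimately show "\<exists>f\<in>A_space p. \<forall>j\<in>insert a J. \<forall>l<m j. fps_expansion f (z j) $ l = v j l" by blast
qed

lemma interpolates_on_Un_finite:
  assumes p: "weight p" and J: "interpolates_on p z m J" "J \<noteq> {}" and m: "\<And>j. m j > 0" and z: "inj z"
    and F: "finite F"
  shows "interpolates_on p z m (J \<union> F)"
  using F
proof (induction F rule: finite_induct)
  case empty
  then show ?case using J by simp
next
  case (insert a F)
  show ?case
  proof (cases "a \<in> J")
    case True
    then show ?thesis using insert.IH by (simp add: insert_absorb)
  next
    case False
    then show ?thesis
      using interpolates_on_insert[OF p insert.IH _ m z, of a] J insert.hyps by auto
  qed
qed

section \<open>Uniform bounds and Jensen's inequality\<close>

lemma weight_locally_bounded:
  assumes "weight p"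
  shows "\<exists>B. \<forall>w. norm w \<le> r \<longrightarrow> p w \<le> B"
proof -
  have op: "open {w. p w < real n}" for n using assms by (auto simp: weight_def subharmonic_def)
  have cover: "cball (0::complex) r \<subseteq> (\<Union>n\<in>UNIV. {w. p w < real n})"
    using reals_Archimedean2 by auto
  obtain C where C: "finite C" "cball (0::complex) r \<subseteq> (\<Union>n\<in>C. {w. p w < real n})"
    using op by (rule compactE_image[OF compact_cball _ cover])
  have "p w \<le> real (\<Sum>C)" if "norm w \<le> r" for w
  proof -
    have "w \<in> cball 0 r" using that by simp
    then obtain n where n: "n \<in> C" "p w < real n" using C(2) by blast
    have "n \<le> \<Sum>C" using member_le_sum[of n C "\<lambda>n. n"] C(1) n(1) by simp
    then show ?thesis using n(2) by linarith
  qed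
  then show ?thesis by blast
qed

text \<open>Data indexed by subsets of the naturals: the Cantor space on which the Baire argument runs.\<close>

definition top_jets :: "(nat \<Rightarrow> nat) \<Rightarrow> nat set \<Rightarrow> nat \<Rightarrow> nat \<Rightarrow> complex" where
  "top_jets m C k l = (if k \<in> C \<and> l = m k - 1 then 1 else 0)"

definition solves :: "(complex \<Rightarrow> real) \<Rightarrow> (nat \<Rightarrow> complex) \<Rightarrow> (nat \<Rightarrow> nat) \<Rightarrow> nat \<Rightarrow> nat set \<Rightarrow> (complex \<Rightarrow> complex) \<Rightarrow> bool" where
  "solves p z m n C f \<longleftrightarrow> f holomorphic_on UNIV \<and> (\<forall>w. norm (f w) \<le> real n * exp (real n * p w)) \<and>
     (\<forall>k. \<forall>l<m k. fps_expansion f (z k) $ l = top_jets m C k l)"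

lemma solves_exists:
  assumes p: "weight p" and int: "interpolates_on p z m UNIV"
  shows "\<exists>n f. solves p z m n C f"
proof -
  have "(\<Sum>l<m j. norm (top_jets m C j l)) \<le> 1 * exp (1 * p (z j))" for j
  proof -
    have "(\<Sum>l<m j. norm (top_jets m C j l)) = (\<Sum>l<m j. if l = m j - 1 then (if j \<in> C then 1 else 0) else 0)"
      by (intro sum.cong) (auto simp: top_jets_def)
    also have "\<dots> \<le> 1" by simp
    also have "1 \<le> exp (p (z j))" using weight_nonneg[OF p, of "z j"] by simp
    finally show ?thesis by simp
  qed
  then have "\<exists>A>0. \<exists>B>0. \<forall>j\<in>UNIV. (\<Sum>l<m j. norm (top_jets m C j l)) \<le> A * exp (B * p (z j))"
    by (intro exI[of _ 1] conjI) auto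
  then obtain f where f: "f \<in> A_space p" "\<And>j l. l < m j \<Longrightarrow> fps_expansion f (z j) $ l = top_jets m C j l"
    using int unfolding interpolates_on_def by blast
  obtain A B where AB: "A > 0" "B > 0" "\<And>w. norm (f w) \<le> A * exp (B * p w)" using A_space_bound[OF f(1)] by blast
  obtain n :: nat where n: "max A B \<le> real n" using real_arch_simple by blast
  have "norm (f w) \<le> real n * exp (real n * p w)" for w
  proof -
    have "A * exp (B * p w) \<le> real n * exp (real n * p w)"
      using n AB weight_nonneg[OF p, of w] by (intro mult_mono) (auto intro!: mult_right_mono)
    then show ?thesis using AB(3)[of w] by linarith
  qed
  then show ?thesis using f A_space_holomorphic[OF f(1)] unfolding solves_def by blast
qed

text \<open>The sets of data that are solvable with bound \<open>n\<close> are closed in the Cantor space, by Montel's theorem: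
only finitely many coordinates matter for each Taylor coefficient.\<close>

lemma solves_closed:
  assumes p: "weight p"
    and approx: "\<And>K. \<exists>C' f. (\<forall>i<K. (i \<in> C') = (i \<in> C)) \<and> solves p z m n C' f"
  shows "\<exists>f. solves p z m n C f"
proof -
  obtain D g where D: "\<And>K. (\<forall>i<K. (i \<in> D K) = (i \<in> C))" and g: "\<And>K. solves p z m n (D K) (g K)"
    using approx by metis
  have gh: "g K holomorphic_on UNIV" for K using g by (simp add: solves_def)
  have gb: "norm (g K w) \<le> real n * exp (real n * p w)" for K w using g by (simp add: solves_def)
  have bdd: "\<exists>B. \<forall>h\<in>range g. \<forall>w\<in>T. norm (h w) \<le> B" if "compact T" for T
  proof -
    obtain r where r: "\<And>w. w \<in> T \<Longrightarrow> norm w \<le> r" using \<open>compact T\<close> by (meson bounded_iff compact_imp_bounded)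
    obtain B where B: "\<And>w. norm w \<le> r \<Longrightarrow> p w \<le> B" using weight_locally_bounded[OF p] by blast
    have "norm (g K w) \<le> real n * exp (real n * B)" if "w \<in> T" for K w
    proof -
      have "real n * exp (real n * p w) \<le> real n * exp (real n * B)"
        using B[OF r[OF that]] by (intro mult_left_mono) (auto intro!: mult_left_mono)
      then show ?thesis using gb[of K w] by linarith
    qed
    then show ?thesis by blast
  qed
  obtain f r where f: "f holomorphic_on UNIV" and r: "strict_mono (r :: nat \<Rightarrow> nat)"
    and pt: "\<And>w. (\<lambda>i. g (r i) w) \<longlonglongrightarrow> f w"
    and ul: "\<And>T. compact T \<Longrightarrow> uniform_limit T (g \<circ> r) f sequentially"
  proof (rule Montel[of UNIV "range g" g])
    fix f r assume "f holomorphic_on UNIV" "strict_mono (r :: nat \<Rightarrow> nat)"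
      "\<And>x. x \<in> UNIV \<Longrightarrow> (\<lambda>n. g (r n) x) \<longlonglongrightarrow> f x"
      "\<And>K. compact K \<Longrightarrow> K \<subseteq> UNIV \<Longrightarrow> uniform_limit K (g \<circ> r) f sequentially"
    then show ?thesis by (intro that[of f r]) auto
  qed (use gh bdd in auto)
  have "norm (f w) \<le> real n * exp (real n * p w)" for w
    using tendsto_norm[OF pt[of w]] gb by (intro LIMSEQ_le_const2) auto
  moreover have "fps_expansion f (z k) $ l = top_jets m C k l" if l: "l < m k" for k l
  proof -
    have "(\<lambda>i. fps_expansion ((g \<circ> r) i) (z k) $ l) \<longlonglongrightarrow> fps_expansion f (z k) $ l"
      using gh by (intro fps_expansion_uniform_limit f ul) auto
    moreover have "eventually (\<lambda>i. fps_expansion ((g \<circ> r) i) (z k) $ l = top_jets m C k l) sequentially"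
    proof (rule eventually_sequentiallyI)
      fix i assume "i \<ge> Suc k"
      then have "k < r i" using seq_suble[OF r, of i] by linarith
      then have "k \<in> D (r i) \<longleftrightarrow> k \<in> C" using D[of "r i"] by blast
      then show "fps_expansion ((g \<circ> r) i) (z k) $ l = top_jets m C k l"
        using g[of "r i"] l by (auto simp: solves_def top_jets_def)
    qed
    then have "(\<lambda>i. fps_expansion ((g \<circ> r) i) (z k) $ l) \<longlonglongrightarrow> top_jets m C k l"
      by (rule tendsto_eventually)
    ultimately show ?thesis by (rule LIMSEQ_unique)
  qed
  ultimately show ?thesis using f unfolding solves_def by blast
qed

text \<open>The Baire category theorem for countably many closed sets that cover the Cantor space, proved by
nested cylinders: if no bound \<open>n\<close> worked on a cylinder, prefixes could be extended successively so as to
exclude the bounds \<open>0, 1, 2, \<dots>\<close>, and the limit set would not be solvable at all.\<close>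

lemma solves_uniformly_on_cylinder:
  assumes p: "weight p" and int: "interpolates_on p z m UNIV"
  shows "\<exists>n K C. \<forall>C'. (\<forall>i<K. (i \<in> C') = (i \<in> C)) \<longrightarrow> (\<exists>f. solves p z m n C' f)"
proof (rule ccontr)
  assume nt: "\<not> (\<exists>n K C. \<forall>C'. (\<forall>i<K. (i \<in> C') = (i \<in> C)) \<longrightarrow> (\<exists>f. solves p z m n C' f))"
  have neg: "\<exists>C'. (\<forall>i<K. (i \<in> C') = (i \<in> C)) \<and> \<not> (\<exists>f. solves p z m n C' f)" for n K C
    using nt by simp
  define bad where "bad n x \<longleftrightarrow> n \<le> snd x \<and> (\<forall>C'. (\<forall>i<snd x. (i \<in> C') = (i \<in> fst x)) \<longrightarrow> \<not> (\<exists>f. solves p z m n C' f))"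
    for n :: nat and x :: "nat set \<times> nat"
  define ext where "ext x y \<longleftrightarrow> snd x \<le> snd y \<and> (\<forall>i<snd x. (i \<in> fst y) = (i \<in> fst x))"
    for x y :: "nat set \<times> nat"
  have step: "\<exists>y. bad n y \<and> ext x y" for n x
  proof -
    obtain C' where C': "(\<forall>i<snd x. (i \<in> C') = (i \<in> fst x))" "\<not> (\<exists>f. solves p z m n C' f)"
      using neg[of "snd x" "fst x" n] by (elim exE conjE) (rule that)
    have "\<exists>K. \<forall>D. (\<forall>i<K. (i \<in> D) = (i \<in> C')) \<longrightarrow> \<not> (\<exists>f. solves p z m n D f)"
    proof (rule ccontr)
      assume *: "\<not> (\<exists>K. \<forall>D. (\<forall>i<K. (i \<in> D) = (i \<in> C')) \<longrightarrow> \<not> (\<exists>f. solves p z m n D f))"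
      have "\<exists>f. solves p z m n C' f"
      proof (rule solves_closed[OF p])
        fix K
        show "\<exists>D f. (\<forall>i<K. (i \<in> D) = (i \<in> C')) \<and> solves p z m n D f" using * by simp
      qed
      then show False using C'(2) by contradiction
    qed
    then obtain K where K: "\<forall>D. (\<forall>i<K. (i \<in> D) = (i \<in> C')) \<longrightarrow> \<not> (\<exists>f. solves p z m n D f)" ..
    define K' where "K' = max K (max n (snd x))"
    have agree: "(\<forall>i<K. (i \<in> D) = (i \<in> C'))" if "(\<forall>i<K'. (i \<in> D) = (i \<in> C'))" for D
      using that by (simp add: K'_def)
    have "bad n (C', K')"
      unfolding bad_def fst_conv snd_conv
    proof (intro conjI allI impI)
      show "n \<le> K'" by (simp add: K'_def)
      show "\<not> (\<exists>f. solves p z m n D f)" if "(\<forall>i<K'. (i \<in> D) = (i \<in> C'))" for D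
        using K[THEN spec, THEN mp, OF agree[OF that]] .
    qed
    moreover have "ext x (C', K')" using C' by (simp add: ext_def K'_def)
    ultimately show ?thesis by blast
  qed
  have "\<exists>s. \<forall>n. bad n (s n) \<and> ext (s n) (s (Suc n))"
  proof (rule dependent_nat_choice)
    show "\<exists>x. bad 0 x" using step[of 0 undefined] by (elim exE conjE) (rule exI)
    show "\<exists>y. bad (Suc n) y \<and> ext x y" for x n by (rule step)
  qed
  then obtain s where s: "\<And>n. bad n (s n)" "\<And>n. ext (s n) (s (Suc n))" by blast
  have chain: "ext (s i) (s j)" if "i \<le> j" for i j
    using that
  proof (induction j rule: dec_induct)
    case base
    then show ?case by (simp add: ext_def)
  next
    case (step j)
    from step.IH s(2)[of j] show ?case unfolding ext_def by (meson less_le_trans order_trans)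
  qed
  \<comment> \<open>The \<open>i\<close>-th coordinate is settled from stage \<open>i + 1\<close> on, because \<open>i < snd (s (Suc i))\<close>.\<close>
  define L where "L = {i. i \<in> fst (s (Suc i))}"
  have "(\<forall>i<snd (s n). (i \<in> L) = (i \<in> fst (s n)))" for n
  proof -
    have "i \<in> fst (s (Suc i)) \<longleftrightarrow> i \<in> fst (s n)" if i: "i < snd (s n)" for i
    proof (cases "n \<le> Suc i")
      case True
      from chain[OF this] show ?thesis using i unfolding ext_def by blast
    next
      case False
      then have "ext (s (Suc i)) (s n)" by (intro chain) auto
      moreover have "i < snd (s (Suc i))" using s(1)[of "Suc i"] by (simp add: bad_def)
      ultimately show ?thesis unfolding ext_def by blast
    qed
    then show ?thesis by (simp add: L_def)
  qed
  then have "\<not> (\<exists>f. solves p z m n L f)" for n using s(1)[of n] unfolding bad_def by blast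
  then show False using solves_exists[OF p int] by blast
qed

text \<open>The difference of the solutions for two sets in the cylinder that differ only in \<open>j\<close>.\<close>

lemma uniform_fundamental_functions:
  assumes p: "weight p" and int: "interpolates_on p z m UNIV"
  obtains A B K where "A > 0" "B > 0" "\<And>j. j \<ge> K \<Longrightarrow> \<exists>f. f holomorphic_on UNIV \<and>
      (\<forall>w. norm (f w) \<le> A * exp (B * p w)) \<and>
      (\<forall>k. \<forall>l<m k. fps_expansion f (z k) $ l = (if k = j \<and> l = m j - 1 then 1 else 0))"
proof -
  obtain n K C where nKC: "\<forall>C'. (\<forall>i<K. (i \<in> C') = (i \<in> C)) \<longrightarrow> (\<exists>f. solves p z m n C' f)"
    using solves_uniformly_on_cylinder[OF p int] by (elim exE) (rule that)
  show thesis
  proof (rule that[of "2 * real n + 1" "real n + 1" K])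
    fix j assume j: "j \<ge> K"
    have "(\<forall>i<K. (i \<in> insert j C) = (i \<in> C))" "(\<forall>i<K. (i \<in> (C - {j})) = (i \<in> C))" using j by auto
    from this[THEN nKC[THEN spec, THEN mp]] obtain f g where f: "solves p z m n (insert j C) f" and g: "solves p z m n (C - {j}) g"
      by (elim exE) (rule that)
    have fh: "f holomorphic_on UNIV" "g holomorphic_on UNIV" using f g by (auto simp: solves_def)
    have "norm (f w - g w) \<le> (2 * real n + 1) * exp ((real n + 1) * p w)" for w
    proof -
      have "norm (f w) \<le> real n * exp (real n * p w)" "norm (g w) \<le> real n * exp (real n * p w)"
        using f g by (simp_all add: solves_def)
      then have "norm (f w - g w) \<le> 2 * real n * exp (real n * p w)"
        using norm_triangle_ineq4[of "f w" "g w"] by linarith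
      also have "\<dots> \<le> (2 * real n + 1) * exp ((real n + 1) * p w)"
        using weight_nonneg[OF p, of w] by (intro mult_mono) (auto intro!: mult_right_mono)
      finally show ?thesis .
    qed
    moreover have "fps_expansion (\<lambda>w. f w - g w) (z k) $ l = (if k = j \<and> l = m j - 1 then 1 else 0)"
      if "l < m k" for k l
      using f g that by (auto simp: fps_expansion_entire_diff[OF fh] solves_def top_jets_def)
    ultimately show "\<exists>f. f holomorphic_on UNIV \<and>
      (\<forall>w. norm (f w) \<le> (2 * real n + 1) * exp ((real n + 1) * p w)) \<and>
      (\<forall>k. \<forall>l<m k. fps_expansion f (z k) $ l = (if k = j \<and> l = m j - 1 then 1 else 0))"
      by (intro exI[of _ "\<lambda>w. f w - g w"]) (auto intro!: holomorphic_intros fh)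
  qed auto
qed

lemma entire_divide_zeros:
  assumes G: "finite G" and f: "f holomorphic_on UNIV" and inj: "inj_on a G"
    and van: "\<And>k l. k \<in> G \<Longrightarrow> l < m k \<Longrightarrow> fps_expansion f (a k) $ l = 0"
  shows "\<exists>h. h holomorphic_on UNIV \<and> (\<forall>w. f w = (\<Prod>k\<in>G. (w - a k) ^ m k) * h w)"
  using assms
proof (induction G rule: finite_induct)
  case empty
  then show ?case by auto
next
  case (insert x G)
  then obtain h where h: "h holomorphic_on UNIV" "\<And>w. f w = (\<Prod>k\<in>G. (w - a k) ^ m k) * h w"
    by (auto simp: inj_on_def)
  have "f = (\<lambda>w. (\<Prod>k\<in>G. (w - a k) ^ m k) * h w)" using h(2) by auto
  then have "\<forall>l<m x. fps_expansion h (a x) $ l = 0"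
    using insert.prems(3)[of x] insert.hyps insert.prems(2)
    by (intro allI impI fps_expansion_vanish_cancel[of "\<lambda>w. \<Prod>k\<in>G. (w - a k) ^ m k" h "a x" "m x"])
       (auto intro!: holomorphic_intros h simp: inj_on_def)
  then obtain g where "g holomorphic_on UNIV" "\<And>w. h w = (w - a x) ^ m x * g w"
    using entire_divide_zero[OF h(1)] by blast
  then show ?case using h insert.hyps by (intro exI[of _ g]) auto
qed

text \<open>Replacing each factor \<open>w - a k\<close> of \<open>f\<close> by \<open>(\<rho>\<^sup>2 - cnj (a k - c) * (w - c)) / \<rho>\<close>, which has the same
modulus on the circle, gives a function without these zeros; its value at the centre is bounded by
the maximum of \<open>|f|\<close> on the circle.\<close>

lemma Jensen_inequality:
  assumes G: "finite G" and f: "f holomorphic_on UNIV" and inj: "inj_on a G" and \<rho>: "\<rho> > 0"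
    and a: "\<And>k. k \<in> G \<Longrightarrow> a k \<noteq> c"
    and van: "\<And>k l. k \<in> G \<Longrightarrow> l < m k \<Longrightarrow> fps_expansion f (a k) $ l = 0"
    and c: "\<And>l. l < s \<Longrightarrow> fps_expansion f c $ l = 0" "fps_expansion f c $ s = 1"
    and B: "\<And>w. norm (w - c) = \<rho> \<Longrightarrow> norm (f w) \<le> B"
  shows "(\<Sum>k\<in>G. real (m k) * ln (\<rho> / norm (c - a k))) + real s * ln \<rho> \<le> ln B"
proof -
  obtain g where g: "g holomorphic_on UNIV" "\<And>w. f w = (w - c) ^ s * g w"
    using entire_divide_zero[OF f, of s c] c(1) by blast
  have feq: "f = (\<lambda>w. (w - c) ^ s * g w)" using g(2) by auto
  have "fps_expansion f c = fps_X ^ s * fps_expansion g c"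
    unfolding feq by (subst fps_expansion_entire_mult) (auto intro!: holomorphic_intros g simp: fps_expansion_linear_power)
  then have gc: "g c = 1" using c(2) by (simp add: fps_X_power_mult_nth fps_expansion_def)
  have gv: "fps_expansion g (a k) $ l = 0" if "k \<in> G" "l < m k" for k l
    using van[OF that(1)] that a[OF that(1)] unfolding feq
    by (intro fps_expansion_vanish_cancel[of "\<lambda>w. (w - c) ^ s" g "a k" "m k"]) (auto intro!: holomorphic_intros g)
  obtain h where h: "h holomorphic_on UNIV" "\<And>w. g w = (\<Prod>k\<in>G. (w - a k) ^ m k) * h w"
    using entire_divide_zeros[OF G g(1) inj gv] by blast
  define H where "H w = of_real \<rho> ^ s * h w * (\<Prod>k\<in>G. ((of_real \<rho> ^ 2 - cnj (a k - c) * (w - c)) / of_real \<rho>) ^ m k)" for w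
  have Hh: "H holomorphic_on UNIV" unfolding H_def using \<rho> by (intro holomorphic_intros h) auto
  have "norm (H w) \<le> B" if w: "norm (w - c) = \<rho>" for w
  proof -
    have e: "norm ((of_real \<rho> ^ 2 - cnj (a k - c) * (w - c)) / of_real \<rho>) = norm (w - a k)" for k
    proof -
      have "of_real \<rho> ^ 2 - cnj (a k - c) * (w - c) = cnj (w - a k) * (w - c)"
        using complex_norm_square[of "w - c"] w by (simp add: algebra_simps power2_eq_square)
      then show ?thesis using \<rho> w by (simp only: norm_divide norm_mult complex_mod_cnj) simp
    qed
    have "norm (H w) = \<rho> ^ s * norm (h w) * (\<Prod>k\<in>G. norm (w - a k) ^ m k)"
      using \<rho> by (simp only: H_def norm_mult norm_power prod_norm[symmetric] e) simp
    also have "\<dots> = norm (f w)" by (simp add: g(2) h(2) norm_mult norm_power prod_norm[symmetric] w)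
    also have "\<dots> \<le> B" by (rule B[OF w])
    finally show ?thesis .
  qed
  then have "norm (fps_expansion H c $ 0) \<le> B / \<rho> ^ 0"
    by (intro fps_expansion_Cauchy_bound_entire Hh \<rho>) auto
  then have HB: "norm (H c) \<le> B" by (simp add: fps_expansion_def)
  have hc: "(\<Prod>k\<in>G. norm (c - a k) ^ m k) * norm (h c) = 1"
    using arg_cong[OF h(2)[of c], of norm] by (simp add: gc norm_mult norm_power prod_norm[symmetric])
  have d: "norm (c - a k) > 0" if "k \<in> G" for k using a[OF that] by simp
  have "norm (H c) = \<rho> ^ s * norm (h c) * (\<Prod>k\<in>G. \<rho> ^ m k)"
    using \<rho> by (simp add: H_def norm_mult norm_power prod_norm[symmetric] power2_eq_square)
  also have "\<dots> = \<rho> ^ s * (\<Prod>k\<in>G. (\<rho> / norm (c - a k)) ^ m k) * ((\<Prod>k\<in>G. norm (c - a k) ^ m k) * norm (h c))"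
  proof -
    have "(\<Prod>k\<in>G. \<rho> ^ m k) = (\<Prod>k\<in>G. (\<rho> / norm (c - a k)) ^ m k * norm (c - a k) ^ m k)"
      using d by (intro prod.cong) (auto simp: power_divide)
    then show ?thesis by (simp add: prod.distrib)
  qed
  finally have "norm (H c) = \<rho> ^ s * (\<Prod>k\<in>G. (\<rho> / norm (c - a k)) ^ m k)" by (simp add: hc)
  also have "\<dots> = exp (real s * ln \<rho>) * exp (\<Sum>k\<in>G. real (m k) * ln (\<rho> / norm (c - a k)))"
    unfolding exp_sum[OF G] using \<rho> d by (auto simp: exp_of_nat_mult intro!: prod.cong)
  finally have "exp ((\<Sum>k\<in>G. real (m k) * ln (\<rho> / norm (c - a k))) + real s * ln \<rho>) \<le> B"
    using HB by (simp add: exp_add mult.commute)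
  then show ?thesis by (meson exp_gt_zero less_le_trans ln_ge_iff)
qed

section \<open>Radial weights that are log-convex in the logarithm of the modulus\<close>

text \<open>At the endpoint \<open>t0\<close> the one-sided derivative is the limit of slopes of chords, and these increase.\<close>

lemma convex_above_tangent_atLeast:
  fixes q q' :: "real \<Rightarrow> real"
  assumes q: "convex_on {t0..} q" and d: "\<And>t. t \<ge> t0 \<Longrightarrow> (q has_real_derivative q' t) (at t within {t0..})"
    and ts: "t \<ge> t0" "s \<ge> t0"
  shows "q t + q' t * (s - t) \<le> q s"
proof -
  consider "t > t0" | "t = t0" "s = t0" | "t = t0" "s > t0" using ts by linarith
  then show ?thesis
  proof cases
    case 1
    then have "t \<in> interior {t0..}" by simp
    from convex_on_imp_above_tangent[OF q _ this _ d[OF ts(1)], of s] ts show ?thesis by auto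
  next
    case 2
    then show ?thesis by simp
  next
    case 3
    have slope: "(q u - q t0) / (u - t0) \<le> (q s - q t0) / (s - t0)" if u: "t0 < u" "u < s" for u
    proof -
      define h where "h = (u - t0) / (s - t0)"
      have h: "0 \<le> h" "h \<le> 1" using u by (auto simp: h_def)
      have "u = (1 - h) * t0 + h * s"
      proof -
        have "h * (s - t0) = u - t0" using u by (simp add: h_def)
        then show ?thesis by (simp add: algebra_simps)
      qed
      then have "q u \<le> (1 - h) * q t0 + h * q s"
        using convex_onD[OF q, of h t0 s] h 3 by simp
      then have "q u - q t0 \<le> h * (q s - q t0)" by (simp add: algebra_simps)
      also have "\<dots> = (q s - q t0) / (s - t0) * (u - t0)" by (simp add: h_def)
      finally show ?thesis using u by (simp add: pos_divide_le_eq)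
    qed
    have "((\<lambda>u. (q u - q t0) / (u - t0)) \<longlongrightarrow> q' t0) (at t0 within {t0..})"
      using d[of t0] by (simp add: has_field_derivative_iff)
    moreover have "eventually (\<lambda>u. (q u - q t0) / (u - t0) \<le> (q s - q t0) / (s - t0)) (at t0 within {t0..})"
      unfolding eventually_at using 3 slope by (intro exI[of _ "s - t0"]) (auto simp: dist_real_def)
    moreover have "at t0 within {t0..} \<noteq> bot"
      by (simp add: at_within_Ici_at_right)
    ultimately have "q' t0 \<le> (q s - q t0) / (s - t0)" by (rule tendsto_upperbound)
    then show ?thesis using 3 by (simp add: pos_le_divide_eq algebra_simps)
  qed
qed

text \<open>The weight is replaced by its value at \<open>r0\<close> inside the disc of radius \<open>r0\<close>, since there its values are
not controlled by \<open>q\<close>. The lower bound is the tangent inequality for \<open>q\<close>. For the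
upper bound, \<open>q (ln r)\<close> has the derivative \<open>q' (ln r) / r\<close>, which is nonincreasing.\<close>

lemma regular_growth_of_weight:
  assumes p: "weight p" and r0: "r0 > 0"
    and pp: "\<And>r. r \<ge> r0 \<Longrightarrow> p (of_real r) > 0"
    and d: "\<And>t. t \<ge> ln r0 \<Longrightarrow> (log_profile p has_real_derivative q' t) (at t within {ln r0..})"
    and cv: "convex_on {ln r0..} (log_profile p)"
    and a: "q' (ln r0) > 0"
    and mono: "mono_on {r0..} (\<lambda>r. r / q' (ln r))"
  obtains M where "regular_growth (\<lambda>w. p (of_real (max (norm w) r0))) (\<lambda>w. q' (ln (norm w)))
    r0 (q' (ln r0)) (r0 / q' (ln r0)) (p (of_real r0)) M"
proof -
  define q where "q = log_profile p"
  define t0 where "t0 = ln r0"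
  define P where "P w = p (of_real (max (norm w) r0))" for w :: complex
  have tangent: "q t + q' t * (s - t) \<le> q s" if "t \<ge> t0" "s \<ge> t0" for s t
    using convex_above_tangent_atLeast[OF cv d, of t s] that by (simp add: q_def t0_def)
  have q'mono: "q' t \<le> q' s" if "t \<ge> t0" "t \<le> s" for s t
  proof (cases "t = s")
    case False
    have "q' t * (s - t) \<le> q' s * (s - t)"
      using tangent[of t s] tangent[of s t] that by (simp add: algebra_simps)
    then show ?thesis using False that by (simp add: mult_le_cancel_right)
  qed simp
  have lnr: "ln r \<ge> t0" if "r \<ge> r0" for r using that r0 by (simp add: t0_def)
  have k: "q' t0 \<le> q' (ln r)" "0 < q' (ln r)" if "r \<ge> r0" for r
  proof -
    show "q' t0 \<le> q' (ln r)" using q'mono[OF order_refl lnr[OF that]] .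
    then show "0 < q' (ln r)" using a by (simp add: t0_def)
  qed
  have Pe: "P w = exp (q (ln (max (norm w) r0)))" for w
  proof -
    have "max (norm w) r0 > 0" using r0 by simp
    then show ?thesis using pp[of "max (norm w) r0"] by (simp add: P_def q_def log_profile_def)
  qed
  have qmono: "q (ln r) \<le> q (ln s)" if "r0 \<le> r" "r \<le> s" for r s
  proof -
    have "ln r \<le> ln s" using that r0 by simp
    then have "0 \<le> q' (ln r) * (ln s - ln r)" using k(2)[OF that(1)] by simp
    then show ?thesis using tangent[of "ln r" "ln s"] lnr[of r] lnr[of s] that by linarith
  qed
  obtain M0 where M0: "M0 > 0" "\<And>w. 1 + (norm w)\<^sup>2 \<le> M0 * exp (M0 * p w)" using weight_log[OF p] by blast
  have "regular_growth P (\<lambda>w. q' (ln (norm w))) r0 (q' t0) (r0 / q' t0) (p (of_real r0)) M0"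
  proof
    show "0 < r0" "0 < M0" by fact+
    show "0 < q' t0" using a by (simp add: t0_def)
    then show "0 < r0 / q' t0" using r0 by simp
    show "0 < p (of_real r0)" using pp by simp
    show "p (of_real r0) \<le> P w" for w
    proof -
      have "p (of_real r0) = P 0" using r0 by (simp add: P_def)
      then show ?thesis unfolding Pe using qmono[of r0 "max (norm w) r0"] r0 by simp
    qed
    show "1 + (norm w)\<^sup>2 \<le> M0 * exp (M0 * P w)" for w
    proof -
      define r where "r = max (norm w) r0"
      have "(norm w)\<^sup>2 \<le> r\<^sup>2" by (intro power_mono) (auto simp: r_def)
      moreover have "1 + r\<^sup>2 \<le> M0 * exp (M0 * P w)"
        using M0(2)[of "of_real r"] by (simp add: P_def r_def)
      ultimately show ?thesis by linarith
    qed
    fix \<zeta> :: complex assume \<zeta>: "r0 \<le> norm \<zeta>"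
    have z0: "norm \<zeta> > 0" using \<zeta> r0 by linarith
    have Pz: "P \<zeta> = exp (q (ln (norm \<zeta>)))" using \<zeta> by (simp add: Pe max_absorb1)
    show "q' t0 \<le> q' (ln (norm \<zeta>))" by (rule k[OF \<zeta>])
    have "r0 / q' t0 \<le> norm \<zeta> / q' (ln (norm \<zeta>))"
      using mono_onD[OF mono, of r0 "norm \<zeta>"] \<zeta> by (simp add: t0_def)
    then show "r0 / q' t0 * q' (ln (norm \<zeta>)) \<le> norm \<zeta>" using k(2)[OF \<zeta>] by (simp add: pos_le_divide_eq)
    show "P \<zeta> * norm (w / \<zeta>) powr q' (ln (norm \<zeta>)) \<le> P w" for w
    proof -
      define r where "r = max (norm w) r0"
      have r: "r \<ge> r0" "r \<ge> norm w" "r > 0" using r0 by (auto simp: r_def)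
      have "norm (w / \<zeta>) powr q' (ln (norm \<zeta>)) \<le> (r / norm \<zeta>) powr q' (ln (norm \<zeta>))"
        using r z0 k(2)[OF \<zeta>] by (intro powr_mono2) (auto simp: norm_divide divide_right_mono)
      also have "\<dots> = exp (q' (ln (norm \<zeta>)) * (ln r - ln (norm \<zeta>)))"
        using r z0 by (simp add: powr_def ln_div)
      finally have "P \<zeta> * norm (w / \<zeta>) powr q' (ln (norm \<zeta>)) \<le> P \<zeta> * exp (q' (ln (norm \<zeta>)) * (ln r - ln (norm \<zeta>)))"
        by (intro mult_left_mono) (auto simp: Pz)
      also have "\<dots> = exp (q (ln (norm \<zeta>)) + q' (ln (norm \<zeta>)) * (ln r - ln (norm \<zeta>)))"
        by (simp add: Pz exp_add)
      also have "\<dots> \<le> exp (q (ln r))" using tangent[OF lnr[OF \<zeta>] lnr[OF r(1)]] by simp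
      also have "\<dots> = P w" by (simp add: Pe r_def)
      finally show ?thesis .
    qed
    show "P w \<le> P \<zeta> * exp (q' (ln (norm \<zeta>)) * norm (w - \<zeta>) / norm \<zeta>)" for w
    proof (cases "norm w \<le> norm \<zeta>")
      case True
      then have "P w \<le> P \<zeta>" unfolding Pe using \<zeta> by (subst exp_le_cancel_iff, intro qmono) auto
      also have "P \<zeta> * 1 \<le> P \<zeta> * exp (q' (ln (norm \<zeta>)) * norm (w - \<zeta>) / norm \<zeta>)"
        using k(2)[OF \<zeta>] z0 by (intro mult_left_mono) (auto simp: Pz)
      finally show ?thesis by simp
    next
      case False
      define \<kappa> where "\<kappa> = q' (ln (norm \<zeta>))"
      define g where "g x = q (ln x)" for x
      have lt: "norm \<zeta> < norm w" using False by simp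
      have gd: "(g has_real_derivative q' (ln x) / x) (at x)" if x: "norm \<zeta> < x" for x
      proof -
        have x0: "x > 0" using x z0 by linarith
        have "ln x > t0" using x \<zeta> r0 by (simp add: t0_def)
        then have "(q has_real_derivative q' (ln x)) (at (ln x))"
          using d[of "ln x"] at_within_interior[of "ln x" "{t0..}"] by (simp add: q_def t0_def)
        from DERIV_chain2[OF this DERIV_ln[OF x0]] show ?thesis by (simp add: g_def[abs_def] divide_inverse)
      qed
      have gc: "continuous_on {norm \<zeta>..norm w} g"
        unfolding g_def
      proof (rule continuous_on_compose2[of "{t0..}" q])
        show "continuous_on {t0..} q"
          using d by (intro DERIV_continuous_on[of _ _ q']) (auto simp: q_def t0_def)
        show "continuous_on {norm \<zeta>..norm w} ln" using z0 by (intro continuous_intros) auto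
        show "ln ` {norm \<zeta>..norm w} \<subseteq> {t0..}" using \<zeta> lnr by auto
      qed
      obtain l x where x: "norm \<zeta> < x" "x < norm w" "(g has_real_derivative l) (at x)"
          "g (norm w) - g (norm \<zeta>) = (norm w - norm \<zeta>) * l"
        using MVT[OF lt gc] gd real_differentiable_def by blast
      have l: "l = q' (ln x) / x" using DERIV_unique[OF x(3) gd[OF x(1)]] .
      have x0: "x \<ge> r0" "x > 0" using x(1) \<zeta> z0 by linarith+
      have "norm \<zeta> / \<kappa> \<le> x / q' (ln x)"
        using mono_onD[OF mono, of "norm \<zeta>" x] \<zeta> x(1) x0 by (simp add: \<kappa>_def)
      then have "l \<le> \<kappa> / norm \<zeta>"
        using k(2)[OF \<zeta>] k(2)[OF x0(1)] z0 x0 by (simp add: l \<kappa>_def field_simps)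
      then have "(norm w - norm \<zeta>) * l \<le> (norm w - norm \<zeta>) * (\<kappa> / norm \<zeta>)"
        using lt by (intro mult_left_mono) auto
      also have "\<dots> \<le> norm (w - \<zeta>) * (\<kappa> / norm \<zeta>)"
        using k(2)[OF \<zeta>] z0 norm_triangle_ineq2[of w \<zeta>] by (intro mult_right_mono) (auto simp: \<kappa>_def)
      finally have "g (norm w) \<le> g (norm \<zeta>) + \<kappa> * norm (w - \<zeta>) / norm \<zeta>" using x(4) by (simp add: mult.commute)
      then have "exp (g (norm w)) \<le> exp (g (norm \<zeta>)) * exp (\<kappa> * norm (w - \<zeta>) / norm \<zeta>)"
        by (simp add: exp_add[symmetric])
      moreover have "P w = exp (g (norm w))" using False \<zeta> by (simp add: Pe g_def max_absorb1)
      ultimately show ?thesis by (simp add: Pz g_def \<kappa>_def)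
    qed
  qed
  then show thesis using that unfolding P_def t0_def by blast
qed

lemma cofinite_far_points:
  assumes "multiplicity_variety z m"
  shows "finite {j. norm (z j) < r}" "\<exists>j. r \<le> norm (z j)"
proof -
  show f: "finite {j. norm (z j) < r}"
    by (rule finite_subset[OF _ finite_multiplicity_variety_disc[OF assms, of 0 r]]) auto
  show "\<exists>j. r \<le> norm (z j)"
  proof (rule ccontr)
    assume "\<not> (\<exists>j. r \<le> norm (z j))"
    then have "{j. norm (z j) < r} = UNIV" by (auto simp: not_le)
    then show False using f by simp
  qed
qed

theorem theorem1p13:
  fixes p :: "complex \<Rightarrow> real" and r0 :: real and q' :: "real \<Rightarrow> real"
    and z :: "nat \<Rightarrow> complex" and m :: "nat \<Rightarrow> nat"
  assumes "weight p" and "radial p"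
    and "r0 > 0"
    and "\<And>r. r \<ge> r0 \<Longrightarrow> p (of_real r) > 0"
    and "C2_on (\<lambda>r. p (of_real r)) {r0..}"
    and "\<And>t. t \<ge> ln r0 \<Longrightarrow>
           (log_profile p has_real_derivative q' t) (at t within {ln r0..})"
    and "convex_on {ln r0..} (log_profile p)"
    and "q' (ln r0) > 0"
    and "mono_on {r0..} (\<lambda>r. r / q' (ln r))"
    and "multiplicity_variety z m"
  shows "interpolating_variety p z m \<longleftrightarrow>
    (\<exists>A>0. \<exists>B>0. \<forall>j. norm (z j) \<ge> r0 \<longrightarrow>
       N_count z m (z j) (max (norm (z j) / q' (ln (norm (z j)))) (exp 1)) \<le> A * p (z j) + B)"
proof -
  define P where "P w = p (of_real (max (norm w) r0))" for w :: complex
  define \<kappa> where "\<kappa> w = q' (ln (norm w))" for w :: complex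
  define a where "a = q' (ln r0)"
  define p0 where "p0 = p (of_real r0)"
  define \<rho> where "\<rho> j = max (norm (z j) / \<kappa> (z j)) (exp 1)" for j
  obtain M where RG: "regular_growth P \<kappa> r0 a (r0 / a) p0 M"
    using regular_growth_of_weight[OF assms(1,3,4,6-9)]
    unfolding P_def \<kappa>_def a_def p0_def by blast
  interpret regular_growth P \<kappa> r0 a "r0 / a" p0 M by (rule RG)
  have Pp: "P w = p w" if "r0 \<le> norm w" for w
    using that assms(2) by (simp add: P_def max_absorb1 radial_def)
  have PC: "P w \<le> p w + p0" for w
  proof (cases "r0 \<le> norm w")
    case True
    then show ?thesis using Pp pos by simp
  next
    case False
    then show ?thesis using weight_nonneg[OF assms(1), of w] by (simp add: P_def p0_def max_absorb2)
  qed
  have inj: "inj z" and mpos: "\<And>j. m j > 0" using assms(10) by (auto simp: multiplicity_variety_def)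
  have rho1: "\<rho> j \<ge> exp 1" for j by (simp add: \<rho>_def)
  then have rho0: "\<rho> j > 0" for j by (meson exp_gt_zero less_le_trans)
  have "interpolates_on p z m UNIV \<longleftrightarrow> (\<exists>A>0. \<exists>B>0. \<forall>j. norm (z j) \<ge> r0 \<longrightarrow> N_count z m (z j) (\<rho> j) \<le> A * p (z j) + B)"
  proof
    assume "\<exists>A>0. \<exists>B>0. \<forall>j. norm (z j) \<ge> r0 \<longrightarrow> N_count z m (z j) (\<rho> j) \<le> A * p (z j) + B"
    then obtain A B where AB: "A > 0" "B > 0" "\<And>j. norm (z j) \<ge> r0 \<Longrightarrow> N_count z m (z j) (\<rho> j) \<le> A * p (z j) + B"
      by blast
    interpret sparse_variety P \<kappa> r0 a "r0 / a" p0 M z m \<rho> "A + B / p0"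
    proof
      show "multiplicity_variety z m" by fact
      show "0 < A + B / p0" using AB pos by (simp add: add_pos_pos)
      fix j assume j: "r0 \<le> norm (z j)"
      show "norm (z j) / \<kappa> (z j) \<le> \<rho> j" "exp 1 \<le> \<rho> j" by (auto simp: \<rho>_def)
      have "B * 1 \<le> B * (P (z j) / p0)" using AB P_ge[of "z j"] pos by (intro mult_left_mono) auto
      then show "N_count z m (z j) (\<rho> j) \<le> (A + B / p0) * P (z j)"
        using AB(3)[OF j] Pp[OF j] by (simp add: distrib_right)
    qed
    have far_r0: "r0 \<le> norm (z j)" if "j \<in> far" for j using that pos unfolding far_def by simp
    have "interpolates_on p z m far"
      unfolding interpolates_on_def
    proof (intro allI impI)
      fix w :: "nat \<Rightarrow> nat \<Rightarrow> complex"
      assume "\<exists>A>0. \<exists>B>0. \<forall>j\<in>far. (\<Sum>l<m j. norm (w j l)) \<le> A * exp (B * p (z j))"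
      then obtain A0 B0 where w: "A0 > 0" "\<And>j. j \<in> far \<Longrightarrow> (\<Sum>l<m j. norm (w j l)) \<le> A0 * exp (B0 * p (z j))"
        by blast
      have "norm (w j l) \<le> A0 * exp (B0 * P (z j))" if "j \<in> far" "l < m j" for j l
        using w(2)[OF that(1)] member_le_sum[of l "{..<m j}" "\<lambda>l. norm (w j l)"] that Pp[OF far_r0[OF that(1)]] by simp
      then obtain f A1 B1 where f: "f holomorphic_on UNIV" "A1 > 0" "B1 > 0" "\<And>u. norm (f u) \<le> A1 * exp (B1 * P u)"
          "\<forall>j\<in>far. \<forall>l<m j. fps_expansion f (z j) $ l = w j l"
        using interpolation_far_points[of A0 w B0] w(1) by auto
      have "norm (f u) \<le> (A1 * exp (B1 * p0)) * exp (B1 * p u)" for u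
      proof -
        have "B1 * P u \<le> B1 * p0 + B1 * p u" using PC[of u] f(3) by (simp add: distrib_left[symmetric])
        then have "A1 * exp (B1 * P u) \<le> A1 * exp (B1 * p0 + B1 * p u)" using f(2) by simp
        then show ?thesis using f(4)[of u] by (simp add: exp_add)
      qed
      then have "f \<in> A_space p" by (rule A_spaceI[OF assms(1) f(1)])
      then show "\<exists>f\<in>A_space p. \<forall>j\<in>far. \<forall>l<m j. fps_expansion f (z j) $ l = w j l" using f(5) by blast
    qed
    moreover have "far \<noteq> {}" using cofinite_far_points(2)[OF assms(10)] unfolding far_def by blast
    moreover have "finite {j. norm (z j) < 2 * r0}" by (rule cofinite_far_points(1)[OF assms(10)])
    ultimately have "interpolates_on p z m (far \<union> {j. norm (z j) < 2 * r0})"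
      by (rule interpolates_on_Un_finite[OF assms(1) _ _ mpos inj])
    moreover have "far \<union> {j. norm (z j) < 2 * r0} = UNIV" unfolding far_def by auto
    ultimately show "interpolates_on p z m UNIV" by simp
  next
    assume int: "interpolates_on p z m UNIV"
    obtain A B K where AB: "A > 0" "B > 0" and fund: "\<And>j. j \<ge> K \<Longrightarrow> \<exists>f. f holomorphic_on UNIV \<and>
      (\<forall>w. norm (f w) \<le> A * exp (B * p w)) \<and>
      (\<forall>k. \<forall>l<m k. fps_expansion f (z k) $ l = (if k = j \<and> l = m j - 1 then 1 else 0))"
      using uniform_fundamental_functions[OF assms(1) int] by metis
    obtain M0 where M0: "\<And>w. norm w \<le> r0 \<Longrightarrow> p w \<le> M0" using weight_locally_bounded[OF assms(1)] by blast
    \<comment> \<open>On the circle of radius \<open>\<rho> j\<close> the weight is at most \<open>exp c\<close> times its value at the centre: the ratio of \<open>\<rho> j\<close>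
to \<open>norm (z j) / \<kappa> (z j)\<close> is at most \<open>c\<close>, as that scale is at least \<open>r0 / a\<close>.\<close>
    define c where "c = max 1 (exp 1 * a / r0)"
    define A2 where "A2 = B * exp c + M"
    define B2 where "B2 = \<bar>ln A\<bar> + B * \<bar>M0\<bar> + \<bar>ln (M / a + exp 1)\<bar> + (\<Sum>j<K. \<bar>N_count z m (z j) (\<rho> j)\<bar>) + 1"
    have A2: "A2 > 0" using AB pos by (simp add: A2_def add_pos_pos)
    have B2: "B2 > 0" unfolding B2_def using AB by (intro add_nonneg_pos add_nonneg_nonneg sum_nonneg) auto
    have "N_count z m (z j) (\<rho> j) \<le> A2 * p (z j) + B2" if j: "norm (z j) \<ge> r0" for j
    proof (cases "j < K")
      case True
      have "\<bar>N_count z m (z j) (\<rho> j)\<bar> \<le> (\<Sum>j<K. \<bar>N_count z m (z j) (\<rho> j)\<bar>)"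
        using True by (intro member_le_sum) auto
      moreover have "0 \<le> A2 * p (z j)" using A2 weight_nonneg[OF assms(1)] by simp
      moreover have "0 \<le> B * \<bar>M0\<bar>" using AB by simp
      ultimately show ?thesis unfolding B2_def by linarith
    next
      case False
      then obtain f where f: "f holomorphic_on UNIV" and fb: "\<And>w. norm (f w) \<le> A * exp (B * p w)"
        and fj: "\<And>k l. l < m k \<Longrightarrow> fps_expansion f (z k) $ l = (if k = j \<and> l = m j - 1 then 1 else 0)"
        using fund[of j] by auto
      have kj: "\<kappa> (z j) > 0" using \<kappa>_ge[OF j] pos by linarith
      have zj: "norm (z j) > 0" using j pos by linarith
      have sph: "norm (f w) \<le> A * exp (B * (\<bar>M0\<bar> + exp c * p (z j)))" if w: "norm (w - z j) = \<rho> j" for w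
      proof -
        have "\<kappa> (z j) * \<rho> j / norm (z j) \<le> c"
        proof -
          have "\<kappa> (z j) * \<rho> j / norm (z j) = max 1 (exp 1 * \<kappa> (z j) / norm (z j))"
            using kj zj by (auto simp: \<rho>_def max_def field_simps)
          also have "\<dots> \<le> c"
          proof -
            have "\<kappa> (z j) * r0 \<le> norm (z j) * a" using radius_ge[OF j] pos by (simp add: field_simps)
            then have "exp 1 * (\<kappa> (z j) / norm (z j)) \<le> exp 1 * (a / r0)"
              using zj pos by (intro mult_left_mono) (auto simp: field_simps)
            then show ?thesis by (auto simp: c_def)
          qed
          finally show ?thesis .
        qed
        then have "P (z j) * exp (\<kappa> (z j) * norm (w - z j) / norm (z j)) \<le> P (z j) * exp c"
          unfolding w using P_ge[of "z j"] pos by (intro mult_left_mono) auto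
        then have "P w \<le> exp c * p (z j)" using P_upper[OF j, of w] Pp[OF j] by (simp add: mult.commute)
        moreover have "p w \<le> \<bar>M0\<bar> + P w"
        proof (cases "r0 \<le> norm w")
          case True
          then show ?thesis using Pp by simp
        next
          case False
          then show ?thesis using M0[of w] P_ge[of w] pos by simp
        qed
        ultimately have "B * p w \<le> B * (\<bar>M0\<bar> + exp c * p (z j))" using AB by (intro mult_left_mono) auto
        then have "A * exp (B * p w) \<le> A * exp (B * (\<bar>M0\<bar> + exp c * p (z j)))" using AB by simp
        then show ?thesis using fb[of w] by linarith
      qed
      define G where "G = {k. 0 < norm (z j - z k) \<and> norm (z j - z k) \<le> \<rho> j}"
      have fG: "finite G"
        by (rule finite_subset[OF _ finite_multiplicity_variety_disc[OF assms(10), of "z j" "\<rho> j"]]) (auto simp: G_def)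
      have "(\<Sum>k\<in>G. real (m k) * ln (\<rho> j / norm (z j - z k))) + real (m j - 1) * ln (\<rho> j)
          \<le> ln (A * exp (B * (\<bar>M0\<bar> + exp c * p (z j))))"
      proof (rule Jensen_inequality[OF fG f _ rho0 _ _ _ _ sph])
        show "inj_on z G" using inj by (rule inj_on_subset) simp
        show "z k \<noteq> z j" if "k \<in> G" for k using that by (auto simp: G_def)
        show "fps_expansion f (z k) $ l = 0" if "k \<in> G" "l < m k" for k l
          using fj[OF that(2)] that(1) by (auto simp: G_def)
        show "fps_expansion f (z j) $ l = 0" if "l < m j - 1" for l using fj[of l j] that by simp
        show "fps_expansion f (z j) $ (m j - 1) = 1" using fj[of "m j - 1" j] mpos[of j] by simp
      qed
      also have "\<dots> = ln A + B * \<bar>M0\<bar> + B * exp c * p (z j)"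
        using AB by (simp add: ln_mult distrib_left)
      finally have 1: "(\<Sum>k\<in>G. real (m k) * ln (\<rho> j / norm (z j - z k))) + real (m j - 1) * ln (\<rho> j)
          \<le> ln A + B * \<bar>M0\<bar> + B * exp c * p (z j)" .
      \<comment> \<open>The fundamental function vanishes at \<open>z j\<close> only to order \<open>m j - 1\<close>; the missing \<open>ln (\<rho> j)\<close> is \<open>O(p (z j))\<close>.\<close>
      have n0: "n_count z m (z j) 0 = m j"
      proof -
        have "{k. norm (z j - z k) \<le> 0} = {j}" using inj by (auto dest: injD)
        then show ?thesis by (simp add: n_count_def)
      qed
      have mj: "real (m j) = real (m j - 1) + 1" using mpos[of j] by simp
      have "N_count z m (z j) (\<rho> j) = (\<Sum>k\<in>G. real (m k) * ln (\<rho> j / norm (z j - z k))) + real (m j) * ln (\<rho> j)"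
        unfolding N_count_eq_sum[OF assms(10) rho0] n0 by (simp add: G_def)
      then have 2: "N_count z m (z j) (\<rho> j) = (\<Sum>k\<in>G. real (m k) * ln (\<rho> j / norm (z j - z k))) + real (m j - 1) * ln (\<rho> j) + ln (\<rho> j)"
        unfolding mj by (simp only: distrib_right mult_1 add.assoc)
      have 3: "ln (\<rho> j) \<le> ln (M / a + exp 1) + M * p (z j)"
      proof -
        have e1: "1 \<le> exp (M * p (z j))" using pos weight_nonneg[OF assms(1)] by simp
        have "norm (z j) \<le> 1 + (norm (z j))\<^sup>2"
          using sum_squares_bound[of "norm (z j)" 1] norm_ge_zero[of "z j"] unfolding power2_eq_square by linarith
        also have "\<dots> \<le> M * exp (M * p (z j))" using P_log[of "z j"] Pp[OF j] by simp
        finally have nz: "norm (z j) \<le> M * exp (M * p (z j))" .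
        have "norm (z j) / \<kappa> (z j) \<le> norm (z j) / a"
          using \<kappa>_ge[OF j] pos kj by (intro divide_left_mono) auto
        also have "\<dots> \<le> M * exp (M * p (z j)) / a" using nz pos by (intro divide_right_mono) auto
        finally have u: "norm (z j) / \<kappa> (z j) \<le> M / a * exp (M * p (z j))" by simp
        have v: "exp 1 \<le> exp 1 * exp (M * p (z j))" using mult_left_mono[OF e1, of "exp 1"] by simp
        have "0 \<le> M / a * exp (M * p (z j))" "0 \<le> exp 1 * exp (M * p (z j))" using pos by auto
        then have "\<rho> j \<le> M / a * exp (M * p (z j)) + exp 1 * exp (M * p (z j))"
          unfolding \<rho>_def using u v by (intro max.boundedI) linarith+
        then have "\<rho> j \<le> (M / a + exp 1) * exp (M * p (z j))" by (simp add: distrib_right)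
        then have "ln (\<rho> j) \<le> ln ((M / a + exp 1) * exp (M * p (z j)))" using rho0[of j] by simp
        also have "\<dots> = ln (M / a + exp 1) + M * p (z j)"
        proof -
          have "M / a + exp 1 > 0" using pos by (intro add_pos_pos) auto
          then show ?thesis by (simp add: ln_mult_pos)
        qed
        finally show ?thesis .
      qed
      have 4: "0 \<le> (\<Sum>j<K. \<bar>N_count z m (z j) (\<rho> j)\<bar>)" by (intro sum_nonneg) auto
      have "A2 * p (z j) = B * exp c * p (z j) + M * p (z j)" by (simp add: A2_def distrib_right)
      then show ?thesis using 1 2 3 4 unfolding B2_def by linarith
    qed
    then show "\<exists>A>0. \<exists>B>0. \<forall>j. norm (z j) \<ge> r0 \<longrightarrow> N_count z m (z j) (\<rho> j) \<le> A * p (z j) + B"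
      using A2 B2 by blast
  qed
  then show ?thesis
    unfolding interpolating_variety_iff \<rho>_def \<kappa>_def .
qed

end
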